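(* Let $d\in\mathbb N^*$ and let $\mathbf K:\mathbb R\to\mathbb R$ satisfy: $\int\mathbf K=1$, $\|\mathbf K\|_\infty<\infty$, $\mathrm{supp}(\mathbf K)\subseteq[-1/2,1/2]$, $\mathbf K$ symmetric, and $|\mathbf K(t)-\mathbf K(s)|\le L|t-s|$ for all $t,s\in\mathbb R$, for some $L>0$. Let $\widehat f_{\widehat h,\widehat{\mathcal P}}$ be the data-driven estimator (constructed with $\mathbf K$ and $q$) defined in the context. Then for any $q\ge1$ and any $0<\mathbf f<\infty$ there exist finite constants $\mathbf{C_1}(q,d,\mathbf K,\mathbf f)$ and $\mathbf{C_2}(q,d,\mathbf K,\mathbf f)$, depending only on the indicated quantities, such that for any density $f\in\mathbf F(\mathbf f)$ and any $n\ge3$ $$\left(\mathbb E^{(n)}_f\big\|\widehat f_{\widehat h,\widehat{\mathcal P}}-f\big\|_\infty^q\right)^{1/q}\le \mathbf{C_1}(q,d,\mathbf K,\mathbf f)\,\mathfrak R_n(f)+\mathbf{C_2}(q,d,\mathbf K,\mathbf f)\,n^{-1/2},$$ where $$\mathfrak R_n(f)=\inf_{h\in\mathcal H_n}\ \inf_{\mathcal P\in\mathfrak P(f)}\left(B(h,\mathcal P)+\sqrt{\frac{\ln n}{nV(h,\mathcal P)}}\right).$$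
   Context: **Model.** $X_i=(X_{1,i},\dots,X_{d,i})$, $i\ge1$, are i.i.d. $\mathbb R^d$-valued random vectors with density $f$ with respect to Lebesgue measure; $X^{(n)}=(X_1,\dots,X_n)$ has law $\mathbb P_f^{(n)}$ with expectation $\mathbb E_f^{(n)}$. $\|\cdot\|_\infty$ is the supremum norm. **Sets and partitions.** $\mathcal I_d$ is the set of nonempty subsets $\mathbf I$ of $\{1,\dots,d\}$. For $\mathbf I\in\mathcal I_d$: $|\mathbf I|$ is its cardinality, $x_{\mathbf I}=(x_j)_{j\in\mathbf I}$, $X_{\mathbf I,i}=(X_{j,i})_{j\in\mathbf I}$, $\|g\|_{\mathbf I,\infty}=\sup_{x_{\mathbf I}\in\mathbb R^{|\mathbf I|}}|g(x_{\mathbf I})|$, and $f_{\mathbf I}(x_{\mathbf I})=\int f(x)\,dx_{\bar{\mathbf I}}$, with $\bar{\mathbf I}=\{1,\dots,d\}\setminus\mathbf I$, is the marginal density ($f_{\mathbf I}=f$ if $\mathbf I=\{1,\dots,d\}$). $\mathfrak P$ is the set of all partitions of $\{1,\dots,d\}$ (including the trivial one-block partition), and $$\mathfrak P(f)=\Big\{\mathcal P\in\mathfrak P:\ f(x)=\prod_{\mathbf I\in\mathcal P}f_{\mathbf I}(x_{\mathbf I})\ \ \forall x\in\mathbb R^d\Big\}.$$ For $\mathcal P,\mathcal P'\in\mathfrak P$, $\mathcal P\diamond\mathcal P'=\{\mathbf I\cap\mathbf I'\ne\emptyset:\ \mathbf I\in\mathcal P,\ \mathbf I'\in\mathcal P'\}\in\mathfrak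 P$. **Class of densities.** $\mathbf F(\mathbf f)=\{f:\ \sup_{\mathbf I\in\mathcal I_d}\|f_{\mathbf I}\|_\infty\le\mathbf f\}$. **The function $\gamma_p$.** For $a>0$, $p\ge1$, $s\in\mathbb N^*$, with $L$ the Lipschitz constant of the kernel, $$\gamma_p(s,a)=4e\sqrt{2s\,\tau_p(s,a)\big[a+\tfrac{3L}{2}a^{s-1}\big]}+\tfrac{16e}{3}\Big(s\big[a+\tfrac{3L}{2}a^{s-1}\big]\vee 8a\Big)\tau_p(s,a),$$ $$\tau_p(s,a)=s\big(234s\delta_*^{-2}+6.5p+5.5\big)\ln2+s(2p+3)+\big[108s\delta_*^{-2}|\log a|+36C_s+1\big][\ln3]^{-1},$$ where $\delta_*$ is the smallest solution of $8\pi^2\delta(1+[\ln\delta]^2)=1$, $\phi(\delta)=(6/\pi^2)(1+[\ln\delta]^2)^{-1}$, $C_s=C_s^{(1)}+C_s^{(2)}$, and $$C_s^{(1)}=s\sup_{\delta>\delta_*}\delta^{-2}\Big\{\Big[1+\ln\Big(\tfrac{9216(s+1)\delta^2}{[\phi(\delta)]^2}\Big)\Big]_++1.5\Big[\log_2\Big(\tfrac{4608(s+1)\delta^2}{[\phi(\delta)]^2}\Big)\Big]_+\Big\},$$ $$C_s^{(2)}=s\sup_{\delta>\delta_*}\delta^{-1}\Big\{\Big[1+\ln\Big(\tfrac{9216(s+1)\delta}{\phi(\delta)}\Big)\Big]_++1.5\Big[\log_2\Big(\tfrac{4608(s+1)\delta}{\phi(\delta)}\Big)\Big]_+\Big\}.$$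 **Kernel estimators.** $\mathrm k_m=\|\mathbf K\|_m$, $m\in\{1,\infty\}$. For $h\in(0,1]^d$: $V_{h_{\mathbf I}}=\prod_{j\in\mathbf I}h_j$, $V_h=\prod_{j=1}^dh_j$, $K_{h_{\mathbf I}}(u)=V_{h_{\mathbf I}}^{-1}\prod_{j\in\mathbf I}\mathbf K(u_j/h_j)$, $V(h,\mathcal P)=\inf_{\mathbf I\in\mathcal P}V_{h_{\mathbf I}}$. Put $$\mathcal H_n=\{h\in(0,1]^d:\ nV_h\ge(\mathfrak a^* )^{-1}\ln n\},\qquad \mathfrak a^*=\inf_{\mathbf I\in\mathcal I_d}\big[2\gamma_{2q}(|\mathbf I|,\mathrm k_\infty)\big]^{-2}.$$ (If $\mathcal H_n=\emptyset$, $\mathfrak R_n(f)=+\infty$ and the bound is void.) Define $\widetilde f_{h_{\mathbf I}}(x_{\mathbf I})=n^{-1}\sum_{i=1}^nK_{h_{\mathbf I}}(X_{\mathbf I,i}-x_{\mathbf I})$ and $\widehat f_{h,\mathcal P}(x)=\prod_{\mathbf I\in\mathcal P}\widetilde f_{h_{\mathbf I}}(x_{\mathbf I})$. With $\mathbf K_{b}(u)=b^{-1}\mathbf K(u/b)$ and $[\mathbf K_{h_j}\ast\mathbf K_{\eta_j}](z)=\int_{\mathbb R}\mathbf K_{h_j}(u-z)\mathbf K_{\eta_j}(u)\,du$, let $[K_{h_{\mathbf I}}\star K_{\eta_{\mathbf I}}](u)=\prod_{j\in\mathbf I}[\mathbf K_{h_j}\ast\mathbf K_{\eta_j}](u_j)$,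 $$\widetilde f_{h_{\mathbf I},\eta_{\mathbf I}}(x_{\mathbf I})=n^{-1}\sum_{i=1}^n[K_{h_{\mathbf I}}\star K_{\eta_{\mathbf I}}](X_{\mathbf I,i}-x_{\mathbf I}),\qquad \widehat f_{(h,\mathcal P),(\eta,\mathcal P')}(x)=\prod_{\mathbf J\in\mathcal P\diamond\mathcal P'}\widetilde f_{h_{\mathbf J},\eta_{\mathbf J}}(x_{\mathbf J}).$$ **Selection rule.** Let $$\mathbf f_n=\sup_{h\in\mathcal H_n}\sup_{\mathbf I\in\mathcal I_d}\Big\|n^{-1}\sum_{i=1}^n\big|K_{h_{\mathbf I}}(X_{\mathbf I,i}-\cdot)\big|\Big\|_{\mathbf I,\infty},\quad \bar{\mathbf f}_n=1\vee2\mathbf f_n,\quad \widehat A_n(h,\mathcal P)=\sqrt{\frac{\bar{\mathbf f}_n\ln n}{nV(h,\mathcal P)}},$$ $\Lambda=\sup_{\mathcal P\in\mathfrak P}\sup_{\mathbf I\in\mathcal P}\gamma_{2q}(|\mathbf I|,\mathrm k_\infty)$, $\lambda=\Lambda d(\bar{\mathbf f}_n)^{\lfloor d^2/4\rfloor+1}$, and $$\widehat\Delta_n(h,\mathcal P)=\sup_{\eta\in\mathcal H_n}\sup_{\mathcal P'\in\mathfrak P}\Big[\big\|\widehat f_{(h,\mathcal P),(\eta,\mathcal P')}-\widehat f_{\eta,\mathcal P'}\big\|_\infty-\lambda\widehat A_n(\eta,\mathcal P')\Big]_+.$$ Then $(\widehat h,\widehat{\mathcal P})\in\mathcal H_n\times\mathfrak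 P$ is an $X^{(n)}$-measurable minimizer of $(h,\mathcal P)\mapsto\widehat\Delta_n(h,\mathcal P)+\lambda\widehat A_n(h,\mathcal P)$ over $\mathcal H_n\times\mathfrak P$, and the estimator is $\widehat f_{\widehat h,\widehat{\mathcal P}}$. **Approximation error.** For $h\in(0,1]^d$, $\mathbf I\in\mathcal I_d$, $$b_{h_{\mathbf I}}=\Big\|\int_{\mathbb R^{|\mathbf I|}}K_{h_{\mathbf I}}(t_{\mathbf I}-\cdot)\big[f_{\mathbf I}(t_{\mathbf I})-f_{\mathbf I}(\cdot)\big]dt_{\mathbf I}\Big\|_{\mathbf I,\infty},\qquad B(h,\mathcal P)=\sup_{\mathcal P'\in\mathfrak P}\ \sup_{\mathbf I\in\mathcal P\diamond\mathcal P'}b_{h_{\mathbf I}}.$$ *)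

theory Defs
  imports "HOL-Analysis.Analysis"
begin

text \<open>A point of a Euclidean space with coordinates in a finite index set I is a function in
  \<open>I \<rightarrow>\<^sub>E UNIV\<close>; only the coordinates in I are ever read.  A sample X consists of the points
  \<open>X 1, \<dots>, X n\<close>, and \<open>X i j\<close> is the j-th coordinate of the i-th observation.\<close>

type_synonym point = "nat \<Rightarrow> real"
type_synonym sample = "nat \<Rightarrow> point"

definition leb :: "nat set \<Rightarrow> point measure" where
  "leb I = PiM I (\<lambda>_. lborel)"

text \<open>The supremum norm is a genuine (pointwise) supremum with values in \<open>[0, \<infinity>]\<close>.\<close>

definition supnorm :: "nat set \<Rightarrow> (point \<Rightarrow> real) \<Rightarrow> ennreal" where
  "supnorm I g = (SUP x \<in> I \<rightarrow>\<^sub>E UNIV. ennreal \<bar>g x\<bar>)"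

text \<open>Powers \<open>x\<^sup>a\<close> on \<open>[0, \<infinity>]\<close>, for exponents \<open>a > 0\<close> only.\<close>

definition epowr :: "ennreal \<Rightarrow> real \<Rightarrow> ennreal" where
  "epowr x a = (if x = \<infinity> then \<infinity> else ennreal (enn2real x powr a))"

definition index_sets :: "nat \<Rightarrow> nat set set" where
  "index_sets d = {I. I \<subseteq> {1..d} \<and> I \<noteq> {}}"

definition partitions :: "nat \<Rightarrow> nat set set set" where
  "partitions d = {P. partition_on {1..d} P}"

definition meet :: "nat set set \<Rightarrow> nat set set \<Rightarrow> nat set set"  (infixl \<open>\<diamond>\<close> 70) where
  "P \<diamond> P' = {I \<inter> I' | I I'. I \<in> P \<and> I' \<in> P' \<and> I \<inter> I' \<noteq> {}}"

definition is_density :: "nat \<Rightarrow> (point \<Rightarrow> real) \<Rightarrow> bool" where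
  "is_density d f \<longleftrightarrow>
     f \<in> borel_measurable (leb {1..d}) \<and>
     (\<forall>x \<in> {1..d} \<rightarrow>\<^sub>E UNIV. 0 \<le> f x) \<and>
     (\<integral>\<^sup>+ x. ennreal (f x) \<partial>leb {1..d}) = 1"

text \<open>The marginal is first taken in \<open>[0, \<infinity>]\<close>, because the integral over the remaining
  coordinates can diverge at individual points.  On the class \<open>dens_class\<close> below it is finite
  everywhere, so that its real version \<open>marginal\<close> loses nothing.\<close>

definition emarginal :: "nat \<Rightarrow> (point \<Rightarrow> real) \<Rightarrow> nat set \<Rightarrow> point \<Rightarrow> ennreal" where
  "emarginal d f I x =
     (\<integral>\<^sup>+ y. ennreal (f (merge I ({1..d} - I) (x, y))) \<partial>leb ({1..d} - I))"

definition marginal :: "nat \<Rightarrow> (point \<Rightarrow> real) \<Rightarrow> nat set \<Rightarrow> point \<Rightarrow> real" where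
  "marginal d f I x = enn2real (emarginal d f I x)"

definition dens_class :: "nat \<Rightarrow> real \<Rightarrow> (point \<Rightarrow> real) set" where
  "dens_class d bf = {f. is_density d f \<and>
     (SUP I \<in> index_sets d. SUP x \<in> I \<rightarrow>\<^sub>E UNIV. emarginal d f I x) \<le> ennreal bf}"

definition indep_partitions :: "nat \<Rightarrow> (point \<Rightarrow> real) \<Rightarrow> nat set set set" where
  "indep_partitions d f =
     {P \<in> partitions d. \<forall>x \<in> {1..d} \<rightarrow>\<^sub>E UNIV. f x = (\<Prod>I\<in>P. marginal d f I x)}"

definition law :: "nat \<Rightarrow> (point \<Rightarrow> real) \<Rightarrow> nat \<Rightarrow> sample measure" where
  "law d f n = PiM {1..n} (\<lambda>_. density (leb {1..d}) (\<lambda>x. ennreal (f x)))"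

text \<open>The solution is unique, as \<open>\<delta> \<mapsto> \<delta> (1 + (ln \<delta>)\<^sup>2)\<close> increases strictly on \<open>(0, \<infinity>)\<close>
  from 0 to \<open>\<infinity>\<close>.\<close>

definition delta_star :: real where
  "delta_star = (LEAST \<delta>. 0 < \<delta> \<and> 8 * pi\<^sup>2 * \<delta> * (1 + (ln \<delta>)\<^sup>2) = 1)"

definition phi :: "real \<Rightarrow> real" where
  "phi \<delta> = (6 / pi\<^sup>2) * inverse (1 + (ln \<delta>)\<^sup>2)"

text \<open>The two real suprema are over bounded sets: \<open>delta_star > 0\<close>, and the expressions
  tend to 0 as \<open>\<delta> \<rightarrow> \<infinity>\<close>.\<close>

definition C_s1 :: "nat \<Rightarrow> real" where
  "C_s1 s = real s * (SUP \<delta> \<in> {delta_star<..}. inverse (\<delta>\<^sup>2) *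
     (max 0 (1 + ln (9216 * (real s + 1) * \<delta>\<^sup>2 / (phi \<delta>)\<^sup>2))
      + 1.5 * max 0 (log 2 (4608 * (real s + 1) * \<delta>\<^sup>2 / (phi \<delta>)\<^sup>2))))"

definition C_s2 :: "nat \<Rightarrow> real" where
  "C_s2 s = real s * (SUP \<delta> \<in> {delta_star<..}. inverse \<delta> *
     (max 0 (1 + ln (9216 * (real s + 1) * \<delta> / phi \<delta>))
      + 1.5 * max 0 (log 2 (4608 * (real s + 1) * \<delta> / phi \<delta>))))"

definition C_s :: "nat \<Rightarrow> real" where
  "C_s s = C_s1 s + C_s2 s"

definition tau :: "real \<Rightarrow> nat \<Rightarrow> real \<Rightarrow> real" where
  "tau p s a =
     real s * (234 * real s * inverse (delta_star\<^sup>2) + 6.5 * p + 5.5) * ln 2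
     + real s * (2 * p + 3)
     + (108 * real s * inverse (delta_star\<^sup>2) * \<bar>ln a\<bar> + 36 * C_s s + 1) * inverse (ln 3)"

definition gam :: "real \<Rightarrow> real \<Rightarrow> nat \<Rightarrow> real \<Rightarrow> real" where
  "gam L p s a =
     4 * exp 1 * sqrt (2 * real s * tau p s a * (a + 3 * L / 2 * a ^ (s - 1)))
     + 16 * exp 1 / 3 * max (real s * (a + 3 * L / 2 * a ^ (s - 1))) (8 * a) * tau p s a"

definition kernel_cond :: "(real \<Rightarrow> real) \<Rightarrow> real \<Rightarrow> bool" where
  "kernel_cond K L \<longleftrightarrow>
     integrable lborel K \<and> (\<integral>t. K t \<partial>lborel) = 1 \<and>
     bounded (range K) \<and>
     closure {t. K t \<noteq> 0} \<subseteq> {-1/2..1/2} \<and>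
     (\<forall>t. K (- t) = K t) \<and>
     0 < L \<and> L-lipschitz_on UNIV K"

definition k_inf :: "(real \<Rightarrow> real) \<Rightarrow> real" where
  "k_inf K = (SUP t. \<bar>K t\<bar>)"

definition vol :: "point \<Rightarrow> nat set \<Rightarrow> real" where
  "vol h I = (\<Prod>j\<in>I. h j)"

definition min_vol :: "point \<Rightarrow> nat set set \<Rightarrow> real" where
  "min_vol h P = (INF I\<in>P. vol h I)"

definition kern :: "(real \<Rightarrow> real) \<Rightarrow> point \<Rightarrow> nat set \<Rightarrow> point \<Rightarrow> real" where
  "kern K h I u = inverse (vol h I) * (\<Prod>j\<in>I. K (u j / h j))"

definition a_star :: "(real \<Rightarrow> real) \<Rightarrow> real \<Rightarrow> real \<Rightarrow> nat \<Rightarrow> real" where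
  "a_star K L q d = (INF I \<in> index_sets d. inverse ((2 * gam L (2 * q) (card I) (k_inf K))\<^sup>2))"

definition bandwidths :: "(real \<Rightarrow> real) \<Rightarrow> real \<Rightarrow> real \<Rightarrow> nat \<Rightarrow> nat \<Rightarrow> point set" where
  "bandwidths K L q d n =
     {h \<in> {1..d} \<rightarrow>\<^sub>E {0<..1}. real n * vol h {1..d} \<ge> inverse (a_star K L q d) * ln (real n)}"

definition est1 :: "(real \<Rightarrow> real) \<Rightarrow> nat \<Rightarrow> sample \<Rightarrow> point \<Rightarrow> nat set \<Rightarrow> point \<Rightarrow> real" where
  "est1 K n X h I x = inverse (real n) * (\<Sum>i=1..n. kern K h I (\<lambda>j. X i j - x j))"

definition est :: "(real \<Rightarrow> real) \<Rightarrow> nat \<Rightarrow> sample \<Rightarrow> point \<Rightarrow> nat set set \<Rightarrow> point \<Rightarrow> real" where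
  "est K n X h P x = (\<Prod>I\<in>P. est1 K n X h I x)"

definition kern1 :: "(real \<Rightarrow> real) \<Rightarrow> real \<Rightarrow> real \<Rightarrow> real" where
  "kern1 K b u = inverse b * K (u / b)"

definition conv1 :: "(real \<Rightarrow> real) \<Rightarrow> real \<Rightarrow> real \<Rightarrow> real \<Rightarrow> real" where
  "conv1 K a b z = (\<integral>u. kern1 K a (u - z) * kern1 K b u \<partial>lborel)"

definition conv_kern ::
    "(real \<Rightarrow> real) \<Rightarrow> point \<Rightarrow> point \<Rightarrow> nat set \<Rightarrow> point \<Rightarrow> real" where
  "conv_kern K h \<eta> I u = (\<Prod>j\<in>I. conv1 K (h j) (\<eta> j) (u j))"

definition est1_conv ::
    "(real \<Rightarrow> real) \<Rightarrow> nat \<Rightarrow> sample \<Rightarrow> point \<Rightarrow> point \<Rightarrow> nat set \<Rightarrow> point \<Rightarrow> real" where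
  "est1_conv K n X h \<eta> I x =
     inverse (real n) * (\<Sum>i=1..n. conv_kern K h \<eta> I (\<lambda>j. X i j - x j))"

definition est_conv ::
    "(real \<Rightarrow> real) \<Rightarrow> nat \<Rightarrow> sample \<Rightarrow> point \<Rightarrow> nat set set \<Rightarrow> point \<Rightarrow> nat set set
      \<Rightarrow> point \<Rightarrow> real" where
  "est_conv K n X h P \<eta> P' x = (\<Prod>J \<in> P \<diamond> P'. est1_conv K n X h \<eta> J x)"

text \<open>The supremum is finite for bounded K and \<open>n \<ge> 2\<close>, since \<open>vol h {1..d}\<close> is bounded away
  from 0 on \<open>bandwidths\<close> and \<open>vol h I \<ge> vol h {1..d}\<close>; so \<open>enn2real\<close> loses nothing.\<close>

definition f_n :: "(real \<Rightarrow> real) \<Rightarrow> real \<Rightarrow> real \<Rightarrow> nat \<Rightarrow> nat \<Rightarrow> sample \<Rightarrow> real" where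
  "f_n K L q d n X = enn2real
     (SUP h \<in> bandwidths K L q d n. SUP I \<in> index_sets d.
        supnorm I (\<lambda>x. inverse (real n) * (\<Sum>i=1..n. \<bar>kern K h I (\<lambda>j. X i j - x j)\<bar>)))"

definition fbar_n :: "(real \<Rightarrow> real) \<Rightarrow> real \<Rightarrow> real \<Rightarrow> nat \<Rightarrow> nat \<Rightarrow> sample \<Rightarrow> real" where
  "fbar_n K L q d n X = max 1 (2 * f_n K L q d n X)"

definition A_n ::
    "(real \<Rightarrow> real) \<Rightarrow> real \<Rightarrow> real \<Rightarrow> nat \<Rightarrow> nat \<Rightarrow> sample \<Rightarrow> point \<Rightarrow> nat set set \<Rightarrow> real" where
  "A_n K L q d n X h P = sqrt (fbar_n K L q d n X * ln (real n) / (real n * min_vol h P))"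

definition Lam :: "(real \<Rightarrow> real) \<Rightarrow> real \<Rightarrow> real \<Rightarrow> nat \<Rightarrow> real" where
  "Lam K L q d = (SUP P \<in> partitions d. SUP I \<in> P. gam L (2 * q) (card I) (k_inf K))"

definition lam :: "(real \<Rightarrow> real) \<Rightarrow> real \<Rightarrow> real \<Rightarrow> nat \<Rightarrow> nat \<Rightarrow> sample \<Rightarrow> real" where
  "lam K L q d n X = Lam K L q d * real d * fbar_n K L q d n X ^ (d\<^sup>2 div 4 + 1)"

text \<open>Subtraction on \<^typ>\<open>ennreal\<close> is truncated at 0, i.e. it is the positive part of the
  difference.\<close>

definition Delta_n ::
    "(real \<Rightarrow> real) \<Rightarrow> real \<Rightarrow> real \<Rightarrow> nat \<Rightarrow> nat \<Rightarrow> sample \<Rightarrow> point \<Rightarrow> nat set set \<Rightarrow> ennreal"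
  where
  "Delta_n K L q d n X h P =
     (SUP \<eta> \<in> bandwidths K L q d n. SUP P' \<in> partitions d.
        supnorm {1..d} (\<lambda>x. est_conv K n X h P \<eta> P' x - est K n X \<eta> P' x)
        - ennreal (lam K L q d n X * A_n K L q d n X \<eta> P'))"

definition criterion ::
    "(real \<Rightarrow> real) \<Rightarrow> real \<Rightarrow> real \<Rightarrow> nat \<Rightarrow> nat \<Rightarrow> sample \<Rightarrow> point \<Rightarrow> nat set set \<Rightarrow> ennreal"
  where
  "criterion K L q d n X h P =
     Delta_n K L q d n X h P + ennreal (lam K L q d n X * A_n K L q d n X h P)"

definition is_selection ::
    "(real \<Rightarrow> real) \<Rightarrow> real \<Rightarrow> real \<Rightarrow> nat \<Rightarrow> nat \<Rightarrow>
     (sample \<Rightarrow> point) \<Rightarrow> (sample \<Rightarrow> nat set set) \<Rightarrow> bool" where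
  "is_selection K L q d n hhat Phat \<longleftrightarrow>
     hhat \<in> PiM {1..n} (\<lambda>_. leb {1..d}) \<rightarrow>\<^sub>M leb {1..d} \<and>
     Phat \<in> PiM {1..n} (\<lambda>_. leb {1..d}) \<rightarrow>\<^sub>M count_space (partitions d) \<and>
     (\<forall>X \<in> space (PiM {1..n} (\<lambda>_. leb {1..d})).
        hhat X \<in> bandwidths K L q d n \<and> Phat X \<in> partitions d \<and>
        (\<forall>h \<in> bandwidths K L q d n. \<forall>P \<in> partitions d.
           criterion K L q d n X (hhat X) (Phat X) \<le> criterion K L q d n X h P))"

definition bias ::
    "(real \<Rightarrow> real) \<Rightarrow> nat \<Rightarrow> (point \<Rightarrow> real) \<Rightarrow> point \<Rightarrow> nat set \<Rightarrow> ennreal" where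
  "bias K d f h I = supnorm I (\<lambda>x.
     \<integral>t. kern K h I (\<lambda>j. t j - x j) * (marginal d f I t - marginal d f I x) \<partial>leb I)"

definition approx_err ::
    "(real \<Rightarrow> real) \<Rightarrow> nat \<Rightarrow> (point \<Rightarrow> real) \<Rightarrow> point \<Rightarrow> nat set set \<Rightarrow> ennreal" where
  "approx_err K d f h P = (SUP P' \<in> partitions d. SUP I \<in> P \<diamond> P'. bias K d f h I)"

text \<open>The infimum over an empty set of bandwidths is \<open>\<infinity>\<close>.\<close>

definition oracle_risk ::
    "(real \<Rightarrow> real) \<Rightarrow> real \<Rightarrow> real \<Rightarrow> nat \<Rightarrow> nat \<Rightarrow> (point \<Rightarrow> real) \<Rightarrow> ennreal" where
  "oracle_risk K L q d n f =
     (INF h \<in> bandwidths K L q d n. INF P \<in> indep_partitions d f.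
        approx_err K d f h P + ennreal (sqrt (ln (real n) / (real n * min_vol h P))))"

definition risk ::
    "(real \<Rightarrow> real) \<Rightarrow> real \<Rightarrow> nat \<Rightarrow> nat \<Rightarrow> (point \<Rightarrow> real) \<Rightarrow>
     (sample \<Rightarrow> point) \<Rightarrow> (sample \<Rightarrow> nat set set) \<Rightarrow> ennreal" where
  "risk K q d n f hhat Phat =
     epowr (\<integral>\<^sup>+ X. epowr (supnorm {1..d} (\<lambda>x. est K n X (hhat X) (Phat X) x - f x)) q
              \<partial>law d f n) (1 / q)"

end

theory Submission
  imports Defs "HOL-Probability.Probability" "HOL-Real_Asymp.Real_Asymp"
begin

text \<open>
  The randomness is confined to one good event.  Bandwidths and locations are discretised on a
  grid of mesh \<open>n\<^bsup>-(d+4)\<^esup>\<close>, on which the Lipschitz kernel changes by \<open>O(1/n)\<close>, and Bernstein's inequality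
  is applied at every grid point to the estimators built from \<open>K\<close> and from \<open>\<bar>K\<bar>\<close>.  The grid of locations
  is infinite, but the probability of a deviation at a given location carries a factor proportional to the mass
  of a window around it, and these masses have a bounded sum.  Bounding the variance by the mean of
  the \<open>\<bar>K\<bar>\<close>-estimator, which is in turn controlled by \<open>f_n\<close>, makes the deviations of size
  \<open>gam * sqrt (fbar_n * ln n / (n * vol h I))\<close>; of the explicit constant only the lower bound
  \<open>gam\<^sup>2 \<ge> 9 tail_exponent a\<^sup>d\<close> matters.

  On the good event everything is deterministic.  If \<open>P\<close> is an independence partition, the smoothed
  density factorises over the blocks of \<open>P \<diamond> P'\<close>, and the auxiliary estimator
  of a block is the \<open>\<eta>\<close>-smoothing of the simple estimator with bandwidth \<open>h\<close>.  Its error is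
  thus charged to the oracle \<open>(h, P)\<close>, and only the noise of the \<open>\<eta>\<close>-estimator has
  to be dominated by the majorant \<open>lam * A_n\<close>.  The selection rule then gives
  the risk bound through the usual triangle inequality, and off the good event the trivial
  bound \<open>O(n)\<close> on the loss is enough.
\<close>

section \<open>The constants\<close>

text \<open>\<open>Delta_n\<close> takes a supremum over every \<eta> and every P', including pairs
  far worse than the oracle. Errors that belong to \<eta> must therefore fit under the majorant with
  its given constants, whereas errors of the fixed pair (h, P) and errors of order 1/n may carry any
  constant. This asymmetry decides which estimates have to be sharp. Comparing a product of at most
  d block estimators with the product of their means costs d times the (d-1)st power of a bound on
  the factors, and for \<eta> this has to match the factor
  \<open>d * fbar_n ^ (d^2 div 4 + 1)\<close> of \<open>lam\<close>. On the oracle side a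
  deterministic bound on \<open>fbar_n\<close> is good enough.

  A plain grid can replace a finer entropy argument because \<open>delta_star\<close> \<le> 1/72
  pushes \<open>tau\<close> above 600000 s^2. The constant \<open>gam\<close> then absorbs the
  logarithm of the number of grid bandwidths, which is polynomial in n with an exponent of order
  d^2.\<close>

lemma delta_profile_mono:
  fixes x y :: real
  assumes "0 < x" "x \<le> y"
  shows "x * (1 + (ln x)\<^sup>2) \<le> y * (1 + (ln y)\<^sup>2)"
proof (rule DERIV_nonneg_imp_nondecreasing[OF assms(2)])
  fix t assume "x \<le> t" "t \<le> y"
  then have t: "t > 0" using assms by simp
  \<comment> \<open>The derivative 1 + (ln t)^2 + 2 ln t is a perfect square, so its sign is clear
    for every t > 0.\<close>
  have "((\<lambda>x. x * (1 + (ln x)\<^sup>2)) has_real_derivative (1 + ln t)\<^sup>2) (at t)"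
    using t by (auto intro!: derivative_eq_intros simp: power2_eq_square field_simps)
  then show "\<exists>z. ((\<lambda>x. x * (1 + (ln x)\<^sup>2)) has_real_derivative z) (at t) \<and> 0 \<le> z"
    by (metis zero_le_power2)
qed

text \<open>\<open>LEAST\<close> on the reals says nothing until a least solution is exhibited. The
  intermediate value theorem supplies a solution in [c, 1], compactness of the solution set there
  supplies a least one, and monotonicity excludes solutions below c, where the profile is still less
  than 1.\<close>

lemma delta_star_solves: "0 < delta_star \<and> 8 * pi\<^sup>2 * delta_star * (1 + (ln delta_star)\<^sup>2) = 1"
proof -
  define g :: "real \<Rightarrow> real" where "g = (\<lambda>\<delta>. 8 * pi\<^sup>2 * \<delta> * (1 + (ln \<delta>)\<^sup>2))"
  have mono: "g x \<le> g y" if "0 < x" "x \<le> y" for x y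
    using delta_profile_mono[OF that] by (simp add: g_def mult.assoc)
  have "((\<lambda>\<delta>::real. 8 * pi\<^sup>2 * \<delta> * (1 + (ln \<delta>)\<^sup>2)) \<longlongrightarrow> 0) (at_right 0)"
    by real_asymp
  then have "eventually (\<lambda>\<delta>. g \<delta> < 1) (at_right 0)"
    unfolding g_def by (rule order_tendstoD) simp
  then obtain b where b: "b > 0" "\<And>y. y > 0 \<Longrightarrow> y < b \<Longrightarrow> g y < 1"
    unfolding eventually_at_right_field by blast
  define c where "c = min (b / 2) (1 / 2)"
  have c: "0 < c" "c < 1" "g c < 1"
    using b by (auto simp: c_def)
  have "g 1 \<ge> 1"
    using one_le_power[of pi 2] pi_gt3 by (simp add: g_def del: one_le_power)
  have cont: "continuous_on {c..1} g"
    unfolding g_def using c by (intro continuous_intros) auto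
  obtain x0 where x0: "c \<le> x0" "x0 \<le> 1" "g x0 = 1"
    using IVT'[of g c 1 1] c \<open>g 1 \<ge> 1\<close> cont by auto
  define S where "S = {c..1} \<inter> g -` {1}"
  have "closed S"
    unfolding S_def by (rule continuous_on_closed_vimage[THEN iffD1, rule_format, OF _ cont, of "{1}", simplified Int_commute]) auto
  then have "compact S"
    unfolding S_def by (metis Int_absorb2 S_def compact_Icc compact_Int_closed inf_le1 inf_commute)
  moreover have "S \<noteq> {}" using x0 by (auto simp: S_def)
  ultimately obtain s where s: "s \<in> S" "\<And>t. t \<in> S \<Longrightarrow> s \<le> t"
    using compact_attains_inf[of S] by auto
  have "delta_star = s"
    unfolding delta_star_def
  proof (rule Least_equality)
    show "0 < s \<and> 8 * pi\<^sup>2 * s * (1 + (ln s)\<^sup>2) = 1"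
      using s(1) c by (auto simp: S_def g_def)
  next
    fix y assume y: "0 < y \<and> 8 * pi\<^sup>2 * y * (1 + (ln y)\<^sup>2) = 1"
    show "s \<le> y"
    proof (cases "y \<le> 1")
      case True
      have "c \<le> y" using mono[of y c] c y by (fastforce simp: g_def)
      then show ?thesis using s(2)[of y] True y by (auto simp: S_def g_def)
    next
      case False
      then show ?thesis using s(1) by (auto simp: S_def)
    qed
  qed
  then show ?thesis using s(1) c by (auto simp: S_def g_def)
qed

lemma delta_star_pos: "0 < delta_star"
  using delta_star_solves by simp

text \<open>With pi replaced by 3 and the logarithm dropped, the defining equation gives 8 * 9 *
  \<open>delta_star\<close> \<le> 1. Smallness matters because \<open>tau\<close> contains the power
  -2 of \<open>delta_star\<close>.\<close>

lemma delta_star_le: "delta_star \<le> 1 / 72"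
proof -
  have "pi\<^sup>2 \<ge> 3\<^sup>2" using pi_gt3 by (intro power_mono) auto
  then have "72 * delta_star \<le> 8 * pi\<^sup>2 * delta_star"
    using delta_star_pos by simp
  also have "\<dots> \<le> 8 * pi\<^sup>2 * delta_star * (1 + (ln delta_star)\<^sup>2)"
    using mult_left_mono[of 1 "1 + (ln delta_star)\<^sup>2" "8 * pi\<^sup>2 * delta_star"] delta_star_pos
    by simp
  finally show ?thesis using delta_star_solves by simp
qed

lemma bdd_above_image_Ioi:
  fixes g :: "real \<Rightarrow> real"
  assumes "continuous_on {c..} g" "(g \<longlongrightarrow> l) at_top"
  shows "bdd_above (g ` {c<..})"
proof -
  obtain D where D: "\<And>x. x \<ge> D \<Longrightarrow> g x < l + 1"
    using order_tendstoD(2)[OF assms(2), of "l + 1"] by (auto simp: eventually_at_top_linorder)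
  have "compact (g ` {c..max c D})"
    using assms(1) by (intro compact_continuous_image) (auto intro: continuous_on_subset)
  then obtain B where B: "\<And>x. x \<in> {c..max c D} \<Longrightarrow> g x \<le> B"
    by (meson bdd_above.E bounded_imp_bdd_above compact_imp_bounded imageI)
  have "g x \<le> max (l + 1) B" if "x > c" for x
    using B[of x] D[of x] that by (cases "x \<ge> D") fastforce+
  then show ?thesis by (auto intro!: bdd_aboveI[of _ "max (l + 1) B"])
qed

text \<open>A real supremum over an unbounded set has an unspecified value, so one nonnegative value
  proves nothing until the image is known to be bounded.\<close>

lemma Sup_Ioi_nonneg:
  fixes g :: "real \<Rightarrow> real"
  assumes "continuous_on {c..} g" "(g \<longlongrightarrow> l) at_top" "0 \<le> g (c + 1)"
  shows "0 \<le> (SUP x\<in>{c<..}. g x)"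
  using assms bdd_above_image_Ioi[OF assms(1,2)] by (intro cSUP_upper2[where x = "c + 1"]) auto

lemma one_plus_square_neq_0: "1 + (ln x)\<^sup>2 \<noteq> 0" for x :: real
  using zero_le_power2[of "ln x"] by linarith

text \<open>This sign makes the last summand of \<open>tau\<close> nonnegative. The suprema are over
  bounded sets by continuity on the closed half-line and decay to 0 at infinity, and the positive
  parts make each value nonnegative.\<close>

lemma C_s_nonneg: "0 \<le> C_s s"
proof -
  have "0 \<le> C_s1 s"
    unfolding C_s1_def
  proof (intro mult_nonneg_nonneg[OF of_nat_0_le_iff] Sup_Ioi_nonneg[where l = 0])
    show "((\<lambda>\<delta>. inverse (\<delta>\<^sup>2) * (max 0 (1 + ln (9216 * (real s + 1) * \<delta>\<^sup>2 / (phi \<delta>)\<^sup>2))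
      + 1.5 * max 0 (log 2 (4608 * (real s + 1) * \<delta>\<^sup>2 / (phi \<delta>)\<^sup>2)))) \<longlongrightarrow> 0) at_top"
      unfolding phi_def log_def by real_asymp
  next
    show "continuous_on {delta_star..} (\<lambda>\<delta>. inverse (\<delta>\<^sup>2) * (max 0 (1 + ln (9216 * (real s + 1) * \<delta>\<^sup>2 / (phi \<delta>)\<^sup>2))
      + 1.5 * max 0 (log 2 (4608 * (real s + 1) * \<delta>\<^sup>2 / (phi \<delta>)\<^sup>2))))"
      unfolding phi_def log_def using delta_star_pos
      by (intro continuous_intros) (auto simp: one_plus_square_neq_0)
  qed auto
  moreover have "0 \<le> C_s2 s"
    unfolding C_s2_def
  proof (intro mult_nonneg_nonneg[OF of_nat_0_le_iff] Sup_Ioi_nonneg[where l = 0])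
    show "((\<lambda>\<delta>. inverse \<delta> * (max 0 (1 + ln (9216 * (real s + 1) * \<delta> / phi \<delta>))
      + 1.5 * max 0 (log 2 (4608 * (real s + 1) * \<delta> / phi \<delta>)))) \<longlongrightarrow> 0) at_top"
      unfolding phi_def log_def by real_asymp
  next
    show "continuous_on {delta_star..} (\<lambda>\<delta>. inverse \<delta> * (max 0 (1 + ln (9216 * (real s + 1) * \<delta> / phi \<delta>))
      + 1.5 * max 0 (log 2 (4608 * (real s + 1) * \<delta> / phi \<delta>))))"
      unfolding phi_def log_def using delta_star_pos
      by (intro continuous_intros) (auto simp: one_plus_square_neq_0)
  qed (use delta_star_pos in auto)
  ultimately show ?thesis by (simp add: C_s_def)
qed

lemma tau_ge:
  assumes "s \<ge> 1" "p \<ge> 1"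
  shows "tau p s a \<ge> 600000 * (real s)\<^sup>2 + real s * (2 * p + 3)"
proof -
  have "ln 2 \<ge> (1/2::real)"
    using ln_le_minus_one[of "1/2::real"] by (simp add: ln_div)
  have i: "inverse (delta_star\<^sup>2) \<ge> 5184"
    using delta_star_pos power_mono[OF delta_star_le, of 2]
    by (simp add: field_simps)
  \<comment> \<open>5184 = 72^2 comes from \<open>delta_star_le\<close> and 1/2 from ln 2; the
    product 234 * 5184 / 2 = 606528 is rounded down to 600000.\<close>
  have "real s * (234 * real s * 5184) * (1/2) \<le>
     real s * (234 * real s * inverse (delta_star\<^sup>2) + 6.5 * p + 5.5) * ln 2"
    using i assms \<open>ln 2 \<ge> 1/2\<close>
    by (intro mult_mono mult_left_mono) (auto intro!: add_increasing2 mult_left_mono)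
  moreover have "0 \<le> (108 * real s * inverse (delta_star\<^sup>2) * \<bar>ln a\<bar> + 36 * C_s s + 1) * inverse (ln 3)"
    using C_s_nonneg[of s] by auto
  moreover have "real s * (234 * real s * 5184) * (1/2) \<ge> 600000 * (real s)\<^sup>2"
    by (simp add: power2_eq_square)
  ultimately show ?thesis unfolding tau_def by linarith
qed

lemma gam_pos:
  assumes "s \<ge> 1" "p \<ge> 1" "a > 0" "L > 0"
  shows "gam L p s a > 0"
proof -
  have "0 < 600000 * (real s)\<^sup>2 + real s * (2 * p + 3)" using assms by (auto intro!: add_pos_pos)
  then have t: "tau p s a > 0" using tau_ge[OF assms(1,2), of a] by linarith
  have "16 * exp 1 / 3 * max (real s * (a + 3 * L / 2 * a ^ (s - 1))) (8 * a) * tau p s a > 0"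
    using t assms by (intro mult_pos_pos) (auto simp: max_def)
  moreover have "4 * exp 1 * sqrt (2 * real s * tau p s a * (a + 3 * L / 2 * a ^ (s - 1))) \<ge> 0"
    using t assms by simp
  ultimately show ?thesis unfolding gam_def by linarith
qed

text \<open>The square-root summand of \<open>gam\<close> suffices. Its prefactor 4 e is at least 8,
  and L \<ge> 2 a turns (3 L / 2) a^(s-1) into at least 3 a^s, so the radicand is at least 6 T a^s
  with T the lower bound for \<open>tau\<close>; finally 64 * 6 = 384.\<close>

lemma gam_sq_ge:
  assumes "s \<ge> 1" "p \<ge> 1" "a > 0" "L \<ge> 2 * a"
  shows "(gam L p s a)\<^sup>2 \<ge> 384 * (600000 * (real s)\<^sup>2 + real s * (2 * p + 3)) * a ^ s"
proof -
  define w where "w = 2 * real s * tau p s a * (a + 3 * L / 2 * a ^ (s - 1))"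
  define T where "T = 600000 * (real s)\<^sup>2 + real s * (2 * p + 3)"
  have T: "T > 0" using assms by (auto intro!: add_pos_pos simp: T_def)
  then have t: "tau p s a \<ge> T" using tau_ge[OF assms(1,2), of a] by (simp add: T_def)
  have "a ^ s = a * a ^ (s - 1)" using assms(1) by (metis Suc_diff_1 less_eq_Suc_le One_nat_def power_Suc)
  then have "3 * a ^ s \<le> 3 * L / 2 * a ^ (s - 1)"
    using assms by (simp add: mult_right_mono)
  then have la: "3 * a ^ s \<le> a + 3 * L / 2 * a ^ (s - 1)" using assms by linarith
  have "2 * 1 * T * (3 * a ^ s) \<le> w"
    unfolding w_def using la t T assms by (intro mult_mono) auto
  then have w: "6 * T * a ^ s \<le> w" by simp
  have w0: "w \<ge> 0" using w T assms by (smt (verit) mult_nonneg_nonneg zero_le_power)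
  have "16 * exp 1 / 3 * max (real s * (a + 3 * L / 2 * a ^ (s - 1))) (8 * a) * tau p s a \<ge> 0"
    using t T assms by (intro mult_nonneg_nonneg) (auto simp: max_def)
  then have "gam L p s a \<ge> 4 * exp 1 * sqrt w" unfolding gam_def w_def by linarith
  moreover have "4 * exp 1 * sqrt w \<ge> 4 * 2 * sqrt w"
    using exp_ge_add_one_self[of 1] w0 by (intro mult_right_mono) auto
  ultimately have "8 * sqrt w \<le> gam L p s a" by linarith
  then have "(gam L p s a)\<^sup>2 \<ge> (8 * sqrt w)\<^sup>2"
    using w0 by (intro power_mono) auto
  then have "(gam L p s a)\<^sup>2 \<ge> 64 * w" using w0 by (simp add: power_mult_distrib)
  then show ?thesis using w unfolding T_def by linarith
qed

section \<open>Index sets, partitions, and the constants \<open>Lam\<close> and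
  \<open>a_star\<close>\<close>

lemma finite_index_sets: "finite (index_sets d)"
  unfolding index_sets_def by (rule finite_subset[of _ "Pow {1..d}"]) auto

lemma index_sets_card:
  assumes "I \<in> index_sets d" shows "finite I" "1 \<le> card I" "card I \<le> d"
proof -
  show f: "finite I" using assms finite_subset[of I "{1..d}"] by (auto simp: index_sets_def)
  then show "1 \<le> card I" using assms by (auto simp: index_sets_def Suc_le_eq card_gt_0_iff)
  show "card I \<le> d" using assms card_mono[of "{1..d}" I] by (auto simp: index_sets_def)
qed

lemma finite_partitions: "finite (partitions d)"
  unfolding partitions_def
  by (rule finite_subset[of _ "Pow (Pow {1..d})"]) (unfold partition_on_def, blast, simp)

lemma partitions_index_sets: "P \<in> partitions d \<Longrightarrow> I \<in> P \<Longrightarrow> I \<in> index_sets d"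
  unfolding partitions_def partition_on_def index_sets_def by blast

lemma trivial_partition: "d \<ge> 1 \<Longrightarrow> {{1..d}} \<in> partitions d"
  by (auto simp: partitions_def partition_on_def)

lemma partitions_finite: "P \<in> partitions d \<Longrightarrow> finite P"
  using partitions_index_sets finite_index_sets finite_subset by (metis subsetI)

text \<open>The one-block partition contributes the full dimension d, whose constant is the one used
  for all blocks later.\<close>

lemma Lam_ge_gam:
  assumes "d \<ge> 1"
  shows "Lam K L q d \<ge> gam L (2 * q) d (k_inf K)"
proof -
  have "gam L (2 * q) d (k_inf K) \<le> (SUP I\<in>{{1..d}}. gam L (2 * q) (card I) (k_inf K))" by simp
  also have "\<dots> \<le> Lam K L q d"
    unfolding Lam_def using finite_partitions trivial_partition[OF assms]
    by (intro cSUP_upper bdd_above_finite finite_imageI)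
  finally show ?thesis .
qed

lemma inverse_a_star_ge:
  assumes "d \<ge> 1" "q \<ge> 1" "k_inf K > 0" "L > 0"
  shows "inverse (a_star K L q d) \<ge> (2 * gam L (2 * q) d (k_inf K))\<^sup>2"
proof -
  let ?g = "\<lambda>I. inverse ((2 * gam L (2 * q) (card I) (k_inf K))\<^sup>2)"
  have ne: "index_sets d \<noteq> {}" using assms(1) by (auto simp: index_sets_def)
  have d: "{1..d} \<in> index_sets d" using assms(1) by (auto simp: index_sets_def)
  have pos: "?g I > 0" if "I \<in> index_sets d" for I
    using gam_pos[of "card I" "2 * q" "k_inf K" L] index_sets_card(2)[OF that] assms by auto
  \<comment> \<open>The infimum over a finite non-empty set is attained, hence positive; positivity
    is what allows the inverses to be compared.\<close>
  have "a_star K L q d \<in> ?g ` index_sets d"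
    unfolding a_star_def using ne finite_index_sets[of d]
    by (metis Min_in cInf_eq_Min finite_imageI image_is_empty)
  then have "a_star K L q d > 0" using pos by (metis (no_types, lifting) imageE)
  moreover have "a_star K L q d \<le> ?g {1..d}"
    unfolding a_star_def using d by (intro cINF_lower bdd_below_finite finite_imageI finite_index_sets) auto
  ultimately have "inverse (?g {1..d}) \<le> inverse (a_star K L q d)"
    by (intro le_imp_inverse_le)
  then show ?thesis by (simp only: inverse_inverse_eq card_atLeastAtMost diff_Suc_1)
qed

section \<open>Kernels\<close>

text \<open>Replacing the factors one at a time costs D for the exchanged factor and B for each of
  the others. The inequality carries every error from single factors to products: coordinates of a
  kernel, blocks of a partition, and powers of a number.\<close>

lemma abs_prod_diff_le:
  fixes u v :: "'a \<Rightarrow> real"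
  assumes "finite A" "\<And>i. i \<in> A \<Longrightarrow> \<bar>u i\<bar> \<le> B" "\<And>i. i \<in> A \<Longrightarrow> \<bar>v i\<bar> \<le> B"
    "\<And>i. i \<in> A \<Longrightarrow> \<bar>u i - v i\<bar> \<le> D" "0 \<le> B" "0 \<le> D"
  shows "\<bar>(\<Prod>i\<in>A. u i) - (\<Prod>i\<in>A. v i)\<bar> \<le> real (card A) * D * B ^ (card A - 1)"
  using assms(1-4)
proof (induction A rule: finite_induct)
  case empty
  then show ?case by simp
next
  case (insert x A)
  have v: "\<bar>\<Prod>i\<in>A. v i\<bar> \<le> B ^ card A"
    unfolding abs_prod prod_constant[symmetric] using insert.prems by (intro prod_mono) auto
  have IH: "\<bar>(\<Prod>i\<in>A. u i) - (\<Prod>i\<in>A. v i)\<bar> \<le> real (card A) * D * B ^ (card A - 1)"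
    using insert by auto
  have eq: "(\<Prod>i\<in>insert x A. u i) - (\<Prod>i\<in>insert x A. v i) =
     u x * ((\<Prod>i\<in>A. u i) - (\<Prod>i\<in>A. v i)) + (u x - v x) * (\<Prod>i\<in>A. v i)"
    unfolding prod.insert[OF insert.hyps] by (simp add: right_diff_distrib left_diff_distrib)
  have "\<bar>u x * ((\<Prod>i\<in>A. u i) - (\<Prod>i\<in>A. v i))\<bar> \<le> B * (real (card A) * D * B ^ (card A - 1))"
    unfolding abs_mult by (rule mult_mono[OF insert.prems(1)[OF insertI1] IH assms(5) abs_ge_zero])
  also have "\<dots> = real (card A) * D * B ^ card A"
    by (cases "card A") auto
  finally have 1: "\<bar>u x * ((\<Prod>i\<in>A. u i) - (\<Prod>i\<in>A. v i))\<bar> \<le> real (card A) * D * B ^ card A" .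
  have 2: "\<bar>(u x - v x) * (\<Prod>i\<in>A. v i)\<bar> \<le> D * B ^ card A"
    unfolding abs_mult by (rule mult_mono[OF insert.prems(3)[OF insertI1] v assms(6) abs_ge_zero])
  have "real (card (insert x A)) * D * B ^ (card (insert x A) - 1) =
      real (card A) * D * B ^ card A + D * B ^ card A"
    using insert.hyps by (simp add: distrib_right)
  then show ?case
    unfolding eq using abs_triangle_ineq[of "u x * ((\<Prod>i\<in>A. u i) - (\<Prod>i\<in>A. v i))" "(u x - v x) * (\<Prod>i\<in>A. v i)"] 1 2
    by linarith
qed

lemma supnorm_le: "(\<And>x. x \<in> I \<rightarrow>\<^sub>E UNIV \<Longrightarrow> \<bar>g x\<bar> \<le> c) \<Longrightarrow> supnorm I g \<le> ennreal c"
  unfolding supnorm_def by (intro SUP_least ennreal_leI)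

lemma abs_le_supnorm: "supnorm I g \<le> ennreal b \<Longrightarrow> 0 \<le> b \<Longrightarrow> x \<in> I \<rightarrow>\<^sub>E UNIV \<Longrightarrow> \<bar>g x\<bar> \<le> b"
  unfolding supnorm_def SUP_le_iff by simp

lemma supnorm_triangle:
  "supnorm I (\<lambda>x. u x - w x) \<le> supnorm I (\<lambda>x. v x - u x) + supnorm I (\<lambda>x. v x - w x)"
  unfolding supnorm_def
proof (rule SUP_least)
  fix x :: point assume x: "x \<in> I \<rightarrow>\<^sub>E UNIV"
  have "ennreal \<bar>u x - w x\<bar> \<le> ennreal (\<bar>v x - u x\<bar> + \<bar>v x - w x\<bar>)" by (intro ennreal_leI) linarith
  also have "\<dots> = ennreal \<bar>v x - u x\<bar> + ennreal \<bar>v x - w x\<bar>" by simp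
  also have "\<dots> \<le> (SUP x\<in>I \<rightarrow>\<^sub>E UNIV. ennreal \<bar>v x - u x\<bar>) + (SUP x\<in>I \<rightarrow>\<^sub>E UNIV. ennreal \<bar>v x - w x\<bar>)"
    using x by (intro add_mono SUP_upper)
  finally show "ennreal \<bar>u x - w x\<bar> \<le> (SUP x\<in>I \<rightarrow>\<^sub>E UNIV. ennreal \<bar>v x - u x\<bar>) + (SUP x\<in>I \<rightarrow>\<^sub>E UNIV. ennreal \<bar>v x - w x\<bar>)" .
qed

locale kernel =
  fixes K :: "real \<Rightarrow> real" and L :: real
  assumes kernel_cond: "kernel_cond K L"
begin

abbreviation a :: real where "a \<equiv> k_inf K"

lemma integrable_K: "integrable lborel K" and integral_K: "(\<integral>t. K t \<partial>lborel) = 1"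
  and K_sym: "K (- t) = K t" and L_pos: "0 < L" and K_lipschitz: "\<bar>K s - K t\<bar> \<le> L * \<bar>s - t\<bar>"
  using kernel_cond lipschitz_onD[of L UNIV K s t] by (auto simp: kernel_cond_def dist_real_def)

lemma continuous_K: "continuous_on A K"
  using kernel_cond lipschitz_on_continuous_on[of L UNIV K]
  by (auto simp: kernel_cond_def intro: continuous_on_subset)

lemma measurable_K [measurable]: "K \<in> borel_measurable borel"
  using continuous_K by (rule borel_measurable_continuous_onI)

lemma abs_K_le: "\<bar>K t\<bar> \<le> a"
proof -
  have "bdd_above (range (\<lambda>t. \<bar>K t\<bar>))"
    using kernel_cond by (auto simp: kernel_cond_def bounded_iff bdd_above_def)
  then show ?thesis unfolding k_inf_def by (rule cSUP_upper[OF UNIV_I])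
qed

lemma K_zero: "\<bar>t\<bar> \<ge> 1/2 \<Longrightarrow> K t = 0"
proof -
  have out: "K t = 0" if "\<bar>t\<bar> > 1/2" for t
  proof (rule ccontr)
    assume "K t \<noteq> 0"
    then have "t \<in> closure {t. K t \<noteq> 0}" using closure_subset[of "{t. K t \<noteq> 0}"] by auto
    then have "t \<in> {-1/2..1/2}" using kernel_cond unfolding kernel_cond_def by blast
    then show False using that by auto
  qed
  \<comment> \<open>The support condition leaves the endpoints open, and continuity decides there: K
    vanishes at distance e beyond the endpoint, while the Lipschitz bound L e is only half of the
    supposed value.\<close>
  have half: "K (1/2) = 0"
  proof (rule ccontr)
    assume "K (1/2) \<noteq> 0"
    define e where "e = \<bar>K (1/2)\<bar> / (2 * L)"
    have "e > 0" using \<open>K (1/2) \<noteq> 0\<close> L_pos by (simp add: e_def)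
    then have "\<bar>K (1/2)\<bar> \<le> L * e" using K_lipschitz[of "1/2" "1/2 + e"] out[of "1/2 + e"] by simp
    also have "\<dots> = \<bar>K (1/2)\<bar> / 2" using L_pos by (simp add: e_def)
    finally show False using \<open>K (1/2) \<noteq> 0\<close> by simp
  qed
  assume "\<bar>t\<bar> \<ge> 1/2"
  then consider "\<bar>t\<bar> > 1/2" | "t = 1/2" | "t = -(1/2)" by linarith
  then show ?thesis
  proof cases
    case 1
    then show ?thesis by (rule out)
  next
    case 2
    show ?thesis unfolding 2 by (rule half)
  next
    case 3
    show ?thesis unfolding 3 K_sym by (rule half)
  qed
qed

lemma integrable_abs_K: "integrable lborel (\<lambda>t. \<bar>K t\<bar>)"
  using integrable_K by simp

text \<open>The support lies in an interval of length 1. This lets powers of a stand in for powers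
  of the L1 norm in all later constants.\<close>

lemma integral_abs_K_le: "(\<integral>t. \<bar>K t\<bar> \<partial>lborel) \<le> a"
proof -
  have "(\<integral>t. \<bar>K t\<bar> \<partial>lborel) \<le> (\<integral>t. a * indicator {-1/2..1/2::real} t \<partial>lborel)"
    using abs_K_le K_zero by (intro integral_mono integrable_abs_K) (auto split: split_indicator)
  also have "\<dots> = a" by simp
  finally show ?thesis .
qed

lemma a_ge_1: "1 \<le> a"
proof -
  have "1 \<le> (\<integral>t. \<bar>K t\<bar> \<partial>lborel)"
    unfolding integral_K[symmetric] using integrable_K by (intro integral_mono) auto
  then show ?thesis using integral_abs_K_le by simp
qed

text \<open>K vanishes at both ends of an interval of length 1, so each point of it is within 1/2 of
  a zero and the Lipschitz bound gives L/2. This relation between a and L is the hypothesis of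
  \<open>gam_sq_ge\<close>.\<close>

lemma L_ge: "2 * a \<le> L"
proof -
  have "\<bar>K t\<bar> \<le> L / 2" for t
  proof (cases "\<bar>t\<bar> \<ge> 1/2")
    case True
    then show ?thesis using K_zero L_pos by simp
  next
    case False
    have z: "K (1/2) = 0" "K (-1/2) = 0" using K_zero by auto
    show ?thesis
    proof (cases "t \<ge> 0")
      case True
      have "\<bar>K t\<bar> \<le> L * \<bar>t - 1/2\<bar>" using K_lipschitz[of t "1/2"] z by simp
      also have "\<dots> \<le> L * (1/2)" using True False L_pos by (intro mult_left_mono) auto
      finally show ?thesis by simp
    next
      case f: False
      have "\<bar>K t\<bar> \<le> L * \<bar>t + 1/2\<bar>" using K_lipschitz[of t "-1/2"] z by simp
      also have "\<dots> \<le> L * (1/2)" using f False L_pos by (intro mult_left_mono) auto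
      finally show ?thesis by simp
    qed
  qed
  then have "a \<le> L / 2" unfolding k_inf_def by (intro cSUP_least) auto
  then show ?thesis by simp
qed

lemma measurable_kern1 [measurable]: "kern1 K b \<in> borel_measurable borel"
  unfolding kern1_def by measurable

lemma kern1_sym: "kern1 K b (- u) = kern1 K b u"
  by (simp add: kern1_def K_sym)

lemma has_bochner_integral_kern1:
  assumes "b > 0"
  shows "has_bochner_integral lborel (kern1 K b) 1"
    and "has_bochner_integral lborel (\<lambda>u. \<bar>kern1 K b u\<bar>) (\<integral>t. \<bar>K t\<bar> \<partial>lborel)"
proof -
  have "has_bochner_integral lborel (\<lambda>u. K (0 + inverse b * u)) (1 /\<^sub>R \<bar>inverse b\<bar>)"
    using assms integrable_K integral_K by (intro lborel_has_bochner_integral_real_affine_iff[THEN iffD1])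
      (auto simp: has_bochner_integral_iff)
  from has_bochner_integral_mult_right[OF this, of "inverse b"]
  show "has_bochner_integral lborel (kern1 K b) 1"
    using assms by (simp add: kern1_def[abs_def] divide_inverse mult.commute)
  have "has_bochner_integral lborel (\<lambda>u. \<bar>K (0 + inverse b * u)\<bar>) ((\<integral>t. \<bar>K t\<bar> \<partial>lborel) /\<^sub>R \<bar>inverse b\<bar>)"
    using assms integrable_abs_K
    by (intro lborel_has_bochner_integral_real_affine_iff[THEN iffD1, of _ "\<lambda>t. \<bar>K t\<bar>"])
      (auto simp: has_bochner_integral_iff)
  note * = has_bochner_integral_mult_right[OF this, of "inverse b"]
  have eq: "inverse b * ((\<integral>t. \<bar>K t\<bar> \<partial>lborel) /\<^sub>R \<bar>inverse b\<bar>) = (\<integral>t. \<bar>K t\<bar> \<partial>lborel)"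
    using assms by simp
  have "(\<lambda>u. \<bar>kern1 K b u\<bar>) = (\<lambda>u. inverse b * \<bar>K (0 + inverse b * u)\<bar>)"
    using assms by (simp add: kern1_def[abs_def] divide_inverse mult.commute[of _ "inverse b"] abs_mult)
  then show "has_bochner_integral lborel (\<lambda>u. \<bar>kern1 K b u\<bar>) (\<integral>t. \<bar>K t\<bar> \<partial>lborel)"
    using * unfolding eq by simp
qed

lemma abs_kern1_le: "b > 0 \<Longrightarrow> \<bar>kern1 K b u\<bar> \<le> a / b"
  using abs_K_le[of "u / b"] by (simp add: kern1_def abs_mult divide_inverse mult.commute mult_right_mono)

lemma kern1_zero: "0 < b \<Longrightarrow> b \<le> 1 \<Longrightarrow> \<bar>u\<bar> \<ge> 1/2 \<Longrightarrow> kern1 K b u = 0"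
proof -
  assume b: "0 < b" "b \<le> 1" "\<bar>u\<bar> \<ge> 1/2"
  then have "1/2 * b \<le> 1/2" by simp
  then have "1/2 * b \<le> \<bar>u\<bar>" using b(3) by linarith
  then have "\<bar>u / b\<bar> \<ge> 1/2" using b by (simp add: field_simps)
  then show ?thesis using K_zero by (simp add: kern1_def)
qed

text \<open>First the bandwidth moves, then the location. Changing b shifts the argument u/b by |u|
  |1/b - 1/b'|, which is harmless for |u| < 1/2; for larger |u| both kernels vanish because b and b'
  are at most 1.\<close>

lemma kern1_lipschitz:
  assumes b: "1 / m \<le> b" "b \<le> 1" "1 / m \<le> b'" "b' \<le> 1" and m: "m \<ge> 1"
    and u: "\<bar>u - u'\<bar> \<le> \<epsilon>" "\<bar>b - b'\<bar> \<le> \<epsilon>"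
  shows "\<bar>kern1 K b u - kern1 K b' u'\<bar> \<le> (a + 2 * L) * m ^ 3 * \<epsilon>"
proof -
  have pos: "0 < 1 / m" using m by simp
  then have p: "0 < b" "0 < b'" using b by linarith+
  have inv: "inverse b \<le> m" "inverse b' \<le> m"
    using b m p by (simp_all add: field_simps)
  have e: "\<epsilon> \<ge> 0" using u by linarith
  have ib: "\<bar>inverse b - inverse b'\<bar> \<le> m ^ 2 * \<epsilon>"
  proof -
    have "\<bar>inverse b - inverse b'\<bar> = inverse b * inverse b' * \<bar>b - b'\<bar>"
      using p by (simp add: field_simps abs_mult abs_divide)
    also have "\<dots> \<le> m * m * \<epsilon>" using inv p u m e by (intro mult_mono) auto
    finally show ?thesis by (simp add: power2_eq_square)
  qed
  have m23: "m ^ 2 \<le> m ^ 3" using m by (intro power_increasing) auto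
  have 1: "\<bar>kern1 K b u - kern1 K b' u\<bar> \<le> (a + L / 2) * m ^ 3 * \<epsilon>"
  proof (cases "\<bar>u\<bar> \<ge> 1/2")
    case True
    then show ?thesis using kern1_zero p b e L_pos a_ge_1 m by simp
  next
    case False
    have "kern1 K b u - kern1 K b' u = (inverse b - inverse b') * K (u / b) + inverse b' * (K (u / b) - K (u / b'))"
      by (simp add: kern1_def algebra_simps)
    then have "\<bar>kern1 K b u - kern1 K b' u\<bar> \<le> \<bar>inverse b - inverse b'\<bar> * \<bar>K (u / b)\<bar> + inverse b' * \<bar>K (u / b) - K (u / b')\<bar>"
      using p abs_triangle_ineq[of "(inverse b - inverse b') * K (u / b)" "inverse b' * (K (u / b) - K (u / b'))"]
      by (simp only: abs_mult) simp
    also have "\<bar>inverse b - inverse b'\<bar> * \<bar>K (u / b)\<bar> \<le> (m ^ 2 * \<epsilon>) * a"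
      using ib abs_K_le e by (intro mult_mono) auto
    also have "\<dots> \<le> (m ^ 3 * \<epsilon>) * a" using m23 e a_ge_1 by (intro mult_right_mono) auto
    also have "inverse b' * \<bar>K (u / b) - K (u / b')\<bar> \<le> m * (L / 2 * (m ^ 2 * \<epsilon>))"
    proof (rule mult_mono[OF inv(2)])
      have "\<bar>K (u / b) - K (u / b')\<bar> \<le> L * \<bar>u / b - u / b'\<bar>" by (rule K_lipschitz)
      also have "\<bar>u / b - u / b'\<bar> = \<bar>u\<bar> * \<bar>inverse b - inverse b'\<bar>"
        by (simp only: abs_mult[symmetric] right_diff_distrib divide_inverse)
      also have "\<dots> \<le> 1/2 * (m ^ 2 * \<epsilon>)" using False ib by (intro mult_mono) auto
      finally show "\<bar>K (u / b) - K (u / b')\<bar> \<le> L / 2 * (m ^ 2 * \<epsilon>)"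
        using L_pos by (simp add: mult.commute)
    qed (use m in auto)
    finally show ?thesis by (simp add: algebra_simps power3_eq_cube power2_eq_square)
  qed
  have "\<bar>kern1 K b' u - kern1 K b' u'\<bar> = inverse b' * \<bar>K (u / b') - K (u' / b')\<bar>"
    using p by (simp add: kern1_def abs_mult right_diff_distrib[symmetric])
  also have "\<dots> \<le> m * (L * (m * \<epsilon>))"
  proof (rule mult_mono[OF inv(2)])
    have "\<bar>K (u / b') - K (u' / b')\<bar> \<le> L * \<bar>u / b' - u' / b'\<bar>" by (rule K_lipschitz)
    also have "\<bar>u / b' - u' / b'\<bar> = inverse b' * \<bar>u - u'\<bar>"
      unfolding divide_inverse left_diff_distrib[symmetric] abs_mult using p by simp
    also have "\<dots> \<le> m * \<epsilon>" using inv u m p e by (intro mult_mono) auto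
    finally show "\<bar>K (u / b') - K (u' / b')\<bar> \<le> L * (m * \<epsilon>)" using L_pos by simp
  qed (use m in auto)
  also have "\<dots> = L * m ^ 2 * \<epsilon>" by (simp add: power2_eq_square)
  also have "\<dots> \<le> L * m ^ 3 * \<epsilon>" using m23 e L_pos by (intro mult_right_mono mult_left_mono) auto
  finally have 2: "\<bar>kern1 K b' u - kern1 K b' u'\<bar> \<le> L * m ^ 3 * \<epsilon>" .
  have "\<bar>kern1 K b u - kern1 K b' u'\<bar> \<le> (a + L / 2) * m ^ 3 * \<epsilon> + L * m ^ 3 * \<epsilon>"
    using 1 2 by linarith
  also have "\<dots> \<le> (a + 2 * L) * m ^ 3 * \<epsilon>"
  proof -
    have "(a + L / 2) * (m ^ 3 * \<epsilon>) + L * (m ^ 3 * \<epsilon>) \<le> (a + 2 * L) * (m ^ 3 * \<epsilon>)"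
      unfolding distrib_right[symmetric] using L_pos e m by (intro mult_right_mono) auto
    then show ?thesis by (simp add: mult.assoc)
  qed
  finally show ?thesis .
qed

lemma kern_eq_prod: "kern K h I u = (\<Prod>j\<in>I. kern1 K (h j) (u j))"
  by (simp add: kern_def kern1_def vol_def prod.distrib prod_inversef[unfolded o_def])

lemma abs_kern_le:
  assumes "finite I" "\<And>j. j \<in> I \<Longrightarrow> 0 < h j"
  shows "\<bar>kern K h I u\<bar> \<le> a ^ card I / vol h I"
proof -
  have "\<bar>kern K h I u\<bar> \<le> (\<Prod>j\<in>I. a / h j)"
    unfolding kern_eq_prod abs_prod using assms abs_kern1_le by (intro prod_mono) auto
  then show ?thesis by (simp add: prod_dividef vol_def)
qed

text \<open>Each coordinate factor is at most a m and moves by a multiple of m^3 \<epsilon>. The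
  polynomial growth in m is what dictates the mesh of the grid.\<close>

lemma kern_lipschitz:
  assumes "finite I" and m: "m \<ge> 1" and e: "\<epsilon> \<ge> 0"
    and h: "\<And>j. j \<in> I \<Longrightarrow> 1 / m \<le> h j \<and> h j \<le> 1 \<and> 1 / m \<le> h' j \<and> h' j \<le> 1 \<and> \<bar>h j - h' j\<bar> \<le> \<epsilon>"
    and u: "\<And>j. j \<in> I \<Longrightarrow> \<bar>u j - u' j\<bar> \<le> \<epsilon>"
  shows "\<bar>kern K h I u - kern K h' I u'\<bar> \<le> real (card I) * ((a + 2 * L) * m ^ 3 * \<epsilon>) * (a * m) ^ (card I - 1)"
  unfolding kern_eq_prod
proof (rule abs_prod_diff_le)
  have *: "\<bar>kern1 K b v\<bar> \<le> a * m" if "1 / m \<le> b" for b v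
  proof -
    have "0 < 1 / m" using m by simp
    then have "b > 0" using that by linarith
    then have "\<bar>kern1 K b v\<bar> \<le> a / b" by (rule abs_kern1_le)
    also have "\<dots> \<le> a * m" using \<open>b > 0\<close> that m a_ge_1 by (simp add: field_simps)
    finally show ?thesis .
  qed
  show "\<bar>kern1 K (h i) (u i)\<bar> \<le> a * m" "\<bar>kern1 K (h' i) (u' i)\<bar> \<le> a * m" if "i \<in> I" for i
    using * h[OF that] by auto
  show "\<bar>kern1 K (h i) (u i) - kern1 K (h' i) (u' i)\<bar> \<le> (a + 2 * L) * m ^ 3 * \<epsilon>" if "i \<in> I" for i
    using kern1_lipschitz[of m "h i" "h' i" "u i" "u' i" \<epsilon>] h[OF that] u[OF that] m by auto
  show "0 \<le> (a + 2 * L) * m ^ 3 * \<epsilon>" "0 \<le> a * m"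
    using a_ge_1 L_pos m e by simp_all
qed (rule assms(1))

end

declare One_nat_def [simp del]

section \<open>Bernstein's inequality\<close>

lemma exp_le_quadratic:
  fixes y :: real
  assumes "\<bar>y\<bar> \<le> 1"
  shows "exp y \<le> 1 + y + y\<^sup>2"
proof (cases "y \<ge> 0")
  case True
  then show ?thesis using exp_bound[of y] assms by simp
next
  case False
  define u where "u = - y"
  have u: "0 \<le> u" "u \<le> 1" using False assms by (auto simp: u_def)
  \<comment> \<open>The Taylor lower bound for e^u times the claimed upper bound for e^(-u) expands
    to a polynomial that exceeds 1; dividing by e^u gives the claim.\<close>
  have "1 \<le> 1 + u\<^sup>2 / 2 + u ^ 3 / 2 + u ^ 4 / 2" using u by simp
  also have "\<dots> = (1 + u + u\<^sup>2 / 2) * (1 - u + u\<^sup>2)"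
    by (simp add: field_simps power2_eq_square power3_eq_cube power4_eq_xxxx)
  also have "\<dots> \<le> exp u * (1 - u + u\<^sup>2)"
  proof (rule mult_right_mono)
    show "1 + u + u\<^sup>2 / 2 \<le> exp u" by (rule exp_lower_Taylor_quadratic[OF u(1)])
    show "0 \<le> 1 - u + u\<^sup>2" using u by simp
  qed
  finally have "exp (- u) \<le> 1 - u + u\<^sup>2"
    by (simp add: exp_minus field_simps)
  then show ?thesis by (simp add: u_def)
qed

text \<open>The function e^y - 1 - y increases for y \<ge> 0, so y = u is the worst case, and from u
  = 3 on 1 + u is at most half of e^u. This is the origin of the condition z \<ge> 3 in the
  Bernstein bounds.\<close>

lemma exp_remainder_ge:
  fixes u y :: real
  assumes "3 \<le> u" "u \<le> y"
  shows "exp u / 2 \<le> exp y - 1 - y"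
proof -
  have "3 * u \<le> u * u" using assms by (intro mult_right_mono) auto
  have "2 + 2 * u \<le> u * u" using \<open>3 * u \<le> u * u\<close> assms by linarith
  then have "2 * (1 + u) \<le> 1 + u + u\<^sup>2 / 2" using assms by (simp add: power2_eq_square)
  also have "\<dots> \<le> exp u" using assms by (intro exp_lower_Taylor_quadratic) auto
  finally have "exp u / 2 \<le> exp u - 1 - u" by simp
  moreover have "1 + (y - u) \<le> exp (y - u)" by (rule exp_ge_add_one_self)
  then have "exp u * (1 + (y - u)) \<le> exp y"
    using mult_left_mono[of "1 + (y - u)" "exp (y - u)" "exp u"] by (simp add: exp_add[symmetric])
  moreover have "1 * (y - u) \<le> exp u * (y - u)"
    using assms by (intro mult_right_mono) auto
  ultimately show ?thesis by (simp add: algebra_simps)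
qed

context prob_space
begin

lemma PiM_integral_component:
  fixes g :: "'a \<Rightarrow> real"
  assumes "g \<in> borel_measurable M" "i \<in> I"
  shows "(\<integral>X. g (X i) \<partial>PiM I (\<lambda>_. M)) = expectation g"
proof -
  interpret P: product_prob_space "\<lambda>_. M" I by unfold_locales
  have "expectation g = (\<integral>x. g x \<partial>distr (PiM I (\<lambda>_. M)) M (\<lambda>X. X i))"
    using P.PiM_component[OF assms(2)] by simp
  also have "\<dots> = (\<integral>X. g (X i) \<partial>PiM I (\<lambda>_. M))"
    using assms by (intro integral_distr) auto
  finally show ?thesis by simp
qed

text \<open>Markov's inequality is applied to \<open>e\<^sup>y - 1 - y\<close> rather than to \<open>e\<^sup>y\<close>: this produces the factor
  \<open>v\<close> in front of the exponential, which is what makes the bounds summable over an infinite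
  grid of locations.\<close>

lemma bernstein_iid_aux:
  fixes g :: "'a \<Rightarrow> real"
  assumes g [measurable]: "g \<in> borel_measurable M"
    and bd: "\<And>x. x \<in> space M \<Longrightarrow> \<bar>g x\<bar> \<le> B"
    and l: "0 < l" "l * B \<le> 1" and z: "z \<ge> 3"
  shows "measure (PiM {1..n} (\<lambda>_. M)) {X \<in> space (PiM {1..n} (\<lambda>_. M)).
      real n * l * expectation (\<lambda>x. (g x)\<^sup>2) + z / l \<le> (\<Sum>i=1..n. g (X i)) - real n * expectation g}
    \<le> 2 * real n * l\<^sup>2 * expectation (\<lambda>x. (g x)\<^sup>2) * exp (- z)"
proof -
  interpret P: product_prob_space "\<lambda>_. M" "{1..n}" by unfold_locales
  let ?P = "PiM {1..n} (\<lambda>_. M)"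
  have P_prob: "prob_space ?P" by (rule prob_space_PiM) (rule prob_space_axioms)
  define v where "v = expectation (\<lambda>x. (g x)\<^sup>2)"
  define Y where "Y = (\<lambda>X. \<Sum>i=1..n. l * (g (X i) - expectation g))"
  define w where "w = real n * l\<^sup>2 * v"
  \<comment> \<open>The moment bound contributes e^w; a threshold shifted by w cancels it and leaves
    w e^(-z).\<close>
  define u where "u = w + z"
  have v: "v \<ge> 0" by (simp add: v_def)
  have w: "w \<ge> 0" using v by (simp add: w_def)
  have int_g: "integrable M g" by (rule integrable_const_bound[of _ B]) (auto intro: bd)
  have int_g2: "integrable M (\<lambda>x. (g x)\<^sup>2)"
    using power_mono[OF bd abs_ge_zero, of _ 2] by (intro integrable_const_bound[of _ "B\<^sup>2"]) auto
  obtain x0 where "x0 \<in> space M" using not_empty by auto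
  then have B: "B \<ge> 0" using bd[of x0] by linarith
  have Eg: "\<bar>expectation g\<bar> \<le> B"
  proof -
    have "\<bar>expectation g\<bar> \<le> expectation (\<lambda>x. \<bar>g x\<bar>)" by (rule integral_abs_bound)
    also have "\<dots> \<le> B" using int_g bd by (intro integral_le_const) auto
    finally show ?thesis .
  qed
  have cb: "\<bar>l * (g x - expectation g)\<bar> \<le> l * (2 * B)" if "x \<in> space M" for x
    unfolding abs_mult using l bd[OF that] Eg by (intro mult_mono) auto
  have int_e: "integrable M (\<lambda>x. exp (l * (g x - expectation g)))"
    using abs_le_D1[OF cb] by (intro integrable_const_bound[of _ "exp (l * (2 * B))"]) auto
  have int_lg: "integrable M (\<lambda>x. exp (l * g x))"
    using abs_le_D1[OF bd] l by (intro integrable_const_bound[of _ "exp (l * B)"]) auto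
  \<comment> \<open>The quadratic bound is applied to l g before centring, so l B \<le> 1 suffices
    and v may be the uncentred second moment.\<close>
  have mgf: "expectation (\<lambda>x. exp (l * (g x - expectation g))) \<le> exp (l\<^sup>2 * v)"
  proof -
    have "expectation (\<lambda>x. exp (l * g x)) \<le> expectation (\<lambda>x. 1 + l * g x + l\<^sup>2 * (g x)\<^sup>2)"
    proof (rule integral_mono[OF int_lg])
      show "integrable M (\<lambda>x. 1 + l * g x + l\<^sup>2 * (g x)\<^sup>2)" using int_g int_g2 by auto
      fix x assume x: "x \<in> space M"
      have "\<bar>l * g x\<bar> \<le> l * B" unfolding abs_mult using l bd[OF x] by (intro mult_mono) auto
      then have "\<bar>l * g x\<bar> \<le> 1" using l by linarith
      from exp_le_quadratic[OF this] show "exp (l * g x) \<le> 1 + l * g x + l\<^sup>2 * (g x)\<^sup>2"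
        by (simp add: power_mult_distrib)
    qed
    also have "\<dots> = 1 + l * expectation g + l\<^sup>2 * v"
      using int_g int_g2 by (simp add: v_def prob_space)
    also have "\<dots> \<le> exp (l * expectation g + l\<^sup>2 * v)"
      using exp_ge_add_one_self[of "l * expectation g + l\<^sup>2 * v"] by (simp add: add.assoc)
    finally have le: "expectation (\<lambda>x. exp (l * g x)) \<le> exp (l * expectation g + l\<^sup>2 * v)" .
    have "expectation (\<lambda>x. exp (l * (g x - expectation g))) = expectation (\<lambda>x. exp (- l * expectation g) * exp (l * g x))"
      by (intro arg_cong[where f = expectation] ext) (simp add: exp_add[symmetric] right_diff_distrib)
    also have "\<dots> = exp (- l * expectation g) * expectation (\<lambda>x. exp (l * g x))" by simp
    also have "\<dots> \<le> exp (- l * expectation g) * exp (l * expectation g + l\<^sup>2 * v)"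
      using le by (intro mult_left_mono) auto
    also have "\<dots> = exp (l\<^sup>2 * v)" by (simp add: exp_add[symmetric])
    finally show ?thesis .
  qed
  have meas_gi [measurable]: "(\<lambda>X. g (X i)) \<in> borel_measurable ?P" if "i \<in> {1..n}" for i
    using that by measurable
  have meas_Y [measurable]: "Y \<in> borel_measurable ?P"
    unfolding Y_def by (intro borel_measurable_sum borel_measurable_times borel_measurable_diff meas_gi) auto
  have Xi: "X i \<in> space M" if "X \<in> space ?P" "i \<in> {1..n}" for X i
    using that by (auto simp: space_PiM)
  have Yb: "\<bar>Y X\<bar> \<le> real n * (l * (2 * B))" if "X \<in> space ?P" for X
  proof -
    have "\<bar>Y X\<bar> \<le> (\<Sum>i=1..n. \<bar>l * (g (X i) - expectation g)\<bar>)" unfolding Y_def by (rule sum_abs)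
    also have "\<dots> \<le> (\<Sum>i=1..n. l * (2 * B))" by (intro sum_mono cb Xi that)
    finally show ?thesis by simp
  qed
  have int_Y: "integrable ?P Y"
    by (rule P.integrable_const_bound[of _ "real n * (l * (2 * B))"]) (auto intro: Yb)
  have int_eY: "integrable ?P (\<lambda>X. exp (Y X))"
    using abs_le_D1[OF Yb] by (intro P.integrable_const_bound[of _ "exp (real n * (l * (2 * B)))"]) auto
  have EY: "(\<integral>X. Y X \<partial>?P) = 0"
  proof -
    have "(\<integral>X. Y X \<partial>?P) = (\<Sum>i=1..n. \<integral>X. l * (g (X i) - expectation g) \<partial>?P)"
      unfolding Y_def
      by (intro Bochner_Integration.integral_sum P.integrable_const_bound[of _ "l * (2 * B)"])
        (auto intro!: cb Xi)
    also have "\<dots> = 0"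
    proof (rule sum.neutral, rule ballI)
      fix i assume i: "i \<in> {1..n}"
      have "(\<integral>X. l * (g (X i) - expectation g) \<partial>?P) = expectation (\<lambda>x. l * (g x - expectation g))"
        using i by (intro PiM_integral_component[of "\<lambda>x. l * (g x - expectation g)"]) auto
      also have "\<dots> = 0" using int_g by (simp add: prob_space)
      finally show "(\<integral>X. l * (g (X i) - expectation g) \<partial>?P) = 0" .
    qed
    finally show ?thesis .
  qed
  have EeY: "(\<integral>X. exp (Y X) \<partial>?P) \<le> exp w"
  proof -
    have "(\<integral>X. exp (Y X) \<partial>?P) = (\<integral>X. (\<Prod>i=1..n. exp (l * (g (X i) - expectation g))) \<partial>?P)"
      by (simp add: Y_def exp_sum)
    also have "\<dots> = (\<Prod>i=1..n. expectation (\<lambda>x. exp (l * (g x - expectation g))))"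
      using int_e by (intro P.product_integral_prod) auto
    also have "\<dots> \<le> exp (l\<^sup>2 * v) ^ n"
      using mgf by (simp add: power_mono)
    also have "\<dots> = exp w" by (simp add: w_def exp_of_nat_mult[symmetric] mult.assoc)
    finally show ?thesis .
  qed
  define E where "E = {X \<in> space ?P. u \<le> Y X}"
  have Em [measurable]: "E \<in> sets ?P" unfolding E_def by measurable
  have "measure ?P E * (exp u / 2) = (\<integral>X. indicator E X * (exp u / 2) \<partial>?P)"
    using Em by (simp add: mult.commute)
  \<comment> \<open>Markov's inequality in integrated form: the remainder is nonnegative everywhere
    and at least e^u / 2 on E.\<close>
  also have "\<dots> \<le> (\<integral>X. exp (Y X) - 1 - Y X \<partial>?P)"
  proof (rule integral_mono)
    show "integrable ?P (\<lambda>X. indicator E X * (exp u / 2))"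
      using Em by (intro integrable_mult_left integrable_real_indicator) (auto simp: P.emeasure_eq_measure)
    show "integrable ?P (\<lambda>X. exp (Y X) - 1 - Y X)" using int_Y int_eY by simp
    fix X
    show "indicator E X * (exp u / 2) \<le> exp (Y X) - 1 - Y X"
    proof (cases "X \<in> E")
      case True
      then have 1: "indicator E X = (1::real)" by simp
      have "exp u / 2 \<le> exp (Y X) - 1 - Y X"
        using True z w by (intro exp_remainder_ge) (auto simp: E_def u_def)
      then show ?thesis unfolding 1 mult_1 .
    next
      case False
      then have 0: "indicator E X = (0::real)" by simp
      have "0 \<le> exp (Y X) - 1 - Y X" using exp_ge_add_one_self[of "Y X"] by linarith
      then show ?thesis unfolding 0 mult_zero_left .
    qed
  qed
  also have "\<dots> = (\<integral>X. exp (Y X) \<partial>?P) - 1" using int_Y int_eY EY by (simp add: prob_space.prob_space[OF P_prob])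
  also have "\<dots> \<le> exp w - 1" using EeY by simp
  \<comment> \<open>Since Y is centred, subtracting 1 + Y removes the constant term of the moment
    bound, and what is left is proportional to w, hence to v.\<close>
  also have "\<dots> \<le> w * exp w"
  proof -
    have "exp w * (1 + (- w)) \<le> exp w * exp (- w)" by (intro mult_left_mono exp_ge_add_one_self) auto
    then show ?thesis by (simp add: exp_minus algebra_simps)
  qed
  finally have "measure ?P E \<le> w * exp w * 2 / exp u" by (simp add: field_simps)
  also have "\<dots> = 2 * w * exp (- z)" by (simp add: u_def exp_add exp_minus field_simps)
  finally have main: "measure ?P E \<le> 2 * w * exp (- z)" .
  have "{X \<in> space ?P. real n * l * v + z / l \<le> (\<Sum>i=1..n. g (X i)) - real n * expectation g} = E"
  proof -
    have "real n * l * v + z / l \<le> (\<Sum>i=1..n. g (X i)) - real n * expectation g \<longleftrightarrow> u \<le> Y X" for X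
    proof -
      have "Y X = l * ((\<Sum>i=1..n. g (X i)) - real n * expectation g)"
        by (simp add: Y_def sum_distrib_left[symmetric] sum_subtractf)
      moreover have "u = l * (real n * l * v + z / l)"
        using l by (simp add: u_def w_def power2_eq_square algebra_simps)
      ultimately show ?thesis using l by simp
    qed
    then show ?thesis by (simp add: E_def)
  qed
  then show ?thesis using main by (simp add: v_def w_def mult.assoc)
qed

text \<open>Two different bounds on the second moment are in play. The majorant v sets the size of
  the deviation, while the probability keeps the true second moment, which is later bounded by B^2
  times the mass of a window.\<close>

lemma bernstein_iid:
  fixes g :: "'a \<Rightarrow> real"
  assumes g [measurable]: "g \<in> borel_measurable M"
    and bd: "\<And>x. x \<in> space M \<Longrightarrow> \<bar>g x\<bar> \<le> B" and B: "B > 0"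
    and v: "expectation (\<lambda>x. (g x)\<^sup>2) \<le> v" and z: "z \<ge> 3"
  shows "measure (PiM {1..n} (\<lambda>_. M)) {X \<in> space (PiM {1..n} (\<lambda>_. M)).
      2 * sqrt (real n * v * z) + z * B < (\<Sum>i=1..n. g (X i)) - real n * expectation g}
    \<le> 2 * real n * (expectation (\<lambda>x. (g x)\<^sup>2) / B\<^sup>2) * exp (- z)" (is "measure ?P ?E \<le> _")
proof -
  interpret P: product_prob_space "\<lambda>_. M" "{1..n}" by unfold_locales
  define v0 where "v0 = expectation (\<lambda>x. (g x)\<^sup>2)"
  have v0: "0 \<le> v0" "v0 \<le> v" using v by (auto simp: v0_def)
  \<comment> \<open>The value sqrt (z / (n v)) balances the terms n l v and z / l; the cap 1/B keeps
    l B \<le> 1 and produces the linear term z B. For n = 0 or v = 0 the cap alone is used.\<close>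
  define l where "l = (if n = 0 \<or> v = 0 then 1 / B else min (1 / B) (sqrt (z / (real n * v))))"
  have l: "0 < l" "l \<le> 1 / B"
    using B z v0 by (auto simp: l_def intro!: divide_pos_pos mult_pos_pos)
  have lB: "l * B \<le> 1" using l B by (simp add: field_simps)
  have le: "real n * l * v0 + z / l \<le> 2 * sqrt (real n * v * z) + z * B"
  proof (cases "n = 0 \<or> v = 0")
    case True
    then show ?thesis using v0 z B by (auto simp: l_def)
  next
    case False
    define s where "s = sqrt (real n * v * z)"
    define r where "r = sqrt (z / (real n * v))"
    have pos: "real n * v > 0" "z > 0" using False v0 z by auto
    have rpos: "r > 0" using pos by (simp add: r_def)
    have "real n * v * r = s"
    proof -
      define w where "w = real n * v"
      have "w * sqrt (z / w) = sqrt (w\<^sup>2) * sqrt (z / w)" using pos by (simp add: w_def)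
      also have "\<dots> = sqrt (w * z)" using pos unfolding real_sqrt_mult[symmetric] w_def[symmetric]
        by (simp add: power2_eq_square)
      finally show ?thesis by (simp add: r_def s_def w_def)
    qed
    have "z / r = s"
    proof -
      have nv: "real n * v \<noteq> 0" using pos(1) by linarith
      have "s * r = sqrt ((real n * v * z) * (z / (real n * v)))"
        unfolding s_def r_def by (rule real_sqrt_mult[symmetric])
      also have "(real n * v * z) * (z / (real n * v)) = z\<^sup>2"
        using nv by (simp add: power2_eq_square)
      finally have "s * r = z" using pos(2) by simp
      then show ?thesis using rpos by (simp add: field_simps)
    qed
    have ll: "l = min (1 / B) r" using False by (simp add: l_def r_def)
    have "real n * l * v0 \<le> real n * r * v"
      using ll v0 rpos B by (intro mult_mono mult_left_mono) auto
    then have 1: "real n * l * v0 \<le> s" using \<open>real n * v * r = s\<close> by (simp add: mult_ac)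
    have "z / l \<le> z * B + z / r"
      using ll B rpos pos by (auto simp: min_def)
    then show ?thesis using 1 \<open>z / r = s\<close> v0 by (simp add: s_def)
  qed
  have "measure ?P ?E \<le> measure ?P {X \<in> space ?P.
      real n * l * v0 + z / l \<le> (\<Sum>i=1..n. g (X i)) - real n * expectation g}"
  proof (rule P.finite_measure_mono)
    have "(\<lambda>X. g (X i)) \<in> borel_measurable ?P" if "i \<in> {1..n}" for i using that by measurable
    then show "{X \<in> space ?P. real n * l * v0 + z / l \<le> (\<Sum>i=1..n. g (X i)) - real n * expectation g} \<in> sets ?P"
      by (intro borel_measurable_le borel_measurable_const borel_measurable_diff borel_measurable_sum) auto
  qed (use le in auto)
  also have "\<dots> \<le> 2 * real n * l\<^sup>2 * v0 * exp (- z)"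
    unfolding v0_def by (rule bernstein_iid_aux[OF g bd l(1) lB z])
  also have "\<dots> \<le> 2 * real n * (1 / B)\<^sup>2 * v0 * exp (- z)"
    using l v0 by (intro mult_right_mono mult_left_mono power_mono) auto
  finally show ?thesis by (simp add: v0_def power_divide)
qed

end

section \<open>Marginals and independence partitions\<close>

interpretation lborel_product: product_sigma_finite "\<lambda>_::nat. lborel :: real measure"
  by unfold_locales

lemma space_leb [simp]: "space (leb I) = I \<rightarrow>\<^sub>E UNIV"
  by (simp add: leb_def space_PiM)

lemma measurable_restrict_leb [measurable]:
  "I \<subseteq> J \<Longrightarrow> (\<lambda>x. restrict x I) \<in> leb J \<rightarrow>\<^sub>M leb I"
  unfolding leb_def by (rule measurable_restrict_subset)

lemma restrict_merge_left: "x \<in> I \<rightarrow>\<^sub>E UNIV \<Longrightarrow> restrict (merge I J (x, y)) I = x"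
  by (auto simp: merge_def restrict_def PiE_def extensional_def)

lemma restrict_merge_right: "I \<inter> J = {} \<Longrightarrow> y \<in> J \<rightarrow>\<^sub>E UNIV \<Longrightarrow> restrict (merge I J (x, y)) J = y"
  by (rule ext) (auto simp: merge_def restrict_def PiE_def extensional_def)

lemma integral_leb_union:
  fixes u w :: "point \<Rightarrow> real"
  assumes IJ: "I \<inter> J = {}" "finite I" "finite J"
    and u: "integrable (leb I) u" and w: "integrable (leb J) w"
  shows "integrable (leb (I \<union> J)) (\<lambda>x. u (restrict x I) * w (restrict x J))"
    and "(\<integral>x. u (restrict x I) * w (restrict x J) \<partial>leb (I \<union> J)) = integral\<^sup>L (leb I) u * integral\<^sup>L (leb J) w"
proof -
  have um [measurable]: "u \<in> borel_measurable (leb I)" and wm [measurable]: "w \<in> borel_measurable (leb J)"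
    using u w by auto
  have m: "(\<lambda>x. u (restrict x I) * w (restrict x J)) \<in> borel_measurable (leb (I \<union> J))"
    by (intro borel_measurable_times measurable_compose[OF measurable_restrict_leb um]
        measurable_compose[OF measurable_restrict_leb wm]) auto
  have m2: "(\<lambda>x. ennreal (norm (u (restrict x I) * w (restrict x J)))) \<in> borel_measurable (leb (I \<union> J))"
    using m by measurable
  have sp: "space (Pi\<^sub>M I (\<lambda>_. lborel)) = I \<rightarrow>\<^sub>E (UNIV::real set)" for I :: "nat set" by (simp add: space_PiM)
  have "(\<integral>\<^sup>+x. ennreal (norm (u (restrict x I) * w (restrict x J))) \<partial>leb (I \<union> J)) =
     (\<integral>\<^sup>+x. (\<integral>\<^sup>+y. ennreal (norm (u x)) * ennreal (norm (w y)) \<partial>leb J) \<partial>leb I)"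
    unfolding leb_def
    by (subst lborel_product.product_nn_integral_fold[OF IJ m2[unfolded leb_def]])
      (auto intro!: nn_integral_cong simp: sp restrict_merge_left restrict_merge_right[OF IJ(1)] abs_mult ennreal_mult)
  also have "\<dots> = (\<integral>\<^sup>+y. ennreal (norm (w y)) \<partial>leb J) * (\<integral>\<^sup>+x. ennreal (norm (u x)) \<partial>leb I)"
    by (simp add: nn_integral_cmult nn_integral_multc mult.commute)
  also have "\<dots> < \<infinity>"
    using u w by (simp add: integrable_iff_bounded ennreal_mult_less_top)
  finally show int: "integrable (leb (I \<union> J)) (\<lambda>x. u (restrict x I) * w (restrict x J))"
    using m by (simp add: integrable_iff_bounded)
  have "(\<integral>x. u (restrict x I) * w (restrict x J) \<partial>leb (I \<union> J)) = (\<integral>x. (\<integral>y. u x * w y \<partial>leb J) \<partial>leb I)"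
    unfolding leb_def lborel_product.product_integral_fold[OF IJ int[unfolded leb_def]]
    by (intro Bochner_Integration.integral_cong refl)
      (simp only: sp restrict_merge_left restrict_merge_right[OF IJ(1)])
  then show "(\<integral>x. u (restrict x I) * w (restrict x J) \<partial>leb (I \<union> J)) = integral\<^sup>L (leb I) u * integral\<^sup>L (leb J) w"
    by (simp add: mult.commute)
qed

lemma integral_leb_partition:
  fixes g :: "nat set \<Rightarrow> point \<Rightarrow> real"
  assumes "finite P" "disjoint P" "\<And>I. I \<in> P \<Longrightarrow> finite I" "\<And>I. I \<in> P \<Longrightarrow> integrable (leb I) (g I)"
  shows "integrable (leb (\<Union>P)) (\<lambda>x. \<Prod>I\<in>P. g I (restrict x I))
     \<and> (\<integral>x. (\<Prod>I\<in>P. g I (restrict x I)) \<partial>leb (\<Union>P)) = (\<Prod>I\<in>P. integral\<^sup>L (leb I) (g I))"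
  using assms
proof (induction P rule: finite_induct)
  case empty
  \<comment> \<open>\<open>leb {}\<close> is a single point of mass 1, so the empty product
    integrates to 1.\<close>
  interpret finite_measure "Pi\<^sub>M {} (\<lambda>_::nat. lborel :: real measure)"
    by rule (simp add: space_PiM)
  show ?case by (simp add: leb_def space_PiM measure_def)
next
  case (insert I P)
  define w where "w = (\<lambda>x. \<Prod>J\<in>P. g J (restrict x J))"
  have "disjoint P" using insert.prems(1) by (simp add: pairwise_insert)
  then have "integrable (leb (\<Union>P)) w \<and> integral\<^sup>L (leb (\<Union>P)) w = (\<Prod>I\<in>P. integral\<^sup>L (leb I) (g I))"
    unfolding w_def by (rule insert.IH) (use insert.prems in blast)+
  then have IH: "integrable (leb (\<Union>P)) w" "integral\<^sup>L (leb (\<Union>P)) w = (\<Prod>I\<in>P. integral\<^sup>L (leb I) (g I))"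
    by blast+
  have IJ: "I \<inter> \<Union>P = {}"
  proof -
    have "I \<inter> J = {}" if "J \<in> P" for J
      using insert.prems(1) insert.hyps(2) that by (auto simp: pairwise_insert disjnt_def)
    then show ?thesis by auto
  qed
  have fin: "finite I" "finite (\<Union>P)" using insert by auto
  have w: "w (restrict x (\<Union>P)) = (\<Prod>J\<in>P. g J (restrict x J))" for x
    unfolding w_def by (intro prod.cong refl arg_cong[where f = "g _"]) (auto simp: Int_absorb1 Union_upper)
  show ?case
    unfolding prod.insert[OF insert.hyps] Union_insert w[symmetric] IH(2)[symmetric]
    by (rule conjI[OF integral_leb_union[OF IJ fin insert.prems(3)[OF insertI1] IH(1)]])
qed

lemma partition_prod:
  assumes "P \<in> partitions d" "I \<subseteq> {1..d}"
  shows "(\<Prod>J\<in>P. \<Prod>j\<in>J \<inter> I. g j) = (\<Prod>j\<in>I. g j)"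
proof -
  have P: "\<Union>P = {1..d}" "disjoint P" "{} \<notin> P" using assms(1) by (auto simp: partitions_def partition_on_def)
  have fin: "finite J" if "J \<in> P" for J using partitions_index_sets[OF assms(1) that] index_sets_card by blast
  have I: "I = (\<Union>J\<in>P. J \<inter> I)" using P(1) assms(2) by blast
  have "(\<Prod>j\<in>(\<Union>J\<in>P. J \<inter> I). g j) = (\<Prod>J\<in>P. \<Prod>j\<in>J \<inter> I. g j)"
  proof (rule prod.UNION_disjoint)
    show "finite P" using assms(1) by (rule partitions_finite)
    show "\<forall>i\<in>P. \<forall>j\<in>P. i \<noteq> j \<longrightarrow> i \<inter> I \<inter> (j \<inter> I) = {}"
      using P(2) by (auto simp: pairwise_def disjnt_def)
  qed (use fin in auto)
  then show ?thesis using I by simp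
qed

text \<open>The normalisation G {} = 1 makes the empty intersections, which \<diamond> omits,
  harmless. A non-empty intersection determines both of its blocks because blocks are disjoint, so
  no two pairs collapse to one element of the set P \<diamond> P'.\<close>

lemma prod_meet:
  fixes G :: "nat set \<Rightarrow> 'a :: comm_monoid_mult"
  assumes P: "P \<in> partitions d" and P': "P' \<in> partitions d" and G: "G {} = 1"
  shows "(\<Prod>I'\<in>P'. \<Prod>I\<in>P. G (I \<inter> I')) = (\<Prod>J\<in>P \<diamond> P'. G J)"
proof -
  have fin: "finite P" "finite P'" using P P' partitions_finite by auto
  have dP: "disjoint P" "disjoint P'" using P P' by (auto simp: partitions_def partition_on_def)
  define S where "S = {(I', I). I' \<in> P' \<and> I \<in> P \<and> I \<inter> I' \<noteq> {}}"
  have "(\<Prod>I'\<in>P'. \<Prod>I\<in>P. G (I \<inter> I')) = (\<Prod>(I', I)\<in>P' \<times> P. G (I \<inter> I'))"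
    by (rule prod.cartesian_product)
  also have "\<dots> = (\<Prod>(I', I)\<in>S. G (I \<inter> I'))"
    using fin G by (intro prod.mono_neutral_right) (auto simp: S_def)
  also have "\<dots> = (\<Prod>J\<in>(\<lambda>(I', I). I \<inter> I') ` S. G J)"
  proof (subst prod.reindex)
    show "inj_on (\<lambda>(I', I). I \<inter> I') S"
    proof (rule inj_onI, clarify)
      fix I1' I1 I2' I2
      assume s: "(I1', I1) \<in> S" "(I2', I2) \<in> S" "I1 \<inter> I1' = I2 \<inter> I2'"
      then obtain j where "j \<in> I1" "j \<in> I1'" "j \<in> I2" "j \<in> I2'" by (auto simp: S_def)
      then show "I1' = I2' \<and> I1 = I2"
        using s dP unfolding S_def pairwise_def disjnt_def by blast
    qed
  qed (simp add: case_prod_unfold o_def)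
  also have "(\<lambda>(I', I). I \<inter> I') ` S = P \<diamond> P'"
    by (auto simp: S_def meet_def image_iff)
  finally show ?thesis .
qed

lemma meet_commute: "P \<diamond> P' = P' \<diamond> P"
  unfolding meet_def by (auto simp: Int_commute)

lemma finite_meet: "P \<in> partitions d \<Longrightarrow> P' \<in> partitions d \<Longrightarrow> finite (P \<diamond> P')"
proof -
  assume "P \<in> partitions d" "P' \<in> partitions d"
  then have "finite ((\<lambda>(I, I'). I \<inter> I') ` (P \<times> P'))"
    using partitions_finite by auto
  then show ?thesis by (rule finite_subset[rotated]) (auto simp: meet_def)
qed

lemma meet_index_sets:
  assumes "P \<in> partitions d" "J \<in> P \<diamond> P'"
  shows "J \<in> index_sets d"
proof -
  obtain I I' where "J = I \<inter> I'" "I \<in> P" "J \<noteq> {}" using assms(2) by (auto simp: meet_def)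
  then show ?thesis using partitions_index_sets[OF assms(1)] by (auto simp: index_sets_def)
qed

text \<open>Choosing one point from each block is injective. The bound limits the number of factors
  by d for P and for P \<diamond> P' alike.\<close>

lemma card_disjoint_le:
  assumes "disjoint P" "\<And>I. I \<in> P \<Longrightarrow> I \<in> index_sets d"
  shows "card P \<le> d"
proof -
  have "card P \<le> card (\<Union>P)"
  proof -
    have "inj_on (\<lambda>I. SOME j. j \<in> I) P"
    proof (rule inj_onI)
      fix I J assume IJ: "I \<in> P" "J \<in> P" "(SOME j. j \<in> I) = (SOME j. j \<in> J)"
      have "(SOME j. j \<in> I) \<in> I" "(SOME j. j \<in> J) \<in> J"
        using assms(2)[OF IJ(1)] assms(2)[OF IJ(2)] by (simp_all add: index_sets_def some_in_eq)
      then show "I = J" using IJ assms(1) unfolding pairwise_def disjnt_def by (metis disjoint_iff)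
    qed
    moreover have "(\<lambda>I. SOME j. j \<in> I) ` P \<subseteq> \<Union>P"
      using assms(2) by (auto simp: index_sets_def some_in_eq)
    moreover have "finite (\<Union>P)"
      using assms(2) by (intro finite_subset[of "\<Union>P" "{1..d}"]) (auto simp: index_sets_def)
    ultimately show ?thesis by (rule card_inj_on_le)
  qed
  also have "\<dots> \<le> card {1..d}" using assms(2) by (intro card_mono) (auto simp: index_sets_def)
  finally show ?thesis by simp
qed

lemma card_partition_le: "P \<in> partitions d \<Longrightarrow> card P \<le> d"
  using partitions_index_sets by (intro card_disjoint_le) (auto simp: partitions_def partition_on_def)

lemma disjoint_meet: "P \<in> partitions d \<Longrightarrow> P' \<in> partitions d \<Longrightarrow> disjoint (P \<diamond> P')"
  unfolding partitions_def partition_on_def meet_def pairwise_def disjnt_def by blast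

lemma card_meet_le: "P \<in> partitions d \<Longrightarrow> P' \<in> partitions d \<Longrightarrow> card (P \<diamond> P') \<le> d"
  using meet_index_sets by (intro card_disjoint_le disjoint_meet) auto

context kernel
begin

lemma kern_restrict: "kern K h I (\<lambda>j. restrict t I j - x j) = kern K h I (\<lambda>j. t j - x j)"
  unfolding kern_eq_prod by (intro prod.cong) auto

lemma kern_measurable [measurable]:
  assumes "I \<subseteq> J"
  shows "(\<lambda>t. kern K h I (\<lambda>j. t j - x j)) \<in> borel_measurable (leb J)"
proof -
  have "(\<lambda>t. t j) \<in> borel_measurable (leb J)" if "j \<in> I" for j
    unfolding leb_def using measurable_component_singleton[of j J "\<lambda>_. lborel :: real measure"] assms that by auto
  then show ?thesis
    unfolding kern_eq_prod
    by (intro borel_measurable_prod measurable_compose[OF _ measurable_kern1] borel_measurable_diff) auto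
qed

lemma kern_integral:
  assumes "finite I" "\<And>j. j \<in> I \<Longrightarrow> 0 < h j"
  shows "has_bochner_integral (leb I) (\<lambda>t. kern K h I (\<lambda>j. t j - x j)) 1"
    and "has_bochner_integral (leb I) (\<lambda>t. \<bar>kern K h I (\<lambda>j. t j - x j)\<bar>) ((\<integral>t. \<bar>K t\<bar> \<partial>lborel) ^ card I)"
proof -
  have 1: "has_bochner_integral lborel (\<lambda>s. kern1 K (h j) (s - x j)) 1"
    "has_bochner_integral lborel (\<lambda>s. \<bar>kern1 K (h j) (s - x j)\<bar>) (\<integral>t. \<bar>K t\<bar> \<partial>lborel)" if "j \<in> I" for j
    using lborel_has_bochner_integral_real_affine_iff[of 1 "kern1 K (h j)" 1 "- x j"]
      lborel_has_bochner_integral_real_affine_iff[of 1 "\<lambda>s. \<bar>kern1 K (h j) s\<bar>" "\<integral>t. \<bar>K t\<bar> \<partial>lborel" "- x j"]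
      has_bochner_integral_kern1 assms(2)[OF that] by auto
  have i: "integrable (leb I) (\<lambda>t. \<Prod>j\<in>I. kern1 K (h j) (t j - x j))"
    unfolding leb_def using assms 1
    by (intro lborel_product.product_integrable_prod[where f = "\<lambda>j s. kern1 K (h j) (s - x j)"])
      (auto simp: has_bochner_integral_iff)
  have "(\<integral>t. (\<Prod>j\<in>I. kern1 K (h j) (t j - x j)) \<partial>leb I) = (\<Prod>j\<in>I. \<integral>s. kern1 K (h j) (s - x j) \<partial>lborel)"
    unfolding leb_def using assms 1
    by (intro lborel_product.product_integral_prod[where f = "\<lambda>j s. kern1 K (h j) (s - x j)"])
      (auto simp: has_bochner_integral_iff)
  also have "\<dots> = 1" using 1 by (auto simp: has_bochner_integral_iff intro!: prod.neutral)
  finally show "has_bochner_integral (leb I) (\<lambda>t. kern K h I (\<lambda>j. t j - x j)) 1"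
    using i by (simp add: kern_eq_prod has_bochner_integral_iff)
  have "(\<integral>t. (\<Prod>j\<in>I. \<bar>kern1 K (h j) (t j - x j)\<bar>) \<partial>leb I) = (\<Prod>j\<in>I. \<integral>s. \<bar>kern1 K (h j) (s - x j)\<bar> \<partial>lborel)"
    unfolding leb_def using assms 1
    by (intro lborel_product.product_integral_prod[where f = "\<lambda>j s. \<bar>kern1 K (h j) (s - x j)\<bar>"])
      (auto simp: has_bochner_integral_iff)
  also have "\<dots> = (\<integral>t. \<bar>K t\<bar> \<partial>lborel) ^ card I" using 1 by (simp add: has_bochner_integral_iff)
  finally show "has_bochner_integral (leb I) (\<lambda>t. \<bar>kern K h I (\<lambda>j. t j - x j)\<bar>) ((\<integral>t. \<bar>K t\<bar> \<partial>lborel) ^ card I)"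
    using integrable_abs[OF i] by (simp add: kern_eq_prod has_bochner_integral_iff abs_prod)
qed

end

section \<open>The law of one observation: marginals, means and bias\<close>

locale kde = kernel K L for K L +
  fixes d :: nat and f :: "point \<Rightarrow> real" and bf :: real
  assumes f_class: "f \<in> dens_class d bf" and d_pos: "1 \<le> d" and bf_pos: "0 < bf"
begin

definition \<mu> :: "point measure" where "\<mu> = density (leb {1..d}) (\<lambda>x. ennreal (f x))"

abbreviation "marg \<equiv> marginal d f"

text \<open>The expectation of \<open>est1\<close>, written as an integral against the full law
  \<mu>, so that one probability space serves all index sets in the concentration bounds.\<close>

definition mean :: "point \<Rightarrow> nat set \<Rightarrow> point \<Rightarrow> real" where
  "mean h I x = (\<integral>t. kern K h I (\<lambda>j. t j - x j) \<partial>\<mu>)"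

definition abs_mean :: "point \<Rightarrow> nat set \<Rightarrow> point \<Rightarrow> real" where
  "abs_mean h I x = (\<integral>t. \<bar>kern K h I (\<lambda>j. t j - x j)\<bar> \<partial>\<mu>)"

lemma f_measurable [measurable]: "f \<in> borel_measurable (leb {1..d})"
  and f_nonneg: "x \<in> {1..d} \<rightarrow>\<^sub>E UNIV \<Longrightarrow> 0 \<le> f x"
  and f_integral: "(\<integral>\<^sup>+ x. ennreal (f x) \<partial>leb {1..d}) = 1"
  using f_class by (auto simp: dens_class_def is_density_def)

lemma emarginal_le:
  assumes "I \<in> index_sets d" "x \<in> I \<rightarrow>\<^sub>E UNIV"
  shows "emarginal d f I x \<le> ennreal bf"
proof -
  have "emarginal d f I x \<le> (SUP x \<in> I \<rightarrow>\<^sub>E UNIV. emarginal d f I x)" using assms(2) by (rule SUP_upper)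
  also have "\<dots> \<le> (SUP I \<in> index_sets d. SUP x \<in> I \<rightarrow>\<^sub>E UNIV. emarginal d f I x)" using assms(1) by (rule SUP_upper)
  also have "\<dots> \<le> ennreal bf" using f_class by (simp add: dens_class_def)
  finally show ?thesis .
qed

lemma emarginal_restrict: "emarginal d f I (restrict x I) = emarginal d f I x"
  unfolding emarginal_def by (intro nn_integral_cong arg_cong[where f = "\<lambda>x. ennreal (f x)"]) (auto simp: merge_def)

lemma marginal_restrict: "marg I (restrict x I) = marg I x"
  by (simp add: marginal_def emarginal_restrict)

lemma ennreal_marginal:
  assumes "I \<in> index_sets d" "x \<in> I \<rightarrow>\<^sub>E UNIV"
  shows "ennreal (marg I x) = emarginal d f I x"
  using emarginal_le[OF assms] unfolding marginal_def
  by (metis ennreal_enn2real_if ennreal_less_top infinity_ennreal_def leD)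

lemma marginal_nonneg: "0 \<le> marg I x"
  by (simp add: marginal_def)

lemma marginal_le:
  assumes "I \<in> index_sets d" "x \<in> I \<rightarrow>\<^sub>E UNIV"
  shows "marg I x \<le> bf"
  using emarginal_le[OF assms] bf_pos unfolding ennreal_marginal[OF assms, symmetric] by simp

lemma merge_measurable_leb: "I \<inter> J = {} \<Longrightarrow> I \<union> J = {1..d} \<Longrightarrow> merge I J \<in> leb I \<Otimes>\<^sub>M leb J \<rightarrow>\<^sub>M leb {1..d}"
  unfolding leb_def using measurable_merge[of I J "\<lambda>_. lborel :: real measure"] by simp

lemma emarginal_measurable [measurable]:
  assumes "I \<in> index_sets d"
  shows "emarginal d f I \<in> borel_measurable (leb I)"
proof -
  let ?J = "{1..d} - I"
  have U: "I \<inter> ?J = {}" "I \<union> ?J = {1..d}" using assms by (auto simp: index_sets_def)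
  interpret J: sigma_finite_measure "leb ?J"
    unfolding leb_def by (intro lborel_product.sigma_finite) auto
  have "(\<lambda>p. ennreal (f (merge I ?J p))) \<in> borel_measurable (leb I \<Otimes>\<^sub>M leb ?J)"
    using measurable_compose[OF merge_measurable_leb[OF U] f_measurable] by simp
  then have "(\<lambda>x. \<integral>\<^sup>+y. ennreal (f (merge I ?J (x, y))) \<partial>leb ?J) \<in> borel_measurable (leb I)"
    by (intro J.borel_measurable_nn_integral) (simp add: case_prod_unfold)
  then show ?thesis unfolding emarginal_def[abs_def] .
qed

lemma marginal_measurable [measurable]:
  "I \<in> index_sets d \<Longrightarrow> marg I \<in> borel_measurable (leb I)"
  unfolding marginal_def[abs_def] by measurable

lemma index_sets_subset: "I \<in> index_sets d \<Longrightarrow> I \<subseteq> {1..d}"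
  by (simp add: index_sets_def)

lemma full_index_set: "{1..d} \<in> index_sets d"
  using d_pos by (auto simp: index_sets_def)

lemma marginal_full: "x \<in> {1..d} \<rightarrow>\<^sub>E UNIV \<Longrightarrow> marg {1..d} x = f x"
proof -
  assume x: "x \<in> {1..d} \<rightarrow>\<^sub>E UNIV"
  have "merge {1..d} {} (x, y) = x" for y
    using x by (auto simp: merge_def PiE_def extensional_def)
  moreover have "emeasure (leb {}) (space (leb {})) = 1" by (simp add: leb_def space_PiM)
  ultimately have "emarginal d f {1..d} x = ennreal (f x)" by (simp add: emarginal_def leb_def space_PiM)
  then show ?thesis using f_nonneg[OF x] by (simp add: marginal_def)
qed

sublocale \<mu>: prob_space \<mu>
proof
  show "emeasure \<mu> (space \<mu>) = 1"
  proof -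
    have "emeasure \<mu> (space \<mu>) = (\<integral>\<^sup>+ x. ennreal (f x) * indicator (space (leb {1..d})) x \<partial>leb {1..d})"
      unfolding \<mu>_def space_density by (rule emeasure_density[OF _ sets.top]) auto
    also have "\<dots> = (\<integral>\<^sup>+ x. ennreal (f x) \<partial>leb {1..d})"
      by (intro nn_integral_cong) simp
    finally show ?thesis using f_integral by simp
  qed
qed

lemma space_\<mu> [simp]: "space \<mu> = {1..d} \<rightarrow>\<^sub>E UNIV" and sets_\<mu> [measurable_cong]: "sets \<mu> = sets (leb {1..d})"
  by (simp_all add: \<mu>_def)

text \<open>Tonelli along I and its complement identifies the pointwise defined marginal as a
  density of the coordinates in I. Replacing \<open>emarginal\<close> by its real version is
  legitimate because the class bound makes it finite at every point.\<close>

lemma distr_\<mu>: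
  assumes I: "I \<in> index_sets d"
  shows "distr \<mu> (leb I) (\<lambda>t. restrict t I) = density (leb I) (\<lambda>x. ennreal (marg I x))"
proof (rule measure_eqI)
  let ?J = "{1..d} - I"
  have U: "I \<inter> ?J = {}" "I \<union> ?J = {1..d}" "finite I" "finite ?J" using I index_sets_card[OF I] by (auto simp: index_sets_def)
  fix A assume "A \<in> sets (distr \<mu> (leb I) (\<lambda>t. restrict t I))"
  then have A [measurable]: "A \<in> sets (leb I)" by simp
  have r [measurable]: "(\<lambda>t. restrict t I) \<in> leb {1..d} \<rightarrow>\<^sub>M leb I" using U by (intro measurable_restrict_leb) auto
  then have r' [measurable]: "(\<lambda>t. restrict t I) \<in> \<mu> \<rightarrow>\<^sub>M leb I" unfolding measurable_cong_sets[OF sets_\<mu> refl] .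
  have im [measurable]: "(\<lambda>t. indicator A (restrict t I) :: ennreal) \<in> borel_measurable (leb {1..d})"
    using measurable_compose[OF r borel_measurable_indicator[OF A]] .
  have "emeasure (distr \<mu> (leb I) (\<lambda>t. restrict t I)) A = (\<integral>\<^sup>+t. indicator A t \<partial>distr \<mu> (leb I) (\<lambda>t. restrict t I))"
    by simp
  also have "\<dots> = (\<integral>\<^sup>+t. indicator A (restrict t I) \<partial>\<mu>)"
    by (intro nn_integral_distr r' borel_measurable_indicator) simp
  also have "\<dots> = (\<integral>\<^sup>+t. ennreal (f t) * indicator A (restrict t I) \<partial>leb (I \<union> ?J))"
    unfolding \<mu>_def U(2) by (rule nn_integral_density) auto
  also have "\<dots> = (\<integral>\<^sup>+x. (\<integral>\<^sup>+y. ennreal (f (merge I ?J (x, y))) * indicator A (restrict (merge I ?J (x, y)) I) \<partial>leb ?J) \<partial>leb I)"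
    unfolding leb_def by (intro lborel_product.product_nn_integral_fold[OF U(1,3,4)]) (unfold U(2) leb_def[symmetric], auto)
  also have "\<dots> = (\<integral>\<^sup>+x. (\<integral>\<^sup>+y. ennreal (f (merge I ?J (x, y))) * indicator A x \<partial>leb ?J) \<partial>leb I)"
    by (intro nn_integral_cong) (simp add: restrict_merge_left)
  also have "\<dots> = (\<integral>\<^sup>+x. emarginal d f I x * indicator A x \<partial>leb I)"
  proof (intro nn_integral_cong)
    fix x assume x: "x \<in> space (leb I)"
    have "(\<lambda>y. ennreal (f (merge I ?J (x, y)))) \<in> borel_measurable (leb ?J)"
      using measurable_compose[OF measurable_Pair1'[OF x] measurable_compose[OF merge_measurable_leb[OF U(1,2)] f_measurable]] by simp
    then show "(\<integral>\<^sup>+y. ennreal (f (merge I ?J (x, y))) * indicator A x \<partial>leb ?J) = emarginal d f I x * indicator A x"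
      unfolding emarginal_def by (rule nn_integral_multc)
  qed
  also have "\<dots> = (\<integral>\<^sup>+x. ennreal (marg I x) * indicator A x \<partial>leb I)"
    by (intro nn_integral_cong) (simp add: ennreal_marginal[OF I])
  also have "\<dots> = emeasure (density (leb I) (\<lambda>x. ennreal (marg I x))) A"
    using I by (subst emeasure_density) auto
  finally show "emeasure (distr \<mu> (leb I) (\<lambda>t. restrict t I)) A = emeasure (density (leb I) (\<lambda>x. ennreal (marg I x))) A" .
qed simp

lemma integral_\<mu>:
  fixes g :: "point \<Rightarrow> real"
  assumes I: "I \<in> index_sets d" and g [measurable]: "g \<in> borel_measurable (leb I)"
  shows "(\<integral>t. g (restrict t I) \<partial>\<mu>) = (\<integral>x. marg I x * g x \<partial>leb I)"
    and "integrable \<mu> (\<lambda>t. g (restrict t I)) \<longleftrightarrow> integrable (leb I) (\<lambda>x. marg I x * g x)"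
proof -
  have r: "(\<lambda>t. restrict t I) \<in> \<mu> \<rightarrow>\<^sub>M leb I"
    unfolding measurable_cong_sets[OF sets_\<mu> refl] by (intro measurable_restrict_leb index_sets_subset I)
  have [measurable]: "marg I \<in> borel_measurable (leb I)" using I by measurable
  have "(\<integral>t. g (restrict t I) \<partial>\<mu>) = (\<integral>x. g x \<partial>distr \<mu> (leb I) (\<lambda>t. restrict t I))"
    by (intro integral_distr[symmetric] r g)
  also have "\<dots> = (\<integral>x. marg I x * g x \<partial>leb I)"
    unfolding distr_\<mu>[OF I] by (subst integral_density) (auto simp: marginal_nonneg)
  finally show "(\<integral>t. g (restrict t I) \<partial>\<mu>) = (\<integral>x. marg I x * g x \<partial>leb I)" .
  have "integrable \<mu> (\<lambda>t. g (restrict t I)) \<longleftrightarrow> integrable (distr \<mu> (leb I) (\<lambda>t. restrict t I)) g"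
    by (intro integrable_distr_eq[symmetric] r g)
  also have "\<dots> \<longleftrightarrow> integrable (leb I) (\<lambda>x. marg I x * g x)"
    unfolding distr_\<mu>[OF I] by (subst integrable_density) (auto simp: marginal_nonneg)
  finally show "integrable \<mu> (\<lambda>t. g (restrict t I)) \<longleftrightarrow> integrable (leb I) (\<lambda>x. marg I x * g x)" .
qed

lemma kern_measurable_\<mu>:
  "I \<in> index_sets d \<Longrightarrow> (\<lambda>t. kern K h I (\<lambda>j. t j - x j)) \<in> borel_measurable \<mu>"
  unfolding measurable_cong_sets[OF sets_\<mu> refl] by (intro kern_measurable index_sets_subset)

lemma integrable_marginal_mult:
  fixes g :: "point \<Rightarrow> real"
  assumes I: "I \<in> index_sets d" and g: "integrable (leb I) g"
  shows "integrable (leb I) (\<lambda>x. marg I x * g x)"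
proof -
  have "marg I \<in> borel_measurable (leb I)" "g \<in> borel_measurable (leb I)" using I g by auto
  then show ?thesis
  proof (intro Bochner_Integration.integrable_bound[OF integrable_mult_right[OF g, of bf]] AE_I2)
    fix x assume "x \<in> space (leb I)"
    then have "marg I x \<le> bf" using marginal_le[OF I] by simp
    then show "norm (marg I x * g x) \<le> norm (bf * g x)"
      using bf_pos marginal_nonneg[of I x] by (simp add: abs_mult mult_right_mono)
  qed auto
qed

lemma abs_kern_integral_le:
  assumes I: "I \<in> index_sets d" and h: "\<And>j. j \<in> I \<Longrightarrow> 0 < h j"
  shows "(\<integral>t. \<bar>kern K h I (\<lambda>j. t j - x j)\<bar> \<partial>leb I) \<le> a ^ card I"
proof -
  have "(\<integral>t. \<bar>kern K h I (\<lambda>j. t j - x j)\<bar> \<partial>leb I) = (\<integral>t. \<bar>K t\<bar> \<partial>lborel) ^ card I"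
    using kern_integral(2)[OF index_sets_card(1)[OF I] h] by (auto simp: has_bochner_integral_iff)
  also have "\<dots> \<le> a ^ card I" using integral_abs_K_le by (intro power_mono) auto
  finally show ?thesis .
qed

lemma mean_eq:
  assumes I: "I \<in> index_sets d"
  shows "mean h I x = (\<integral>t. marg I t * kern K h I (\<lambda>j. t j - x j) \<partial>leb I)"
    and "abs_mean h I x = (\<integral>t. marg I t * \<bar>kern K h I (\<lambda>j. t j - x j)\<bar> \<partial>leb I)"
  unfolding mean_def abs_mean_def
  using integral_\<mu>(1)[OF I, of "\<lambda>t. kern K h I (\<lambda>j. t j - x j)"]
    integral_\<mu>(1)[OF I, of "\<lambda>t. \<bar>kern K h I (\<lambda>j. t j - x j)\<bar>"]
  unfolding kern_restrict by auto

lemma abs_mean_nonneg: "0 \<le> abs_mean h I x"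
  by (simp add: abs_mean_def)

lemma abs_mean_le:
  assumes I: "I \<in> index_sets d" and h: "\<And>j. j \<in> I \<Longrightarrow> 0 < h j"
  shows "abs_mean h I x \<le> bf * a ^ card I"
proof -
  have i: "integrable (leb I) (\<lambda>t. \<bar>kern K h I (\<lambda>j. t j - x j)\<bar>)"
    using kern_integral(2)[OF index_sets_card(1)[OF I] h] by (auto simp: has_bochner_integral_iff)
  have "abs_mean h I x \<le> (\<integral>t. bf * \<bar>kern K h I (\<lambda>j. t j - x j)\<bar> \<partial>leb I)"
    unfolding mean_eq[OF I] using i marginal_le[OF I]
    by (intro integral_mono integrable_marginal_mult[OF I]) (auto intro!: mult_right_mono)
  also have "\<dots> \<le> bf * a ^ card I"
    using abs_kern_integral_le[OF I h] bf_pos by simp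
  finally show ?thesis .
qed

lemma integrable_kern_\<mu>:
  assumes I: "I \<in> index_sets d" and h: "\<And>j. j \<in> I \<Longrightarrow> 0 < h j"
  shows "integrable \<mu> (\<lambda>t. kern K h I (\<lambda>j. t j - x j))"
  using abs_kern_le[of I h] index_sets_card(1)[OF I] h
  by (intro \<mu>.integrable_const_bound[of _ "a ^ card I / vol h I"] kern_measurable_\<mu> I) auto

lemma mean_le_abs_mean: "\<bar>mean h I x\<bar> \<le> abs_mean h I x"
  unfolding mean_def abs_mean_def by (rule integral_abs_bound)

text \<open>The kernel has total mass 1, so \<open>marg I x\<close> leaves the integral.\<close>

lemma bias_eq:
  assumes I: "I \<in> index_sets d" and h: "\<And>j. j \<in> I \<Longrightarrow> 0 < h j"
  shows "bias K d f h I = supnorm I (\<lambda>x. mean h I x - marg I x)"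
proof -
  have i: "has_bochner_integral (leb I) (\<lambda>t. kern K h I (\<lambda>j. t j - x j)) 1" for x
    using kern_integral(1)[OF index_sets_card(1)[OF I] h] by auto
  have "(\<integral>t. kern K h I (\<lambda>j. t j - x j) * (marg I t - marg I x) \<partial>leb I) = mean h I x - marg I x" for x
  proof -
    have "(\<integral>t. kern K h I (\<lambda>j. t j - x j) * (marg I t - marg I x) \<partial>leb I) =
      (\<integral>t. marg I t * kern K h I (\<lambda>j. t j - x j) - marg I x * kern K h I (\<lambda>j. t j - x j) \<partial>leb I)"
      by (intro Bochner_Integration.integral_cong) (auto simp: algebra_simps)
    also have "\<dots> = mean h I x - marg I x"
      unfolding mean_eq[OF I] using i[of x] by (subst Bochner_Integration.integral_diff)
        (auto intro!: integrable_marginal_mult[OF I] simp: has_bochner_integral_iff)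
    finally show ?thesis .
  qed
  then show ?thesis by (simp add: bias_def)
qed

text \<open>Both integrands split along P: the density by independence, the product kernel along any
  partition of the coordinates. Fubini then integrates block by block. A block that misses I carries
  the empty kernel and contributes the factor 1.\<close>

lemma mean_independent:
  assumes P: "P \<in> indep_partitions d f" and I: "I \<in> index_sets d" and h: "\<And>j. j \<in> {1..d} \<Longrightarrow> 0 < h j"
  shows "mean h I x = (\<Prod>J\<in>P. mean h (J \<inter> I) x)"
proof -
  have PP: "P \<in> partitions d" and fP: "\<And>x. x \<in> {1..d} \<rightarrow>\<^sub>E UNIV \<Longrightarrow> f x = (\<Prod>J\<in>P. marg J x)"
    using P by (auto simp: indep_partitions_def)
  have U: "\<Union>P = {1..d}" "disjoint P" using PP by (auto simp: partitions_def partition_on_def)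
  have ix: "J \<in> index_sets d" if "J \<in> P" for J using partitions_index_sets[OF PP that] .
  define u where "u = (\<lambda>J t. kern K h (J \<inter> I) (\<lambda>j. t j - x j))"
  have ur: "u J (restrict t J) = u J t" for J t
    unfolding u_def kern_eq_prod by (intro prod.cong) auto
  have um: "u J \<in> borel_measurable (leb J)" for J unfolding u_def by (intro kern_measurable) auto
  have ub: "\<bar>u J t\<bar> \<le> a ^ card (J \<inter> I) / vol h (J \<inter> I)" if "J \<in> P" for J t
    unfolding u_def using ix[OF that] index_sets_card(1)[OF ix[OF that]] h by (intro abs_kern_le) (auto simp: index_sets_def)
  have int: "integrable (leb J) (\<lambda>t. marg J t * u J t)" if "J \<in> P" for J
  proof -
    have "u J \<in> borel_measurable \<mu>"
      unfolding u_def measurable_cong_sets[OF sets_\<mu> refl] using index_sets_subset[OF ix[OF that]]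
      by (intro kern_measurable) auto
    then have "integrable \<mu> (u J)"
      using ub[OF that] by (intro \<mu>.integrable_const_bound[of _ "a ^ card (J \<inter> I) / vol h (J \<inter> I)"]) auto
    then have "integrable \<mu> (\<lambda>t. u J (restrict t J))"
      unfolding ur .
    then show ?thesis using integral_\<mu>(2)[OF ix[OF that] um] by simp
  qed
  have "mean h I x = (\<integral>t. (\<Prod>J\<in>P. u J t) \<partial>\<mu>)"
    unfolding mean_def u_def kern_eq_prod partition_prod[OF PP index_sets_subset[OF I]] ..
  also have "\<dots> = (\<integral>t. f t * (\<Prod>J\<in>P. u J t) \<partial>leb {1..d})"
  proof -
    have "(\<lambda>t. \<Prod>J\<in>P. u J t) \<in> borel_measurable (leb {1..d})"
      unfolding u_def using index_sets_subset[OF ix] by (intro borel_measurable_prod kern_measurable) auto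
    then show ?thesis
      unfolding \<mu>_def by (subst integral_density) (auto simp: f_nonneg)
  qed
  also have "\<dots> = (\<integral>t. (\<Prod>J\<in>P. marg J (restrict t J) * u J (restrict t J)) \<partial>leb (\<Union>P))"
    unfolding U by (intro Bochner_Integration.integral_cong) (auto simp: ur marginal_restrict prod.distrib fP)
  also have "\<dots> = (\<Prod>J\<in>P. \<integral>t. marg J t * u J t \<partial>leb J)"
    using integral_leb_partition[of P "\<lambda>J t. marg J t * u J t"] partitions_finite[OF PP] U(2) index_sets_card(1)[OF ix] int
    by auto
  also have "\<dots> = (\<Prod>J\<in>P. mean h (J \<inter> I) x)"
  proof (rule prod.cong[OF refl])
    fix J assume J: "J \<in> P"
    have "(\<integral>t. marg J t * u J t \<partial>leb J) = (\<integral>t. u J (restrict t J) \<partial>\<mu>)"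
      using integral_\<mu>(1)[OF ix[OF J] um] by simp
    then show "(\<integral>t. marg J t * u J t \<partial>leb J) = mean h (J \<inter> I) x"
      unfolding ur by (simp add: mean_def u_def)
  qed
  finally show ?thesis .
qed

text \<open>This is the reason for \<diamond> in \<open>est_conv\<close>: the density need not
  factorise over P', but each smoothed marginal of a block of P' factorises along P, which refines
  P' to P \<diamond> P'.\<close>

lemma prod_mean_independent:
  assumes P: "P \<in> indep_partitions d f" and P': "P' \<in> partitions d" and h: "\<And>j. j \<in> {1..d} \<Longrightarrow> 0 < h j"
  shows "(\<Prod>I\<in>P'. mean h I x) = (\<Prod>J\<in>P \<diamond> P'. mean h J x)"
proof -
  have PP: "P \<in> partitions d" using P by (auto simp: indep_partitions_def)
  have "(\<Prod>I\<in>P'. mean h I x) = (\<Prod>I\<in>P'. \<Prod>J\<in>P. mean h (J \<inter> I) x)"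
    using mean_independent[OF P partitions_index_sets[OF P'] h] by (intro prod.cong) auto
  also have "\<dots> = (\<Prod>J\<in>P \<diamond> P'. mean h J x)"
    \<comment> \<open>The empty kernel is the constant 1 and \<mu> is a probability, so
      \<open>mean h {} x\<close> is 1.\<close>
    by (rule prod_meet[OF PP P']) (simp add: mean_def kern_eq_prod \<mu>.prob_space[unfolded space_\<mu>])
  finally show ?thesis .
qed

end

section \<open>The good event\<close>

text \<open>The union bound is phrased with \<open>count_space\<close> rather than as a series so
  that Tonelli can later interchange the sum over the grid with the integral over \<mu>.\<close>

lemma emeasure_UN_le_nn_integral:
  assumes "countable A" and E [measurable]: "\<And>k. k \<in> A \<Longrightarrow> E k \<in> sets M"
  shows "emeasure M (\<Union>k\<in>A. E k) \<le> (\<integral>\<^sup>+k. emeasure M (E k) \<partial>count_space A)"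
proof -
  have [measurable]: "(\<Union>k\<in>A. E k) \<in> sets M" using assms by (intro sets.countable_UN') auto
  have "emeasure M (\<Union>k\<in>A. E k) = (\<integral>\<^sup>+x. indicator (\<Union>k\<in>A. E k) x \<partial>M)"
    by simp
  also have "\<dots> \<le> (\<integral>\<^sup>+x. (\<integral>\<^sup>+k. indicator (E k) x \<partial>count_space A) \<partial>M)"
  proof (rule nn_integral_mono)
    fix x assume "x \<in> space M"
    have "(1::ennreal) \<le> (\<integral>\<^sup>+k. indicator (E k) x \<partial>count_space A)" if "k \<in> A" "x \<in> E k" for k
      using nn_integral_ge_point[of k A "\<lambda>k. indicator (E k) x"] that by simp
    then show "indicator (\<Union>k\<in>A. E k) x \<le> (\<integral>\<^sup>+k. indicator (E k) x \<partial>count_space A :: ennreal)"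
      by (auto split: split_indicator)
  qed
  also have "\<dots> = (\<integral>\<^sup>+k. (\<integral>\<^sup>+x. indicator (E k) x \<partial>M) \<partial>count_space A)"
    using assms by (intro nn_integral_count_space_nn_integral) auto
  also have "\<dots> = (\<integral>\<^sup>+k. emeasure M (E k) \<partial>count_space A)"
    by (intro nn_integral_cong) (use E in auto)
  finally show ?thesis .
qed

text \<open>An interval of length 1 contains at most N + 1 multiples of 1/N, both endpoints
  included.\<close>

lemma grid_neighbours:
  fixes t :: real
  assumes "N > 0"
  shows "finite {k::int. \<bar>t - of_int k / real N\<bar> \<le> 1/2}" "card {k::int. \<bar>t - of_int k / real N\<bar> \<le> 1/2} \<le> N + 1"
proof -
  have *: "{k::int. \<bar>t - of_int k / real N\<bar> \<le> 1/2} \<subseteq> {\<lceil>real N * t - real N / 2\<rceil>..\<lfloor>real N * t + real N / 2\<rfloor>}"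
  proof
    fix k :: int assume "k \<in> {k. \<bar>t - of_int k / real N\<bar> \<le> 1/2}"
    then have "\<bar>t - of_int k / real N\<bar> \<le> 1/2" by (rule CollectD)
    then have "t - 1/2 \<le> of_int k / real N" "of_int k / real N \<le> t + 1/2"
      by linarith+
    then have "real N * t - real N / 2 \<le> of_int k" "of_int k \<le> real N * t + real N / 2"
      using assms by (simp_all add: field_simps)
    then show "k \<in> {\<lceil>real N * t - real N / 2\<rceil>..\<lfloor>real N * t + real N / 2\<rfloor>}"
      by (simp add: ceiling_le_iff le_floor_iff)
  qed
  then show "finite {k::int. \<bar>t - of_int k / real N\<bar> \<le> 1/2}" by (rule finite_subset) simp
  have "card {k::int. \<bar>t - of_int k / real N\<bar> \<le> 1/2} \<le> card {\<lceil>real N * t - real N / 2\<rceil>..\<lfloor>real N * t + real N / 2\<rfloor>}"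
    by (rule card_mono[OF _ *]) simp
  also have "\<dots> \<le> N + 1"
    unfolding card_atLeastAtMost_int by linarith
  finally show "card {k::int. \<bar>t - of_int k / real N\<bar> \<le> 1/2} \<le> N + 1" .
qed

definition est_abs :: "(real \<Rightarrow> real) \<Rightarrow> nat \<Rightarrow> sample \<Rightarrow> point \<Rightarrow> nat set \<Rightarrow> point \<Rightarrow> real" where
  "est_abs K n X h I x = inverse (real n) * (\<Sum>i=1..n. \<bar>kern K h I (\<lambda>j. X i j - x j)\<bar>)"

context kde
begin

text \<open>Bernstein's deviation \<open>2 * sqrt (n * v * z) + z * B\<close> divided by n, where B
  = a^|I| / V bounds the kernel and v = B times \<open>abs_mean\<close> bounds its second
  moment.\<close>

definition fluct :: "real \<Rightarrow> nat \<Rightarrow> point \<Rightarrow> nat set \<Rightarrow> point \<Rightarrow> real" where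
  "fluct z n h I x =
     2 * sqrt (z * a ^ card I / (real n * vol h I) * abs_mean h I x) + z * a ^ card I / (real n * vol h I)"

definition close_to_mean :: "real \<Rightarrow> nat \<Rightarrow> sample \<Rightarrow> point \<Rightarrow> nat set \<Rightarrow> point \<Rightarrow> bool" where
  "close_to_mean z n X h I x \<longleftrightarrow>
     \<bar>est1 K n X h I x - mean h I x\<bar> \<le> fluct z n h I x \<and>
     \<bar>est_abs K n X h I x - abs_mean h I x\<bar> \<le> fluct z n h I x"

text \<open>As bandwidths are at most 1, this set contains the support of every kernel centred at x,
  whatever its bandwidth. Coordinates outside I are free, which makes it an event for the full law
  \<mu>.\<close>

definition window :: "nat set \<Rightarrow> point \<Rightarrow> point set" where
  "window I x = {t \<in> space \<mu>. \<forall>j\<in>I. \<bar>t j - x j\<bar> \<le> 1/2}"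

lemma law_eq: "law d f n = PiM {1..n} (\<lambda>_. \<mu>)"
  by (simp add: law_def \<mu>_def)

lemma component_measurable_\<mu>: "j \<in> {1..d} \<Longrightarrow> (\<lambda>t. t j) \<in> borel_measurable \<mu>"
  unfolding measurable_cong_sets[OF sets_\<mu> refl] leb_def
  using measurable_component_singleton[of j "{1..d}" "\<lambda>_. lborel :: real measure"] by simp

lemma window_measurable [measurable]:
  assumes "I \<in> index_sets d" shows "window I x \<in> sets \<mu>"
  unfolding window_def using index_sets_card(1)[OF assms] index_sets_subset[OF assms]
  by (intro sets.sets_Collect_finite_All' borel_measurable_le borel_measurable_abs borel_measurable_diff component_measurable_\<mu>
      borel_measurable_const) (use assms in \<open>auto simp: index_sets_def\<close>)

lemma kern_zero_outside_window:
  assumes I: "I \<in> index_sets d" and h: "\<And>j. j \<in> I \<Longrightarrow> 0 < h j \<and> h j \<le> 1" and t: "t \<in> space \<mu>" "t \<notin> window I x"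
  shows "kern K h I (\<lambda>j. t j - x j) = 0"
proof -
  obtain j where j: "j \<in> I" "\<bar>t j - x j\<bar> > 1/2" using t by (auto simp: window_def not_le)
  then have "kern1 K (h j) (t j - x j) = 0" using h[of j] by (intro kern1_zero) auto
  then show ?thesis unfolding kern_eq_prod using j index_sets_card(1)[OF I] by (auto simp: prod_zero)
qed

text \<open>The domination hypothesis lets one proof serve the kernel, its absolute value and the
  negatives of both. Since g vanishes outside the window, its second moment is at most B^2 times the
  window mass, and B^2 cancels in the Bernstein bound.\<close>

lemma one_sided_deviation:
  fixes g :: "point \<Rightarrow> real"
  assumes I: "I \<in> index_sets d" and h: "\<And>j. j \<in> I \<Longrightarrow> 0 < h j \<and> h j \<le> 1" and n: "n > 0" and z: "z \<ge> 3"
    and g [measurable]: "g \<in> borel_measurable \<mu>"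
    and le: "\<And>t. \<bar>g t\<bar> \<le> \<bar>kern K h I (\<lambda>j. t j - x j)\<bar>"
  shows "measure (law d f n) {X \<in> space (law d f n).
      fluct z n h I x < inverse (real n) * (\<Sum>i=1..n. g (X i)) - \<mu>.expectation g}
    \<le> 2 * real n * exp (- z) * measure \<mu> (window I x)"
proof -
  define B where "B = a ^ card I / vol h I"
  define v where "v = B * abs_mean h I x"
  have vol: "vol h I > 0" unfolding vol_def using h by (intro prod_pos) auto
  have B: "B > 0" using vol a_ge_1 by (simp add: B_def)
  have kB: "\<bar>kern K h I (\<lambda>j. t j - x j)\<bar> \<le> B" for t
    unfolding B_def using abs_kern_le[of I h] index_sets_card(1)[OF I] h by auto
  have gB: "\<bar>g t\<bar> \<le> B" for t using le[of t] kB[of t] by linarith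
  have ik: "integrable \<mu> (\<lambda>t. \<bar>kern K h I (\<lambda>j. t j - x j)\<bar>)"
    using integrable_kern_\<mu>[OF I] h by (intro integrable_abs) auto
  have ig2: "integrable \<mu> (\<lambda>t. (g t)\<^sup>2)"
    using power_mono[OF gB abs_ge_zero, of _ 2] by (intro \<mu>.integrable_const_bound[of _ "B\<^sup>2"]) auto
  have v: "\<mu>.expectation (\<lambda>t. (g t)\<^sup>2) \<le> v"
  proof -
    have "\<mu>.expectation (\<lambda>t. (g t)\<^sup>2) \<le> \<mu>.expectation (\<lambda>t. B * \<bar>kern K h I (\<lambda>j. t j - x j)\<bar>)"
    proof (intro integral_mono ig2 integrable_mult_right ik)
      fix t
      have "\<bar>g t\<bar> * \<bar>g t\<bar> \<le> B * \<bar>kern K h I (\<lambda>j. t j - x j)\<bar>"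
        using gB[of t] le[of t] B by (intro mult_mono) auto
      then show "(g t)\<^sup>2 \<le> B * \<bar>kern K h I (\<lambda>j. t j - x j)\<bar>" by (simp add: power2_eq_square)
    qed
    then show ?thesis by (simp add: v_def abs_mean_def)
  qed
  have "\<mu>.expectation (\<lambda>t. (g t)\<^sup>2) \<le> \<mu>.expectation (\<lambda>t. B\<^sup>2 * indicator (window I x) t)"
  proof (intro integral_mono ig2)
    show "integrable \<mu> (\<lambda>t. B\<^sup>2 * indicator (window I x) t)"
      using I by (intro integrable_mult_right integrable_real_indicator) (auto simp: \<mu>.emeasure_eq_measure)
    fix t assume t: "t \<in> space \<mu>"
    show "(g t)\<^sup>2 \<le> B\<^sup>2 * indicator (window I x) t"
    proof (cases "t \<in> window I x")
      case True
      then show ?thesis using power_mono[OF gB[of t], of 2] by simp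
    next
      case False
      then show ?thesis using le[of t] kern_zero_outside_window[OF I h t False] by simp
    qed
  qed
  also have "\<dots> = B\<^sup>2 * measure \<mu> (window I x \<inter> space \<mu>)" by simp
  also have "window I x \<inter> space \<mu> = window I x" by (auto simp: window_def)
  finally have w: "\<mu>.expectation (\<lambda>t. (g t)\<^sup>2) / B\<^sup>2 \<le> measure \<mu> (window I x)"
    using B by (simp add: field_simps)
  have fl: "real n * fluct z n h I x = 2 * sqrt (real n * v * z) + z * B"
  proof -
    define m where "m = abs_mean h I x"
    have b: "z * a ^ card I / (real n * vol h I) = z * B / real n" by (simp add: B_def)
    have "real n * sqrt (z * B / real n * m) = sqrt ((real n)\<^sup>2) * sqrt (z * B / real n * m)" by simp
    also have "\<dots> = sqrt ((real n)\<^sup>2 * (z * B / real n * m))" by (rule real_sqrt_mult[symmetric])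
    also have "(real n)\<^sup>2 * (z * B / real n * m) = real n * v * z"
      using n by (simp add: v_def m_def power2_eq_square)
    finally have "real n * sqrt (z * B / real n * m) = sqrt (real n * v * z)" .
    then show ?thesis unfolding fluct_def b m_def[symmetric] using n by (simp add: distrib_left)
  qed
  have iff: "fluct z n h I x < inverse (real n) * S - e \<longleftrightarrow> 2 * sqrt (real n * v * z) + z * B < S - real n * e" for S e
    unfolding fl[symmetric] using n by (simp add: field_simps)
  have "measure (law d f n) {X \<in> space (law d f n).
      fluct z n h I x < inverse (real n) * (\<Sum>i=1..n. g (X i)) - \<mu>.expectation g} \<le>
      2 * real n * (\<mu>.expectation (\<lambda>t. (g t)\<^sup>2) / B\<^sup>2) * exp (- z)"
    unfolding law_eq iff by (rule \<mu>.bernstein_iid[OF g gB B v z])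
  also have "\<dots> \<le> 2 * real n * measure \<mu> (window I x) * exp (- z)"
    using w by (intro mult_right_mono mult_left_mono) auto
  finally show ?thesis by (simp add: mult_ac)
qed

lemma sample_measurable:
  assumes "g \<in> borel_measurable \<mu>" "i \<in> {1..n}"
  shows "(\<lambda>X. g (X i)) \<in> borel_measurable (law d f n)"
  unfolding law_eq using assms by measurable

lemma prob_space_law: "prob_space (law d f n)"
proof -
  interpret product_prob_space "\<lambda>_. \<mu>" "{1..n}" by unfold_locales
  show ?thesis unfolding law_eq by unfold_locales
qed

lemma est1_measurable:
  assumes I: "I \<in> index_sets d"
  shows "(\<lambda>X. est1 K n X h I x) \<in> borel_measurable (law d f n)"
    "(\<lambda>X. est_abs K n X h I x) \<in> borel_measurable (law d f n)"
  unfolding est1_def est_abs_def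
  using sample_measurable[OF kern_measurable_\<mu>[OF I]]
  by (auto intro!: borel_measurable_times borel_measurable_sum borel_measurable_abs)

lemma deviation_measurable:
  assumes I: "I \<in> index_sets d"
  shows "{X \<in> space (law d f n). \<not> close_to_mean z n X h I x} \<in> sets (law d f n)"
  unfolding close_to_mean_def de_Morgan_conj not_le
  using est1_measurable[OF I] by (intro sets.sets_Collect_disj borel_measurable_less) auto

lemma deviation_bound:
  assumes I: "I \<in> index_sets d" and h: "\<And>j. j \<in> I \<Longrightarrow> 0 < h j \<and> h j \<le> 1" and n: "n > 0" and z: "z \<ge> 3"
  shows "emeasure (law d f n) {X \<in> space (law d f n). \<not> close_to_mean z n X h I x}
    \<le> ennreal (8 * real n * exp (- z)) * emeasure \<mu> (window I x)"
proof -
  interpret P: prob_space "law d f n" by (rule prob_space_law)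
  let ?k = "\<lambda>t. kern K h I (\<lambda>j. t j - x j)"
  define E where "E g = {X \<in> space (law d f n).
      fluct z n h I x < inverse (real n) * (\<Sum>i=1..n. g (X i)) - \<mu>.expectation g}" for g
  have km: "?k \<in> borel_measurable \<mu>" by (rule kern_measurable_\<mu>[OF I])
  have Em: "E g \<in> sets (law d f n)" if "g \<in> borel_measurable \<mu>" for g
    unfolding E_def using sample_measurable[OF that]
    by (intro borel_measurable_less borel_measurable_diff borel_measurable_times borel_measurable_sum) auto
  have Eb: "measure (law d f n) (E g) \<le> 2 * real n * exp (- z) * measure \<mu> (window I x)"
    if "g \<in> borel_measurable \<mu>" "\<And>t. \<bar>g t\<bar> \<le> \<bar>?k t\<bar>" for g
    unfolding E_def using one_sided_deviation[OF I h n z that] .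
  let ?E1 = "E ?k" and ?E2 = "E (\<lambda>t. - ?k t)" and ?E3 = "E (\<lambda>t. \<bar>?k t\<bar>)" and ?E4 = "E (\<lambda>t. - \<bar>?k t\<bar>)"
  have sub: "{X \<in> space (law d f n). \<not> close_to_mean z n X h I x} \<subseteq> (?E1 \<union> ?E2) \<union> (?E3 \<union> ?E4)"
    by (auto simp: E_def close_to_mean_def est1_def est_abs_def mean_def abs_mean_def sum_negf)
  have "measure (law d f n) {X \<in> space (law d f n). \<not> close_to_mean z n X h I x}
    \<le> measure (law d f n) ((?E1 \<union> ?E2) \<union> (?E3 \<union> ?E4))"
    using km by (intro P.finite_measure_mono[OF sub] sets.Un Em) auto
  also have "\<dots> \<le> measure (law d f n) (?E1 \<union> ?E2) + measure (law d f n) (?E3 \<union> ?E4)"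
    using km by (intro measure_Un_le sets.Un Em) auto
  also have "\<dots> \<le> (measure (law d f n) ?E1 + measure (law d f n) ?E2) + (measure (law d f n) ?E3 + measure (law d f n) ?E4)"
    using km by (intro add_mono measure_Un_le Em) auto
  also have "\<dots> \<le> 8 * real n * exp (- z) * measure \<mu> (window I x)"
    using Eb[of ?k] Eb[of "\<lambda>t. - ?k t"] Eb[of "\<lambda>t. \<bar>?k t\<bar>"] Eb[of "\<lambda>t. - \<bar>?k t\<bar>"] km by simp
  finally show ?thesis
    by (simp add: P.emeasure_eq_measure \<mu>.emeasure_eq_measure ennreal_mult[symmetric])
qed

definition grid_point :: "nat \<Rightarrow> (nat \<Rightarrow> int) \<Rightarrow> point" where
  "grid_point N k = (\<lambda>j. of_int (k j) / real N)"

text \<open>Interchanging sum and integral replaces the masses by the number of windows containing a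
  given t. Each coordinate admits at most N + 1 centres, and \<mu> has mass 1.\<close>

lemma sum_window_le:
  assumes I: "I \<in> index_sets d" and N: "N > 0"
  shows "(\<integral>\<^sup>+k. emeasure \<mu> (window I (grid_point N k)) \<partial>count_space (I \<rightarrow>\<^sub>E UNIV)) \<le> ennreal (real (N + 1) ^ d)"
proof -
  have fin: "finite I" by (rule index_sets_card(1)[OF I])
  have cnt: "countable (I \<rightarrow>\<^sub>E (UNIV :: int set))" using fin by (intro countable_PiE) auto
  have "(\<integral>\<^sup>+k. emeasure \<mu> (window I (grid_point N k)) \<partial>count_space (I \<rightarrow>\<^sub>E UNIV)) =
      (\<integral>\<^sup>+k. (\<integral>\<^sup>+t. indicator (window I (grid_point N k)) t \<partial>\<mu>) \<partial>count_space (I \<rightarrow>\<^sub>E UNIV))"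
    using I by (intro nn_integral_cong) auto
  also have "\<dots> = (\<integral>\<^sup>+t. (\<integral>\<^sup>+k. indicator (window I (grid_point N k)) t \<partial>count_space (I \<rightarrow>\<^sub>E UNIV)) \<partial>\<mu>)"
    using I cnt by (intro nn_integral_count_space_nn_integral[symmetric]) auto
  also have "\<dots> \<le> (\<integral>\<^sup>+t. ennreal (real (N + 1) ^ d) \<partial>\<mu>)"
  proof (rule nn_integral_mono)
    fix t assume t: "t \<in> space \<mu>"
    define S where "S = (\<Pi>\<^sub>E j\<in>I. {k::int. \<bar>t j - of_int k / real N\<bar> \<le> 1/2})"
    have finS: "finite S" unfolding S_def using fin grid_neighbours(1)[OF N] by (intro finite_PiE) auto
    have "card S = (\<Prod>j\<in>I. card {k::int. \<bar>t j - of_int k / real N\<bar> \<le> 1/2})"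
      unfolding S_def by (rule card_PiE[OF fin])
    also have "\<dots> \<le> (N + 1) ^ card I"
      using grid_neighbours(2)[OF N] prod_mono[of I "\<lambda>j. card {k::int. \<bar>t j - of_int k / real N\<bar> \<le> 1/2}" "\<lambda>_. N + 1"]
      by simp
    also have "\<dots> \<le> (N + 1) ^ d" using index_sets_card(3)[OF I] by (intro power_increasing) auto
    finally have card: "card S \<le> (N + 1) ^ d" .
    have "(\<integral>\<^sup>+k. indicator (window I (grid_point N k)) t \<partial>count_space (I \<rightarrow>\<^sub>E UNIV)) =
      (\<integral>\<^sup>+k. indicator S k \<partial>count_space (I \<rightarrow>\<^sub>E UNIV))"
      using t by (intro nn_integral_cong) (auto simp: window_def grid_point_def S_def PiE_iff split: split_indicator)
    also have "\<dots> = emeasure (count_space (I \<rightarrow>\<^sub>E UNIV)) S"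
      by (intro nn_integral_indicator) (auto simp: S_def PiE_def)
    also have "\<dots> = of_nat (card S)"
      using finS by (intro emeasure_count_space_finite) (auto simp: S_def PiE_def)
    also have "\<dots> = ennreal (real (card S))" by (simp add: ennreal_of_nat_eq_real_of_nat)
    also have "\<dots> \<le> ennreal (real (N + 1) ^ d)"
      using card by (intro ennreal_leI) (metis of_nat_le_iff of_nat_power)
    finally show "(\<integral>\<^sup>+k. indicator (window I (grid_point N k)) t \<partial>count_space (I \<rightarrow>\<^sub>E UNIV)) \<le> ennreal (real (N + 1) ^ d)" .
  qed
  also have "\<dots> = ennreal (real (N + 1) ^ d)" by (simp add: \<mu>.emeasure_space_1 del: space_\<mu>)
  finally show ?thesis .
qed

text \<open>Grid bandwidths start at 1/N so that volumes stay positive. Locations range over all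
  multiples of 1/N because the density may have unbounded support.\<close>

definition good_event :: "real \<Rightarrow> nat \<Rightarrow> nat \<Rightarrow> sample set" where
  "good_event z N n = {X \<in> space (law d f n). \<forall>I\<in>index_sets d. \<forall>l\<in>I \<rightarrow>\<^sub>E {1..N}. \<forall>k\<in>I \<rightarrow>\<^sub>E UNIV.
     close_to_mean z n X (\<lambda>j. real (l j) / real N) I (grid_point N k)}"

lemma card_index_sets: "card (index_sets d) \<le> 2 ^ d"
proof -
  have "card (index_sets d) \<le> card (Pow {1..d})" by (intro card_mono) (auto simp: index_sets_def)
  then show ?thesis by (simp add: card_Pow)
qed

text \<open>The factor 2^d counts index sets and N^d counts bandwidth vectors; the locations enter
  only through the summed window masses, which give (N+1)^d.\<close>

lemma good_event_complement:
  assumes n: "n > 0" and z: "z \<ge> 3" and N: "N > 0"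
  shows "good_event z N n \<in> sets (law d f n)"
    and "emeasure (law d f n) (space (law d f n) - good_event z N n)
      \<le> ennreal (2 ^ d * (real N ^ d * (8 * real n * exp (- z) * real (N + 1) ^ d)))"
proof -
  define bad where "bad I l k = {X \<in> space (law d f n). \<not> close_to_mean z n X (\<lambda>j. real (l j) / real N) I (grid_point N k)}"
    for I :: "nat set" and l :: "nat \<Rightarrow> nat" and k :: "nat \<Rightarrow> int"
  define U where "U I l = (\<Union>k\<in>I \<rightarrow>\<^sub>E UNIV. bad I l k)" for I l
  have bm: "bad I l k \<in> sets (law d f n)" if "I \<in> index_sets d" for I l k
    unfolding bad_def by (rule deviation_measurable[OF that])
  have cnt: "countable (I \<rightarrow>\<^sub>E (UNIV :: int set))" if "I \<in> index_sets d" for I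
    using index_sets_card(1)[OF that] by (intro countable_PiE) auto
  have fl: "finite (I \<rightarrow>\<^sub>E {1..N})" if "I \<in> index_sets d" for I
    using index_sets_card(1)[OF that] by (intro finite_PiE) auto
  have Um: "U I l \<in> sets (law d f n)" if "I \<in> index_sets d" for I l
    unfolding U_def using bm[OF that] cnt[OF that] by (intro sets.countable_UN') auto
  have Ub: "emeasure (law d f n) (U I l) \<le> ennreal (8 * real n * exp (- z) * real (N + 1) ^ d)"
    if I: "I \<in> index_sets d" and l: "l \<in> I \<rightarrow>\<^sub>E {1..N}" for I l
  proof -
    have l1: "0 < real (l j) / real N \<and> real (l j) / real N \<le> 1" if "j \<in> I" for j
      using PiE_mem[OF l that] N by auto
    have "emeasure (law d f n) (U I l) \<le> (\<integral>\<^sup>+k. emeasure (law d f n) (bad I l k) \<partial>count_space (I \<rightarrow>\<^sub>E UNIV))"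
      unfolding U_def using bm[OF I] cnt[OF I] by (intro emeasure_UN_le_nn_integral) auto
    also have "\<dots> \<le> (\<integral>\<^sup>+k. ennreal (8 * real n * exp (- z)) * emeasure \<mu> (window I (grid_point N k)) \<partial>count_space (I \<rightarrow>\<^sub>E UNIV))"
      unfolding bad_def by (intro nn_integral_mono deviation_bound[OF I l1 n z]) auto
    also have "\<dots> = ennreal (8 * real n * exp (- z)) * (\<integral>\<^sup>+k. emeasure \<mu> (window I (grid_point N k)) \<partial>count_space (I \<rightarrow>\<^sub>E UNIV))"
      by (rule nn_integral_cmult) simp
    also have "\<dots> \<le> ennreal (8 * real n * exp (- z)) * ennreal (real (N + 1) ^ d)"
      by (intro mult_left_mono sum_window_le[OF I N]) auto
    finally show ?thesis by (simp add: ennreal_mult[symmetric])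
  qed
  have eq: "space (law d f n) - good_event z N n = (\<Union>I\<in>index_sets d. \<Union>l\<in>I \<rightarrow>\<^sub>E {1..N}. U I l)"
    unfolding good_event_def U_def bad_def by blast
  have VM: "(\<Union>l\<in>I \<rightarrow>\<^sub>E {1..N}. U I l) \<in> sets (law d f n)" if "I \<in> index_sets d" for I
    using Um[OF that] fl[OF that] by (intro sets.finite_UN) auto
  have "(\<Union>I\<in>index_sets d. \<Union>l\<in>I \<rightarrow>\<^sub>E {1..N}. U I l) \<in> sets (law d f n)"
    by (rule sets.finite_UN[OF finite_index_sets VM])
  then have "space (law d f n) - (space (law d f n) - good_event z N n) \<in> sets (law d f n)"
    unfolding eq by auto
  moreover have "space (law d f n) - (space (law d f n) - good_event z N n) = good_event z N n"
    by (auto simp: good_event_def)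
  ultimately show "good_event z N n \<in> sets (law d f n)" by simp
  define c where "c = 8 * real n * exp (- z) * real (N + 1) ^ d"
  have c: "c \<ge> 0" by (simp add: c_def)
  have "emeasure (law d f n) (\<Union>I\<in>index_sets d. \<Union>l\<in>I \<rightarrow>\<^sub>E {1..N}. U I l)
    \<le> (\<Sum>I\<in>index_sets d. emeasure (law d f n) (\<Union>l\<in>I \<rightarrow>\<^sub>E {1..N}. U I l))"
    using VM finite_index_sets by (intro emeasure_subadditive_finite) auto
  also have "\<dots> \<le> (\<Sum>I\<in>index_sets d. ennreal (real N ^ d * c))"
  proof (rule sum_mono)
    fix I assume I: "I \<in> index_sets d"
    have "emeasure (law d f n) (\<Union>l\<in>I \<rightarrow>\<^sub>E {1..N}. U I l) \<le> (\<Sum>l\<in>I \<rightarrow>\<^sub>E {1..N}. emeasure (law d f n) (U I l))"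
      using Um[OF I] fl[OF I] by (intro emeasure_subadditive_finite) auto
    also have "\<dots> \<le> (\<Sum>l\<in>I \<rightarrow>\<^sub>E {1..N}. ennreal c)"
      using Ub[OF I] by (intro sum_mono) (simp add: c_def)
    also have "\<dots> = ennreal (real (N ^ card I) * c)"
      using c by (simp add: card_PiE index_sets_card(1)[OF I] ennreal_mult ennreal_of_nat_eq_real_of_nat del: of_nat_power)
    also have "\<dots> \<le> ennreal (real N ^ d * c)"
    proof (intro ennreal_leI mult_right_mono c)
      have "N ^ card I \<le> N ^ d" using index_sets_card(3)[OF I] N by (intro power_increasing) auto
      then show "real (N ^ card I) \<le> real N ^ d" by (metis of_nat_le_iff of_nat_power)
    qed
    finally show "emeasure (law d f n) (\<Union>l\<in>I \<rightarrow>\<^sub>E {1..N}. U I l) \<le> ennreal (real N ^ d * c)" .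
  qed
  also have "\<dots> = ennreal (real (card (index_sets d)) * (real N ^ d * c))"
    using c by (simp add: ennreal_mult ennreal_of_nat_eq_real_of_nat)
  also have "\<dots> \<le> ennreal (2 ^ d * (real N ^ d * c))"
  proof (intro ennreal_leI mult_right_mono)
    show "real (card (index_sets d)) \<le> 2 ^ d" using card_index_sets by (metis of_nat_le_iff of_nat_numeral of_nat_power)
    show "0 \<le> real N ^ d * c" using c by simp
  qed
  finally show "emeasure (law d f n) (space (law d f n) - good_event z N n)
      \<le> ennreal (2 ^ d * (real N ^ d * (8 * real n * exp (- z) * real (N + 1) ^ d)))"
    unfolding eq by (simp add: c_def)
qed

end

section \<open>Deviations on the good event\<close>

lemma vol_pos: "(\<And>j. j \<in> I \<Longrightarrow> 0 < h j) \<Longrightarrow> 0 < vol h I"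
  unfolding vol_def by (rule prod_pos) auto

lemma vol_antimono:
  assumes "finite J" "I \<subseteq> J" "\<And>j. j \<in> J \<Longrightarrow> 0 < h j \<and> h j \<le> 1"
  shows "vol h J \<le> vol h I"
proof -
  have "vol h J = vol h I * vol h (J - I)"
    unfolding vol_def using assms by (subst prod.subset_diff[of I J]) (auto simp: mult.commute)
  also have "\<dots> \<le> vol h I * 1"
    unfolding vol_def using assms by (intro mult_left_mono prod_le_1 prod_nonneg) (auto simp: less_imp_le)
  finally show ?thesis by simp
qed

lemma bandwidthsD:
  assumes "h \<in> bandwidths K L q d n" "j \<in> {1..d}"
  shows "0 < h j" "h j \<le> 1"
proof -
  have "h j \<in> {0<..1}" using assms by (auto simp: bandwidths_def)
  then show "0 < h j" "h j \<le> 1" by auto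
qed

lemma min_vol_le:
  assumes "P \<in> partitions d" "I \<in> P"
  shows "min_vol h P \<le> vol h I"
  unfolding min_vol_def using assms partitions_finite by (intro cINF_lower) auto

lemma min_vol_ge:
  assumes "P \<in> partitions d" "d \<ge> 1" "\<And>I. I \<in> P \<Longrightarrow> c \<le> vol h I"
  shows "c \<le> min_vol h P"
proof -
  have "P \<noteq> {}" using assms by (auto simp: partitions_def partition_on_def)
  then show ?thesis unfolding min_vol_def using assms by (intro cINF_greatest) auto
qed

lemma est_abs_nonneg: "0 \<le> est_abs K n X h I x"
  unfolding est_abs_def by (intro mult_nonneg_nonneg sum_nonneg) auto

lemma abs_est1_le: "\<bar>est1 K n X h I x\<bar> \<le> est_abs K n X h I x"
  unfolding est1_def est_abs_def abs_mult using sum_abs by (intro mult_mono) auto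

text \<open>For m > 1 the deviation is at most m/3 + 1/36, so F retains at least half of m. This
  turns an unobservable mean into a bound by an observable quantity and explains the form 1 \<or> 2
  \<open>f_n\<close> of \<open>fbar_n\<close>.\<close>

lemma le_of_self_normalized:
  fixes m F b :: real
  assumes "0 \<le> b" "b \<le> 1 / 36" "0 \<le> m" "\<bar>F - m\<bar> \<le> 2 * sqrt (b * m) + b"
  shows "m \<le> max 1 (2 * F)"
proof (cases "m \<le> 1")
  case False
  then have m: "m > 1" by simp
  have "m \<le> m\<^sup>2" using m by (simp add: power2_eq_square)
  then have "b * m \<le> 1 / 36 * m\<^sup>2" using assms m by (intro mult_mono) auto
  then have "b * m \<le> (m / 6)\<^sup>2" by (simp add: power_divide)
  then have "sqrt (b * m) \<le> m / 6" using m by (intro real_le_lsqrt) auto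
  then show ?thesis using assms m by linarith
qed simp

lemma ln_nat_ge_1:
  assumes "3 \<le> n" shows "1 \<le> ln (real n)"
proof -
  have "exp 1 \<le> real n" using exp_le assms by linarith
  then show ?thesis using assms by (subst ln_ge_iff) auto
qed

lemma est1_restrict: "est1 K n X h I (restrict x I) = est1 K n X h I x"
  unfolding est1_def kern_def by (intro arg_cong[where f = "\<lambda>s. _ * s"] sum.cong prod.cong refl arg_cong[where f = "\<lambda>s. _ * s"]) auto

context kernel
begin

text \<open>The exponent of \<open>n\<close> in the Bernstein bounds: \<open>1 + 2d(d + 4)\<close> pays for the union bound over the
  grid of mesh \<open>n\<^bsup>-(d+4)\<^esup>\<close>, and \<open>3q/2\<close> for the crude bound off the good event.\<close>

definition tail_exponent :: "real \<Rightarrow> nat \<Rightarrow> real" where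
  "tail_exponent q d = 2 * real d * real (d + 4) + 1 + 3 / 2 * q"

text \<open>The value for the full dimension serves all blocks: it lies below \<open>Lam\<close>,
  and it is large enough for smaller blocks because a \<ge> 1 gives a^|I| \<le> a^d.\<close>

definition gam_dim :: "real \<Rightarrow> nat \<Rightarrow> real" where
  "gam_dim q d = gam L (2 * q) d a"

text \<open>Divided by n, this bounds the change of a kernel value when bandwidth and location are
  moved to the grid.\<close>

definition mesh_const :: "nat \<Rightarrow> real" where
  "mesh_const d = real d * (a + 2 * L) * a ^ d"

lemma tail_exponent_ge: "d \<ge> 1 \<Longrightarrow> q \<ge> 1 \<Longrightarrow> 3 \<le> tail_exponent q d"
proof -
  assume "d \<ge> 1" "q \<ge> 1"
  then have "1 * 5 \<le> real d * real (d + 4)" by (intro mult_mono) auto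
  then show ?thesis using \<open>q \<ge> 1\<close> unfolding tail_exponent_def by linarith
qed

lemma gam_dim_pos: "d \<ge> 1 \<Longrightarrow> q \<ge> 1 \<Longrightarrow> 0 < gam_dim q d"
  unfolding gam_dim_def using a_ge_1 L_pos by (intro gam_pos) auto

text \<open>The 9 is the square of the 3 that results when a deviation 2 sqrt(b \<phi>) + b is
  merged into 3 sqrt(b \<phi>). The part of the exponent quadratic in d is paid by 600000 d^2, the
  part linear in q by p = 2 q.\<close>

lemma gam_dim_sq_ge:
  assumes "d \<ge> 1" "q \<ge> 1"
  shows "9 * tail_exponent q d * a ^ d \<le> (gam_dim q d)\<^sup>2"
proof -
  have d: "real d \<ge> 1" using assms by simp
  have d2: "real d \<le> (real d)\<^sup>2" using d by (simp add: power2_eq_square)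
  have dq: "q \<le> real d * q" using d assms mult_right_mono[of 1 "real d" q] by simp
  have k: "tail_exponent q d = 2 * (real d)\<^sup>2 + 8 * real d + 1 + 3 / 2 * q"
    by (simp add: tail_exponent_def power2_eq_square algebra_simps)
  have e: "real d * (2 * (2 * q) + 3) = 4 * (real d * q) + 3 * real d" by (simp add: algebra_simps)
  have "9 * (2 * u + 8 * t + 1 + 3 / 2 * q) \<le> 384 * (600000 * u + (4 * v + 3 * t))"
    if "1 \<le> t" "t \<le> u" "q \<le> v" for t u v :: real
  proof -
    have "18 * u \<le> 230400000 * u" "72 * t + 9 \<le> 1152 * t" "27 / 2 * q \<le> 1536 * v"
      using that assms(2) by simp_all
    moreover have "9 * (2 * u + 8 * t + 1 + 3 / 2 * q) = 18 * u + (72 * t + 9) + 27 / 2 * q" by simp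
    moreover have "384 * (600000 * u + (4 * v + 3 * t)) = 230400000 * u + 1152 * t + 1536 * v" by simp
    ultimately show ?thesis by simp
  qed
  from this[OF d d2 dq] have "9 * tail_exponent q d \<le> 384 * (600000 * (real d)\<^sup>2 + real d * (2 * (2 * q) + 3))"
    unfolding k e .
  then have "9 * tail_exponent q d * a ^ d \<le> 384 * (600000 * (real d)\<^sup>2 + real d * (2 * (2 * q) + 3)) * a ^ d"
    using a_ge_1 by (intro mult_right_mono) auto
  also have "\<dots> \<le> (gam_dim q d)\<^sup>2"
    unfolding gam_dim_def using gam_sq_ge[of d "2 * q" a L] assms a_ge_1 L_ge by auto
  finally show ?thesis .
qed

lemma mesh_const_nonneg: "0 \<le> mesh_const d"
  unfolding mesh_const_def using a_ge_1 L_pos by simp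

lemma bandwidths_vol:
  assumes h: "h \<in> bandwidths K L q d n" and "d \<ge> 1" "q \<ge> 1" "n \<ge> 3"
  shows "4 * (gam_dim q d)\<^sup>2 * ln (real n) \<le> real n * vol h {1..d}" (is ?A) and "1 \<le> real n * vol h {1..d}" (is ?B)
proof -
  note ln = ln_nat_ge_1[OF assms(4)]
  have "(2 * gam_dim q d)\<^sup>2 * ln (real n) \<le> inverse (a_star K L q d) * ln (real n)"
    unfolding gam_dim_def using inverse_a_star_ge[of d q K L] assms a_ge_1 L_pos ln by (intro mult_right_mono) auto
  also have "\<dots> \<le> real n * vol h {1..d}" using h by (simp add: bandwidths_def)
  finally show ?A by (simp add: power_mult_distrib)
  have "1 * 1 \<le> tail_exponent q d * a ^ d" using tail_exponent_ge[OF assms(2,3)] a_ge_1 by (intro mult_mono one_le_power) auto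
  then have "1 \<le> (gam_dim q d)\<^sup>2" using gam_dim_sq_ge[OF assms(2,3)] by linarith
  then have "1 * 1 \<le> 4 * (gam_dim q d)\<^sup>2 * ln (real n)" using ln by (intro mult_mono) auto
  then show ?B using \<open>?A\<close> by linarith
qed

lemma bandwidths_ge:
  assumes h: "h \<in> bandwidths K L q d n" and "d \<ge> 1" "q \<ge> 1" "n \<ge> 3" and j: "j \<in> {1..d}"
  shows "1 / real n \<le> h j"
proof -
  have "vol h {1..d} \<le> vol h {j}"
    using bandwidthsD[OF h] j by (intro vol_antimono) auto
  also have "vol h {j} = h j" by (simp add: vol_def)
  finally have "1 \<le> real n * h j"
    using bandwidths_vol(2)[OF assms(1-4)] mult_left_mono[of "vol h {1..d}" "h j" "real n"] by linarith
  then show ?thesis using assms(4) by (simp add: field_simps)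
qed

lemma est_abs_le:
  assumes h: "h \<in> bandwidths K L q d n" and "d \<ge> 1" "q \<ge> 1" "n \<ge> 3" and I: "I \<in> index_sets d"
  shows "est_abs K n X h I x \<le> a ^ card I / vol h I" and "a ^ card I / vol h I \<le> a ^ d * real n"
proof -
  have hp: "0 < h j \<and> h j \<le> 1" if "j \<in> {1..d}" for j using bandwidthsD[OF h that] by simp
  have Id: "I \<subseteq> {1..d}" using I by (simp add: index_sets_def)
  have fin: "finite I" using index_sets_card(1)[OF I] .
  have vp: "0 < vol h I" using Id hp by (intro vol_pos) auto
  have "(\<Sum>i=1..n. \<bar>kern K h I (\<lambda>j. X i j - x j)\<bar>) \<le> (\<Sum>i=1..n. a ^ card I / vol h I)"
    using Id hp by (intro sum_mono abs_kern_le fin) auto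
  then have "est_abs K n X h I x \<le> inverse (real n) * (real n * (a ^ card I / vol h I))"
    unfolding est_abs_def by (intro mult_left_mono) auto
  then show "est_abs K n X h I x \<le> a ^ card I / vol h I"
    unfolding mult.assoc[symmetric] using assms(4) by simp
  have "vol h {1..d} \<le> vol h I" using Id hp by (intro vol_antimono) auto
  then have "1 \<le> real n * vol h I"
    using bandwidths_vol(2)[OF assms(1-4)] mult_left_mono[of "vol h {1..d}" "vol h I" "real n"] by linarith
  then have "1 / vol h I \<le> real n" using vp by (simp add: field_simps)
  moreover have "a ^ card I \<le> a ^ d" using index_sets_card(3)[OF I] a_ge_1 by (intro power_increasing) auto
  ultimately have "a ^ card I * (1 / vol h I) \<le> a ^ d * real n"
    using vp a_ge_1 by (intro mult_mono) auto
  then show "a ^ card I / vol h I \<le> a ^ d * real n" by simp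
qed

lemma f_n_SUP:
  "f_n K L q d n X = enn2real
     (SUP h \<in> bandwidths K L q d n. SUP I \<in> index_sets d. SUP x \<in> I \<rightarrow>\<^sub>E UNIV. ennreal (est_abs K n X h I x))"
  unfolding f_n_def supnorm_def est_abs_def[symmetric] using est_abs_nonneg by (simp add: abs_of_nonneg)

lemma f_n_upper:
  assumes h: "h \<in> bandwidths K L q d n" and "d \<ge> 1" "q \<ge> 1" "n \<ge> 3" and I: "I \<in> index_sets d"
    and x: "x \<in> I \<rightarrow>\<^sub>E UNIV"
  shows "est_abs K n X h I x \<le> f_n K L q d n X"
proof -
  let ?S = "SUP h \<in> bandwidths K L q d n. SUP I \<in> index_sets d. SUP x \<in> I \<rightarrow>\<^sub>E UNIV. ennreal (est_abs K n X h I x)"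
  have "?S \<le> ennreal (a ^ d * real n)"
    using est_abs_le[OF _ assms(2-4)] by (intro SUP_least ennreal_leI) (meson order_trans)
  then have fin: "?S < \<infinity>" by (simp add: le_less_trans ennreal_less_top)
  have "ennreal (est_abs K n X h I x) \<le> (SUP x \<in> I \<rightarrow>\<^sub>E UNIV. ennreal (est_abs K n X h I x))"
    using x by (rule SUP_upper)
  also have "\<dots> \<le> (SUP I \<in> index_sets d. SUP x \<in> I \<rightarrow>\<^sub>E UNIV. ennreal (est_abs K n X h I x))"
    using I by (rule SUP_upper)
  also have "\<dots> \<le> ?S" using h by (rule SUP_upper)
  finally have "enn2real (ennreal (est_abs K n X h I x)) \<le> enn2real ?S"
    using fin by (intro enn2real_mono) auto
  then show ?thesis unfolding f_n_SUP using est_abs_nonneg by simp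
qed

lemma f_n_least:
  assumes "\<And>h I x. h \<in> bandwidths K L q d n \<Longrightarrow> I \<in> index_sets d \<Longrightarrow> x \<in> I \<rightarrow>\<^sub>E UNIV \<Longrightarrow> est_abs K n X h I x \<le> c" "0 \<le> c"
  shows "f_n K L q d n X \<le> c"
  unfolding f_n_SUP using assms by (intro enn2real_leI SUP_least ennreal_leI) auto

lemma abs_est1_le_fbar:
  assumes "h \<in> bandwidths K L q d n" "d \<ge> 1" "q \<ge> 1" "n \<ge> 3" "I \<in> index_sets d"
  shows "\<bar>est1 K n X h I x\<bar> \<le> fbar_n K L q d n X"
proof -
  have "\<bar>est1 K n X h I x\<bar> = \<bar>est1 K n X h I (restrict x I)\<bar>" by (simp add: est1_restrict del: restrict_apply)
  also have "\<dots> \<le> est_abs K n X h I (restrict x I)" by (rule abs_est1_le)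
  also have "\<dots> \<le> f_n K L q d n X" by (rule f_n_upper[OF assms]) auto
  also have "\<dots> \<le> fbar_n K L q d n X"
    unfolding fbar_n_def f_n_def by (simp add: max_def enn2real_nonneg)
  finally show ?thesis .
qed

end

locale kde_sample = kde K L d f bf for K L d f bf +
  fixes q :: real and n :: nat
  assumes q: "1 \<le> q" and n: "3 \<le> n"
begin

abbreviation "H \<equiv> bandwidths K L q d n"
abbreviation "N \<equiv> n ^ (d + 4)"
abbreviation "z \<equiv> tail_exponent q d * ln (real n)"
abbreviation "\<epsilon> \<equiv> mesh_const d / real n"
abbreviation "fbar X \<equiv> fbar_n K L q d n X"

lemma ln_n: "1 \<le> ln (real n)"
  by (rule ln_nat_ge_1[OF n])

lemma z_ge: "3 \<le> z"
  using mult_mono[OF tail_exponent_ge[OF d_pos q] ln_n] tail_exponent_ge[OF d_pos q] by simp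

lemma eps_nonneg: "0 \<le> \<epsilon>" and eps_le: "\<epsilon> \<le> mesh_const d"
  using mesh_const_nonneg[of d] n mult_right_mono[of 1 "real n" "mesh_const d"] by (auto simp: field_simps)

lemma fbar_ge_1: "1 \<le> fbar X" and fbar_ge_f_n: "2 * f_n K L q d n X \<le> fbar X"
  by (simp_all add: fbar_n_def)

text \<open>Bandwidths are rounded up, which keeps them positive and can only enlarge volumes: the
  fluctuation at the grid point is then controlled by the volume of h itself. Locations are rounded
  down, where the direction is immaterial.\<close>

lemma grid_approx:
  assumes h: "h \<in> H" and I: "I \<in> index_sets d"
  obtains l k where "l \<in> I \<rightarrow>\<^sub>E {1..N}" "k \<in> I \<rightarrow>\<^sub>E UNIV"
    "\<And>j. j \<in> I \<Longrightarrow> h j \<le> real (l j) / real N"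
    "\<And>t. \<bar>kern K h I (\<lambda>j. t j - x j) - kern K (\<lambda>j. real (l j) / real N) I (\<lambda>j. t j - grid_point N k j)\<bar> \<le> \<epsilon>"
proof
  define l where "l = (\<lambda>j\<in>I. nat \<lceil>real N * h j\<rceil>)"
  define k where "k = (\<lambda>j\<in>I. \<lfloor>real N * x j\<rfloor>)"
  have N: "0 < real N" using n by simp
  have Id: "I \<subseteq> {1..d}" using I by (rule index_sets_subset)
  have hb: "0 < h j" "h j \<le> 1" "1 / real n \<le> h j" if "j \<in> I" for j
    using bandwidthsD[OF h] bandwidths_ge[OF h d_pos q n] that Id by auto
  have l: "real N * h j \<le> real (l j)" "real (l j) < real N * h j + 1" "1 \<le> l j" "l j \<le> N" if j: "j \<in> I" for j
  proof -
    have p: "0 < real N * h j" using hb(1)[OF j] N by simp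
    then have c: "0 < \<lceil>real N * h j\<rceil>" by simp
    have r: "real (l j) = of_int \<lceil>real N * h j\<rceil>" using j c by (simp add: l_def)
    show "real N * h j \<le> real (l j)" "real (l j) < real N * h j + 1" unfolding r by linarith+
    have "1 \<le> nat \<lceil>real N * h j\<rceil>" using c by linarith
    then show "1 \<le> l j" using j by (simp add: l_def)
    have "\<lceil>real N * h j\<rceil> \<le> int N"
      unfolding ceiling_le_iff using hb(2)[OF j] N by (simp del: of_nat_power)
    then show "l j \<le> N" using c j by (simp add: l_def nat_le_iff)
  qed
  show "l \<in> I \<rightarrow>\<^sub>E {1..N}" using l(3,4) by (auto simp: l_def)
  show "k \<in> I \<rightarrow>\<^sub>E UNIV" by (auto simp: k_def)
  show hl: "h j \<le> real (l j) / real N" if "j \<in> I" for j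
    using l(1)[OF that] N by (simp add: field_simps)
  have hl2: "real (l j) / real N \<le> h j + 1 / real N" if "j \<in> I" for j
    using l(2)[OF that] N by (simp add: field_simps)
  have l1: "real (l j) / real N \<le> 1" if "j \<in> I" for j
    using l(4)[OF that] N by (simp del: of_nat_power)
  have xk: "\<bar>x j - grid_point N k j\<bar> \<le> 1 / real N" if "j \<in> I" for j
  proof -
    have "of_int (k j) \<le> real N * x j" "real N * x j < of_int (k j) + 1"
      using that by (simp_all add: k_def)
    then have "of_int (k j) / real N \<le> x j" "x j \<le> of_int (k j) / real N + 1 / real N"
      using N by (simp_all add: field_simps)
    then show ?thesis unfolding grid_point_def by linarith
  qed
  fix t :: point
  have "\<bar>kern K h I (\<lambda>j. t j - x j) - kern K (\<lambda>j. real (l j) / real N) I (\<lambda>j. t j - grid_point N k j)\<bar>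
      \<le> real (card I) * ((a + 2 * L) * real n ^ 3 * (1 / real N)) * (a * real n) ^ (card I - 1)"
  proof (rule kern_lipschitz)
    fix j assume j: "j \<in> I"
    show "1 / real n \<le> h j \<and> h j \<le> 1 \<and> 1 / real n \<le> real (l j) / real N \<and> real (l j) / real N \<le> 1 \<and>
       \<bar>h j - real (l j) / real N\<bar> \<le> 1 / real N"
      using hb[OF j] hl[OF j] hl2[OF j] l1[OF j] by linarith
    show "\<bar>t j - x j - (t j - grid_point N k j)\<bar> \<le> 1 / real N" using xk[OF j] by linarith
  qed (use index_sets_card(1)[OF I] n in auto)
  also have "\<dots> \<le> real d * ((a + 2 * L) * real n ^ 3 * (1 / real N)) * (a * real n) ^ (d - 1)"
  proof (intro mult_mono power_increasing)
    have "1 * 1 \<le> a * real n" using a_ge_1 n by (intro mult_mono) auto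
    then show "1 \<le> a * real n" by simp
  qed (use index_sets_card(3)[OF I] a_ge_1 L_pos n in auto)
  also have "\<dots> = real d * (a + 2 * L) * a ^ (d - 1) * (real n ^ 3 * real n ^ (d - 1) / real n ^ (d + 4))"
    by (simp add: power_mult_distrib)
  \<comment> \<open>One factor contributes n^3 through its Lipschitz constant and the other d - 1
    contribute n^(d-1) through their size; the mesh exponent d + 4 = 3 + (d - 1) + 2 outweighs
    both.\<close>
  also have "real n ^ 3 * real n ^ (d - 1) / real n ^ (d + 4) = 1 / real n ^ 2"
  proof -
    have "real n ^ (d + 4) = real n ^ 3 * real n ^ (d - 1) * real n ^ 2"
    proof -
      have "d + 4 = 3 + (d - 1) + 2" using d_pos by simp
      then show ?thesis by (simp only: power_add)
    qed
    then show ?thesis using n by simp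
  qed
  also have "real d * (a + 2 * L) * a ^ (d - 1) * (1 / real n ^ 2) \<le> real d * (a + 2 * L) * a ^ d * (1 / real n)"
  proof (intro mult_mono power_increasing)
    show "1 / real n ^ 2 \<le> 1 / real n" using n by (simp add: power2_eq_square field_simps)
  qed (use a_ge_1 L_pos n in auto)
  finally show "\<bar>kern K h I (\<lambda>j. t j - x j) - kern K (\<lambda>j. real (l j) / real N) I (\<lambda>j. t j - grid_point N k j)\<bar> \<le> \<epsilon>"
    by (simp add: mesh_const_def)
qed

lemma average_close:
  fixes u v :: "nat \<Rightarrow> real"
  assumes "\<And>i. \<bar>u i - v i\<bar> \<le> e"
  shows "\<bar>inverse (real n) * (\<Sum>i=1..n. u i) - inverse (real n) * (\<Sum>i=1..n. v i)\<bar> \<le> e"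
proof -
  have "\<bar>(\<Sum>i=1..n. u i) - (\<Sum>i=1..n. v i)\<bar> \<le> (\<Sum>i=1..n. \<bar>u i - v i\<bar>)"
    unfolding sum_subtractf[symmetric] by (rule sum_abs)
  also have "\<dots> \<le> real n * e" using sum_mono[of "{1..n}" "\<lambda>i. \<bar>u i - v i\<bar>" "\<lambda>_. e"] assms by simp
  finally have "inverse (real n) * \<bar>(\<Sum>i=1..n. u i) - (\<Sum>i=1..n. v i)\<bar> \<le> inverse (real n) * (real n * e)"
    by (intro mult_left_mono) auto
  also have "\<dots> = e" using n by simp
  finally show ?thesis by (simp add: right_diff_distrib[symmetric] abs_mult)
qed

lemma expectation_close:
  fixes u v :: "point \<Rightarrow> real"
  assumes "\<And>t. \<bar>u t - v t\<bar> \<le> e" "integrable \<mu> u" "integrable \<mu> v"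
  shows "\<bar>\<mu>.expectation u - \<mu>.expectation v\<bar> \<le> e"
proof -
  have "\<bar>\<mu>.expectation u - \<mu>.expectation v\<bar> = \<bar>\<mu>.expectation (\<lambda>t. u t - v t)\<bar>"
    using assms by simp
  also have "\<dots> \<le> \<mu>.expectation (\<lambda>t. \<bar>u t - v t\<bar>)" by (rule integral_abs_bound)
  also have "\<dots> \<le> e" using assms by (intro \<mu>.integral_le_const) auto
  finally show ?thesis .
qed

lemma grid_approx_estimators:
  assumes h: "h \<in> H" and I: "I \<in> index_sets d" and X: "X \<in> good_event z N n"
  obtains h' x' where "close_to_mean z n X h' I x'" "\<And>j. j \<in> I \<Longrightarrow> h j \<le> h' j"
    "\<bar>est1 K n X h I x - est1 K n X h' I x'\<bar> \<le> \<epsilon>" "\<bar>est_abs K n X h I x - est_abs K n X h' I x'\<bar> \<le> \<epsilon>"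
    "\<bar>mean h I x - mean h' I x'\<bar> \<le> \<epsilon>" "\<bar>abs_mean h I x - abs_mean h' I x'\<bar> \<le> \<epsilon>"
proof -
  obtain l k where lk: "l \<in> I \<rightarrow>\<^sub>E {1..N}" "k \<in> I \<rightarrow>\<^sub>E UNIV"
    "\<And>j. j \<in> I \<Longrightarrow> h j \<le> real (l j) / real N"
    and kd: "\<And>t. \<bar>kern K h I (\<lambda>j. t j - x j) - kern K (\<lambda>j. real (l j) / real N) I (\<lambda>j. t j - grid_point N k j)\<bar> \<le> \<epsilon>"
    using grid_approx[OF h I] by blast
  have kd2: "\<bar>\<bar>kern K h I (\<lambda>j. t j - x j)\<bar> - \<bar>kern K (\<lambda>j. real (l j) / real N) I (\<lambda>j. t j - grid_point N k j)\<bar>\<bar> \<le> \<epsilon>" for t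
    using kd[of t] by linarith
  have hp: "0 < h j" if "j \<in> I" for j using bandwidthsD(1)[OF h] index_sets_subset[OF I] that by auto
  then have hp': "0 < real (l j) / real N" if "j \<in> I" for j using lk(3)[OF that] that by (meson less_le_trans)
  note i = integrable_kern_\<mu>[OF I hp] integrable_kern_\<mu>[OF I hp']
  show thesis
  proof (rule that)
    show "close_to_mean z n X (\<lambda>j. real (l j) / real N) I (grid_point N k)"
      using X I lk(1,2) by (auto simp: good_event_def)
    show "\<bar>est1 K n X h I x - est1 K n X (\<lambda>j. real (l j) / real N) I (grid_point N k)\<bar> \<le> \<epsilon>"
      unfolding est1_def by (rule average_close[OF kd])
    show "\<bar>est_abs K n X h I x - est_abs K n X (\<lambda>j. real (l j) / real N) I (grid_point N k)\<bar> \<le> \<epsilon>"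
      unfolding est_abs_def by (rule average_close[OF kd2])
    show "\<bar>mean h I x - mean (\<lambda>j. real (l j) / real N) I (grid_point N k)\<bar> \<le> \<epsilon>"
      unfolding mean_def by (rule expectation_close[OF kd i])
    show "\<bar>abs_mean h I x - abs_mean (\<lambda>j. real (l j) / real N) I (grid_point N k)\<bar> \<le> \<epsilon>"
      unfolding abs_mean_def by (rule expectation_close[OF kd2 integrable_abs[OF i(1)] integrable_abs[OF i(2)]])
  qed (rule lk(3))
qed

definition noise_level :: "point \<Rightarrow> nat set \<Rightarrow> real" where
  "noise_level h I = z * a ^ card I / (real n * vol h I)"

lemma noise_level_bounds:
  assumes h: "h \<in> H" and I: "I \<in> index_sets d"
  shows "0 \<le> noise_level h I" "noise_level h I \<le> 1 / 36"
    and "noise_level h I * 9 \<le> (gam_dim q d)\<^sup>2 * (ln (real n) / (real n * vol h I))"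
    and "real n * vol h {1..d} \<le> real n * vol h I" "0 < real n * vol h I"
proof -
  have hp: "0 < h j \<and> h j \<le> 1" if "j \<in> {1..d}" for j using bandwidthsD[OF h that] by simp
  have Id: "I \<subseteq> {1..d}" by (rule index_sets_subset[OF I])
  have vp: "0 < vol h I" using Id hp by (intro vol_pos) auto
  then show nv: "0 < real n * vol h I" using n by simp
  have "0 \<le> z * a ^ card I" using z_ge a_ge_1 by (intro mult_nonneg_nonneg[of z]) auto
  then show "0 \<le> noise_level h I" unfolding noise_level_def using nv by (rule divide_nonneg_pos)
  have vm: "vol h {1..d} \<le> vol h I" using Id hp by (intro vol_antimono) auto
  then show vn: "real n * vol h {1..d} \<le> real n * vol h I" by (intro mult_left_mono) auto
  have "a ^ card I \<le> a ^ d" using index_sets_card(3)[OF I] a_ge_1 by (intro power_increasing) auto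
  then have "9 * tail_exponent q d * a ^ card I \<le> 9 * tail_exponent q d * a ^ d"
    using tail_exponent_ge[OF d_pos q] by (intro mult_left_mono) auto
  then have g: "9 * tail_exponent q d * a ^ card I \<le> (gam_dim q d)\<^sup>2" using gam_dim_sq_ge[OF d_pos q] by linarith
  have za: "9 * (z * a ^ card I) \<le> (gam_dim q d)\<^sup>2 * ln (real n)"
    using mult_right_mono[OF g, of "ln (real n)"] ln_n by (simp add: mult_ac)
  then have "9 * (z * a ^ card I) / (real n * vol h I) \<le> (gam_dim q d)\<^sup>2 * ln (real n) / (real n * vol h I)"
    using nv by (intro divide_right_mono) auto
  then show "noise_level h I * 9 \<le> (gam_dim q d)\<^sup>2 * (ln (real n) / (real n * vol h I))"
    by (simp add: noise_level_def mult.commute)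
  \<comment> \<open>Here 36 = 4 * 9: the bandwidth condition supplies 4 \<open>gam_dim\<close>^2 ln
    n, and \<open>gam_dim\<close>^2 ln n covers 9 z a^|I|. The result is the threshold required by
    \<open>le_of_self_normalized\<close>.\<close>
  have "36 * (z * a ^ card I) \<le> real n * vol h I"
    using za bandwidths_vol(1)[OF h d_pos q n] vn by linarith
  then show "noise_level h I \<le> 1 / 36" unfolding noise_level_def using nv by (simp add: field_simps)
qed

lemma fluct_le:
  assumes h: "h \<in> H" and I: "I \<in> index_sets d" and h': "\<And>j. j \<in> I \<Longrightarrow> h j \<le> h' j"
  shows "fluct z n h' I x \<le> 2 * sqrt (noise_level h I * abs_mean h' I x) + noise_level h I"
proof -
  have hp: "0 < h j" if "j \<in> I" for j using bandwidthsD(1)[OF h] index_sets_subset[OF I] that by auto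
  have v: "0 < vol h I" using hp by (rule vol_pos)
  have "vol h I \<le> vol h' I" unfolding vol_def using h' hp by (intro prod_mono) (auto simp: less_imp_le)
  then have b: "z * a ^ card I / (real n * vol h' I) \<le> noise_level h I"
    unfolding noise_level_def using v n z_ge a_ge_1 by (intro divide_left_mono mult_left_mono mult_pos_pos) auto
  then have "z * a ^ card I / (real n * vol h' I) * abs_mean h' I x \<le> noise_level h I * abs_mean h' I x"
    by (intro mult_right_mono abs_mean_nonneg)
  then show ?thesis unfolding fluct_def using b by (intro add_mono mult_left_mono real_sqrt_le_mono) auto
qed

text \<open>Grid and bandwidth set need not match: the |K|-estimator at the grid point is compared
  with the one at h, and it is the latter that \<open>f_n\<close> dominates. This bounds
  \<open>abs_mean\<close>, which is the variance proxy inside the deviation of \<open>est1\<close>;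
  the bound on \<open>est_abs\<close> conversely uses that \<open>abs_mean\<close> is at most bf
  a^d.\<close>

lemma good_event_bounds:
  assumes h: "h \<in> H" and I: "I \<in> index_sets d" and X: "X \<in> good_event z N n"
  shows "abs_mean h I x \<le> fbar X + 3 * \<epsilon>"
    and "\<bar>est1 K n X h I x - mean h I x\<bar> \<le> gam_dim q d * sqrt (fbar X * ln (real n) / (real n * vol h I)) + 3 * \<epsilon>"
    and "est_abs K n X h I x \<le> 2 * (bf * a ^ d) + 1 + mesh_const d"
proof -
  \<comment> \<open>The supremum in \<open>f_n\<close> runs over extensional points, whereas x is
    arbitrary; only the coordinates in I matter.\<close>
  define x0 where "x0 = restrict x I"
  have kr: "kern K h I (\<lambda>j. t j - x0 j) = kern K h I (\<lambda>j. t j - x j)" for t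
    unfolding x0_def kern_eq_prod by (intro prod.cong) auto
  have x0: "est1 K n X h I x = est1 K n X h I x0" "est_abs K n X h I x = est_abs K n X h I x0"
    "mean h I x = mean h I x0" "abs_mean h I x = abs_mean h I x0"
    by (simp_all add: est1_def est_abs_def mean_def abs_mean_def kr)
  obtain h' x' where g: "close_to_mean z n X h' I x'" "\<And>j. j \<in> I \<Longrightarrow> h j \<le> h' j"
    and d1: "\<bar>est1 K n X h I x0 - est1 K n X h' I x'\<bar> \<le> \<epsilon>" and d2: "\<bar>est_abs K n X h I x0 - est_abs K n X h' I x'\<bar> \<le> \<epsilon>"
    and d3: "\<bar>mean h I x0 - mean h' I x'\<bar> \<le> \<epsilon>" and d4: "\<bar>abs_mean h I x0 - abs_mean h' I x'\<bar> \<le> \<epsilon>"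
    using grid_approx_estimators[OF h I X] by blast
  define m where "m = abs_mean h' I x'"
  define F where "F = est_abs K n X h' I x'"
  define b where "b = noise_level h I"
  have b: "0 \<le> b" "b \<le> 1 / 36" using noise_level_bounds[OF h I] by (auto simp: b_def)
  have m: "0 \<le> m" by (simp add: m_def abs_mean_nonneg)
  have fl: "fluct z n h' I x' \<le> 2 * sqrt (b * m) + b" using fluct_le[OF h I g(2)] by (simp add: b_def m_def)
  have Fm: "\<bar>F - m\<bar> \<le> 2 * sqrt (b * m) + b" using g(1) fl by (simp add: close_to_mean_def F_def m_def)
  have e1: "\<bar>est1 K n X h' I x' - mean h' I x'\<bar> \<le> 2 * sqrt (b * m) + b" using g(1) fl by (simp add: close_to_mean_def)
  have "est_abs K n X h I x0 \<le> f_n K L q d n X" by (rule f_n_upper[OF h d_pos q n I]) (simp add: x0_def)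
  then have Ff: "2 * F \<le> fbar X + 2 * \<epsilon>" using d2 fbar_ge_f_n[of X] by (simp add: F_def)
  have mf: "m \<le> fbar X + 2 * \<epsilon>"
    using le_of_self_normalized[OF b m Fm] Ff fbar_ge_1[of X] eps_nonneg by linarith
  then show "abs_mean h I x \<le> fbar X + 3 * \<epsilon>" using d4 by (simp add: x0 m_def)
  define \<phi> where "\<phi> = fbar X"
  have \<phi>: "1 \<le> \<phi>" by (simp add: \<phi>_def fbar_ge_1)
  have s1: "1 \<le> sqrt \<phi>" using \<phi> by simp
  \<comment> \<open>Since \<phi> \<ge> 1, the discretisation error leaves the root as an additive
    \<epsilon>, not as sqrt \<epsilon>, and so stays of order 1/n.\<close>
  have "\<phi> + 2 * \<epsilon> \<le> (sqrt \<phi> + \<epsilon>)\<^sup>2"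
  proof -
    have "1 * \<epsilon> \<le> sqrt \<phi> * \<epsilon>" using s1 eps_nonneg by (intro mult_right_mono) auto
    moreover have "(sqrt \<phi> + \<epsilon>)\<^sup>2 = \<phi> + 2 * (sqrt \<phi> * \<epsilon>) + \<epsilon>\<^sup>2" using \<phi> by (simp add: power2_sum)
    ultimately show ?thesis using zero_le_power2[of \<epsilon>] by linarith
  qed
  then have sm: "sqrt m \<le> sqrt \<phi> + \<epsilon>"
    using mf eps_nonneg s1 m by (intro real_le_lsqrt) (auto simp: \<phi>_def)
  have sb: "sqrt b \<le> 1 / 6" using b by (intro real_le_lsqrt) (auto simp: power_divide)
  have "sqrt (b * m) \<le> sqrt b * (sqrt \<phi> + \<epsilon>)"
    unfolding real_sqrt_mult using sm b by (intro mult_left_mono) auto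
  also have "\<dots> = sqrt (b * \<phi>) + sqrt b * \<epsilon>" by (simp add: real_sqrt_mult distrib_left)
  also have "sqrt b * \<epsilon> \<le> 1 / 6 * \<epsilon>" using sb eps_nonneg by (intro mult_right_mono) auto
  finally have 1: "sqrt (b * m) \<le> sqrt (b * \<phi>) + 1 / 6 * \<epsilon>" by simp
  have "b = sqrt b * sqrt b" using b by simp
  also have "\<dots> \<le> sqrt b * sqrt \<phi>" using sb s1 b by (intro mult_left_mono) auto
  finally have 2: "b \<le> sqrt (b * \<phi>)" by (simp add: real_sqrt_mult)
  have "\<bar>est1 K n X h I x - mean h I x\<bar> \<le> 3 * sqrt (b * \<phi>) + 3 * \<epsilon>"
    using d1 d3 e1 1 2 eps_nonneg unfolding x0 by linarith
  also have "3 * sqrt (b * \<phi>) \<le> gam_dim q d * sqrt (fbar X * ln (real n) / (real n * vol h I))"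
  proof -
    have "3 * sqrt (b * \<phi>) = sqrt (b * 9 * \<phi>)" by (simp add: real_sqrt_mult)
    also have "\<dots> \<le> sqrt ((gam_dim q d)\<^sup>2 * (ln (real n) / (real n * vol h I)) * \<phi>)"
      unfolding b_def using noise_level_bounds(3)[OF h I] \<phi> by (intro real_sqrt_le_mono mult_right_mono) auto
    also have "\<dots> = gam_dim q d * sqrt (fbar X * ln (real n) / (real n * vol h I))"
      using gam_dim_pos[OF d_pos q] by (simp add: real_sqrt_mult \<phi>_def mult_ac real_sqrt_divide)
    finally show ?thesis .
  qed
  finally show "\<bar>est1 K n X h I x - mean h I x\<bar> \<le> gam_dim q d * sqrt (fbar X * ln (real n) / (real n * vol h I)) + 3 * \<epsilon>"
    by simp
  have hp: "0 < h' j" if "j \<in> I" for j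
    using g(2)[OF that] bandwidthsD(1)[OF h, of j] index_sets_subset[OF I] that by (meson less_le_trans subsetD)
  have "m \<le> bf * a ^ card I" unfolding m_def by (rule abs_mean_le[OF I hp])
  also have "\<dots> \<le> bf * a ^ d" using index_sets_card(3)[OF I] a_ge_1 bf_pos by (intro mult_left_mono power_increasing) auto
  finally have mb: "m \<le> bf * a ^ d" .
  \<comment> \<open>The arithmetic-geometric mean inequality is lossy, but here any deterministic
    bound will do.\<close>
  have "2 * sqrt (b * m) \<le> b + m" using arith_geo_mean_sqrt[OF b(1) m] by simp
  then show "est_abs K n X h I x \<le> 2 * (bf * a ^ d) + 1 + mesh_const d"
    using d2 Fm b mb eps_le unfolding x0 F_def by linarith
qed

text \<open>The random quantity \<open>fbar_n\<close> appears to high powers in the majorant; on the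
  oracle side these powers are replaced by constants through this bound.\<close>

lemma fbar_le:
  assumes X: "X \<in> good_event z N n"
  shows "fbar X \<le> 4 * (bf * a ^ d) + 2 + 2 * mesh_const d"
proof -
  have 0: "0 \<le> bf * a ^ d" using bf_pos a_ge_1 by simp
  have "f_n K L q d n X \<le> 2 * (bf * a ^ d) + 1 + mesh_const d"
    using good_event_bounds(3)[OF _ _ X] 0 mesh_const_nonneg[of d] by (intro f_n_least) auto
  then show ?thesis using 0 mesh_const_nonneg[of d] by (simp add: fbar_n_def)
qed

end

section \<open>Convolution kernels and the constants of the comparison\<close>

context kernel
begin

lemma conv1_shift:
  "conv1 K b c (u - x) = (\<integral>s. kern1 K b (u - s) * kern1 K c (s - x) \<partial>lborel)"
proof -
  have "conv1 K b c (u - x) = (\<integral>s. kern1 K b ((- x + 1 * s) - (u - x)) * kern1 K c (- x + 1 * s) \<partial>lborel)"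
    unfolding conv1_def
    using lborel_integral_real_affine[of 1 "\<lambda>v. kern1 K b (v - (u - x)) * kern1 K c v" "- x"] by simp
  also have "\<dots> = (\<integral>s. kern1 K b (- (u - s)) * kern1 K c (s - x) \<partial>lborel)"
    by (intro Bochner_Integration.integral_cong) (auto simp: algebra_simps)
  finally show ?thesis unfolding kern1_sym .
qed

text \<open>The reflection s to u - s exchanges the two kernels up to a sign in the argument, which
  the symmetry of K removes.\<close>

lemma conv1_commute: "conv1 K b c u = conv1 K c b u"
proof -
  have "conv1 K c b u = (\<integral>s. kern1 K c ((u + (- 1) * s) - u) * kern1 K b (u + (- 1) * s) \<partial>lborel)"
    unfolding conv1_def
    using lborel_integral_real_affine[of "- 1" "\<lambda>v. kern1 K c (v - u) * kern1 K b v" u] by simp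
  also have "\<dots> = (\<integral>s. kern1 K b (u - s) * kern1 K c (- s) \<partial>lborel)"
    by (intro Bochner_Integration.integral_cong) auto
  finally show ?thesis using conv1_shift[of b c u 0] by (simp add: kern1_sym)
qed

text \<open>Because of this symmetry a single auxiliary estimator can be compared with the selected
  estimator and with the oracle in the selection argument.\<close>

lemma est_conv_commute: "est_conv K n X h P \<eta> P' = est_conv K n X \<eta> P' h P"
  unfolding est_conv_def est1_conv_def conv_kern_def by (intro ext) (simp add: conv1_commute meet_commute)

lemma kern1_shift_integrable: "b > 0 \<Longrightarrow> integrable lborel (\<lambda>s. kern1 K b (s - x))"
  using lborel_has_bochner_integral_real_affine_iff[of 1 "kern1 K b" 1 "- x"] has_bochner_integral_kern1(1)[of b]
  by (auto simp: has_bochner_integral_iff)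

lemma conv_kern_eq:
  assumes J: "finite J" and h: "\<And>j. j \<in> J \<Longrightarrow> 0 < h j" and \<eta>: "\<And>j. j \<in> J \<Longrightarrow> 0 < \<eta> j"
  shows "has_bochner_integral (leb J) (\<lambda>t. kern K h J (\<lambda>j. u j - t j) * kern K \<eta> J (\<lambda>j. t j - x j))
     (conv_kern K h \<eta> J (\<lambda>j. u j - x j))"
proof -
  define g where "g = (\<lambda>j s. kern1 K (h j) (u j - s) * kern1 K (\<eta> j) (s - x j))"
  have g: "integrable lborel (g j)" if j: "j \<in> J" for j
    unfolding g_def
  proof (rule Bochner_Integration.integrable_bound[OF integrable_mult_right[OF kern1_shift_integrable[OF \<eta>[OF j]], of "a / h j"]])
    show "AE s in lborel. norm (kern1 K (h j) (u j - s) * kern1 K (\<eta> j) (s - x j)) \<le> norm (a / h j * kern1 K (\<eta> j) (s - x j))"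
    proof (rule AE_I2)
      fix s
      have "\<bar>kern1 K (h j) (u j - s)\<bar> \<le> \<bar>a / h j\<bar>" using abs_kern1_le[OF h[OF j], of "u j - s"] by linarith
      then show "norm (kern1 K (h j) (u j - s) * kern1 K (\<eta> j) (s - x j)) \<le> norm (a / h j * kern1 K (\<eta> j) (s - x j))"
        unfolding real_norm_def abs_mult by (intro mult_right_mono) auto
    qed
  qed measurable
  have eq: "(\<lambda>t. kern K h J (\<lambda>j. u j - t j) * kern K \<eta> J (\<lambda>j. t j - x j)) = (\<lambda>t. \<Prod>j\<in>J. g j (t j))"
    by (simp add: kern_eq_prod g_def prod.distrib)
  have "(\<integral>t. (\<Prod>j\<in>J. g j (t j)) \<partial>leb J) = (\<Prod>j\<in>J. integral\<^sup>L lborel (g j))"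
    unfolding leb_def by (rule lborel_product.product_integral_prod[OF J g])
  moreover have "integrable (leb J) (\<lambda>t. \<Prod>j\<in>J. g j (t j))"
    unfolding leb_def by (rule lborel_product.product_integrable_prod[OF J g])
  ultimately show ?thesis
    unfolding eq conv_kern_def conv1_shift by (simp add: has_bochner_integral_iff g_def)
qed

lemma est1_conv_eq:
  assumes J: "finite J" and h: "\<And>j. j \<in> J \<Longrightarrow> 0 < h j" and \<eta>: "\<And>j. j \<in> J \<Longrightarrow> 0 < \<eta> j"
  shows "has_bochner_integral (leb J) (\<lambda>t. est1 K n X h J t * kern K \<eta> J (\<lambda>j. t j - x j)) (est1_conv K n X h \<eta> J x)"
proof -
  have "has_bochner_integral (leb J)
     (\<lambda>t. inverse (real n) * (\<Sum>i=1..n. kern K h J (\<lambda>j. X i j - t j) * kern K \<eta> J (\<lambda>j. t j - x j)))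
     (inverse (real n) * (\<Sum>i=1..n. conv_kern K h \<eta> J (\<lambda>j. X i j - x j)))"
    using J h \<eta> by (intro has_bochner_integral_mult_right has_bochner_integral_sum conv_kern_eq) auto
  then show ?thesis by (simp add: est1_def est1_conv_def sum_distrib_right mult.assoc)
qed

text \<open>Young's inequality for sup norm and L1 norm. It makes the error of a smoothed function
  independent of \<eta>.\<close>

lemma kern_smoothing_le:
  assumes k: "has_bochner_integral (leb J) (\<lambda>t. \<bar>kern K \<eta> J (\<lambda>j. t j - x j)\<bar>) k" "k \<le> c"
    and g: "\<And>t. t \<in> space (leb J) \<Longrightarrow> \<bar>g t\<bar> \<le> D" "0 \<le> D"
    and i: "integrable (leb J) (\<lambda>t. g t * kern K \<eta> J (\<lambda>j. t j - x j))"
  shows "\<bar>\<integral>t. g t * kern K \<eta> J (\<lambda>j. t j - x j) \<partial>leb J\<bar> \<le> D * c"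
proof -
  have "\<bar>\<integral>t. g t * kern K \<eta> J (\<lambda>j. t j - x j) \<partial>leb J\<bar> \<le> (\<integral>t. \<bar>g t * kern K \<eta> J (\<lambda>j. t j - x j)\<bar> \<partial>leb J)"
    by (rule integral_abs_bound)
  also have "\<dots> \<le> (\<integral>t. D * \<bar>kern K \<eta> J (\<lambda>j. t j - x j)\<bar> \<partial>leb J)"
  proof (rule integral_mono[OF integrable_abs[OF i]])
    show "integrable (leb J) (\<lambda>t. D * \<bar>kern K \<eta> J (\<lambda>j. t j - x j)\<bar>)"
      by (rule integrable_mult_right) (rule integrable.intros[OF k(1)])
  qed (use g in \<open>auto simp: abs_mult intro!: mult_right_mono\<close>)
  also have "\<dots> = D * k" using k(1) by (simp add: has_bochner_integral_iff)
  also have "\<dots> \<le> D * c" using k(2) g(2) by (rule mult_left_mono)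
  finally show ?thesis .
qed

text \<open>The bound of \<open>fbar_le\<close>, three further \<open>mesh_const\<close> to cover 3
  \<epsilon>, and bf to cover the marginals as well.\<close>

definition size_bound :: "nat \<Rightarrow> real \<Rightarrow> real" where
  "size_bound d bf = 4 * (bf * a ^ d) + 2 + 5 * mesh_const d + bf"

text \<open>The coefficient of \<epsilon> when a product of estimators is compared with the product
  of means. The power d + 1 comes from the change of the (d-1)st power of the factor bound, the
  power d from the 3 \<epsilon> in each factor.\<close>

definition noise_const :: "real \<Rightarrow> nat \<Rightarrow> real \<Rightarrow> real" where
  "noise_const q d bf = 3 * real d * (gam_dim q d * real d * size_bound d bf ^ (d + 1) + size_bound d bf ^ d)"

text \<open>At most d factors, each bounded by a^d M after smoothing, with a further a^d for the
  smoothing of the error in the exchanged factor.\<close>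

definition product_const :: "nat \<Rightarrow> real \<Rightarrow> real" where
  "product_const d bf = real d * a ^ d * (a ^ d * size_bound d bf) ^ d"

lemma size_bound_ge:
  assumes "0 < bf"
  shows "1 \<le> size_bound d bf" "bf \<le> size_bound d bf" "bf * a ^ d \<le> size_bound d bf"
proof -
  have "0 \<le> bf * a ^ d" using assms a_ge_1 by simp
  then show "1 \<le> size_bound d bf" "bf \<le> size_bound d bf" "bf * a ^ d \<le> size_bound d bf"
    using assms mesh_const_nonneg[of d] unfolding size_bound_def by linarith+
qed

lemma noise_const_nonneg: "1 \<le> d \<Longrightarrow> 1 \<le> q \<Longrightarrow> 0 < bf \<Longrightarrow> 0 \<le> noise_const q d bf"
  unfolding noise_const_def using gam_dim_pos[of d q] size_bound_ge(1)[of bf d] by simp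

lemma product_const_nonneg: "0 < bf \<Longrightarrow> 0 \<le> product_const d bf"
  unfolding product_const_def using size_bound_ge(1)[of bf d] a_ge_1 by simp

end

text \<open>With d = e + 2 one has d^2 = e^2 + 4 (d - 1), and the integer d - 1 survives rounding
  down. The inequality fits the d - 1 unexchanged factors under the power of \<open>fbar_n\<close>
  in \<open>lam\<close>.\<close>

lemma exponent_le: "d - 1 \<le> d\<^sup>2 div 4 + 1" for d :: nat
proof (cases "d \<le> 2")
  case False
  then obtain e where e: "d = e + 2" by (metis add.commute le_add_diff_inverse nat_le_linear)
  have "d\<^sup>2 = e\<^sup>2 + 4 * (e + 1)" by (simp add: e power2_eq_square algebra_simps)
  then have "d - 1 \<le> d\<^sup>2 div 4" by (simp add: e)
  then show ?thesis by simp
qed auto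

section \<open>Deterministic comparisons on the good event\<close>

context kde_sample
begin

abbreviation "M \<equiv> size_bound d bf"
abbreviation "\<gamma> \<equiv> gam_dim q d"
abbreviation "Aest X h P \<equiv> A_n K L q d n X h P"
abbreviation "lamA X h P \<equiv> lam K L q d n X * Aest X h P"

lemmas M_ge = size_bound_ge[OF bf_pos, of d]

lemma fbar_eps_le:
  assumes "X \<in> good_event z N n"
  shows "fbar X + 3 * \<epsilon> \<le> M" "fbar X \<le> M"
  using fbar_le[OF assms] eps_le eps_nonneg bf_pos mesh_const_nonneg[of d] unfolding size_bound_def by linarith+

lemma min_vol_H:
  assumes h: "h \<in> H" and P: "P \<in> partitions d"
  shows "ln (real n) \<le> real n * min_vol h P" "0 < min_vol h P"
proof -
  have "vol h {1..d} \<le> vol h I" if "I \<in> P" for I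
    using partitions_index_sets[OF P that] bandwidthsD[OF h] by (intro vol_antimono) (auto simp: index_sets_def)
  then have v: "vol h {1..d} \<le> min_vol h P" by (intro min_vol_ge[OF P d_pos])
  have "0 < vol h {1..d}" using bandwidthsD(1)[OF h] by (intro vol_pos)
  then show "0 < min_vol h P" using v by linarith
  have "1 * 1 \<le> tail_exponent q d * a ^ d" using tail_exponent_ge[OF d_pos q] a_ge_1 by (intro mult_mono one_le_power) auto
  then have "1 \<le> 4 * \<gamma>\<^sup>2" using gam_dim_sq_ge[OF d_pos q] by linarith
  then have "1 * ln (real n) \<le> 4 * \<gamma>\<^sup>2 * ln (real n)" using ln_n by (intro mult_right_mono) auto
  also have "\<dots> \<le> real n * vol h {1..d}" by (rule bandwidths_vol(1)[OF h d_pos q n])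
  also have "\<dots> \<le> real n * min_vol h P" using v by (intro mult_left_mono) auto
  finally show "ln (real n) \<le> real n * min_vol h P" by simp
qed

definition rate :: "point \<Rightarrow> nat set set \<Rightarrow> real" where
  "rate h P = sqrt (ln (real n) / (real n * min_vol h P))"

lemma rate_nonneg: "h \<in> H \<Longrightarrow> P \<in> partitions d \<Longrightarrow> 0 \<le> rate h P"
  unfolding rate_def using min_vol_H[of h P] ln_n by auto

lemma A_n_eq: "Aest X h P = sqrt (fbar X) * rate h P"
  unfolding A_n_def rate_def by (simp add: real_sqrt_mult[symmetric])

lemma sqrt_fbar_le: "X \<in> good_event z N n \<Longrightarrow> sqrt (fbar X) \<le> M"
proof -
  assume X: "X \<in> good_event z N n"
  have "fbar X * 1 \<le> fbar X * fbar X" using fbar_ge_1[of X] by (intro mult_left_mono) auto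
  then have "sqrt (fbar X) \<le> fbar X" using fbar_ge_1[of X] by (intro real_le_lsqrt) (auto simp: power2_eq_square)
  then show ?thesis using fbar_eps_le(2)[OF X] by linarith
qed

text \<open>Bandwidths are at most 1, so a sub-block has the larger volume. Hence the blocks of P
  \<diamond> P' cost no more than those of P, and the rate of the oracle does not depend on
  P'.\<close>

lemma sqrt_noise_le:
  assumes h: "h \<in> H" and P: "P \<in> partitions d" and J: "J \<subseteq> I" "I \<in> P"
  shows "sqrt (fbar X * ln (real n) / (real n * vol h J)) \<le> Aest X h P"
proof -
  have I: "I \<subseteq> {1..d}" "finite I" using partitions_index_sets[OF P J(2)] index_sets_card(1) by (auto simp: index_sets_def)
  have "min_vol h P \<le> vol h I" by (rule min_vol_le[OF P J(2)])
  also have "\<dots> \<le> vol h J" using J I bandwidthsD[OF h] by (intro vol_antimono) auto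
  finally have v: "min_vol h P \<le> vol h J" .
  have "fbar X * ln (real n) / (real n * vol h J) \<le> fbar X * ln (real n) / (real n * min_vol h P)"
    using v min_vol_H(2)[OF h P] fbar_ge_1[of X] ln_n n by (intro divide_left_mono mult_left_mono mult_pos_pos mult_nonneg_nonneg) auto
  then show ?thesis unfolding A_n_def by (rule real_sqrt_le_mono)
qed

lemma est_mean_close:
  assumes X: "X \<in> good_event z N n" and h: "h \<in> H" and P: "P \<in> partitions d" and J: "J \<subseteq> I" "I \<in> P" "J \<noteq> {}"
  shows "\<bar>est1 K n X h J x - mean h J x\<bar> \<le> \<gamma> * Aest X h P + 3 * \<epsilon>"
proof -
  have Ji: "J \<in> index_sets d" using J partitions_index_sets[OF P J(2)] by (auto simp: index_sets_def)
  have "\<gamma> * sqrt (fbar X * ln (real n) / (real n * vol h J)) \<le> \<gamma> * Aest X h P"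
    using sqrt_noise_le[OF h P J(1,2)] gam_dim_pos[OF d_pos q] by (intro mult_left_mono) auto
  then show ?thesis using good_event_bounds(2)[OF h Ji X, of x] by linarith
qed

text \<open>This comparison has to meet the majorant exactly: its leading term may use only
  \<open>Lam\<close>, one factor d and the prescribed power of \<open>fbar_n\<close>. Only the part
  of order \<epsilon> may carry a free constant.\<close>

lemma prod_est_mean_close:
  assumes X: "X \<in> good_event z N n" and \<eta>: "\<eta> \<in> H" and P: "P \<in> partitions d"
  shows "\<bar>est K n X \<eta> P x - (\<Prod>I\<in>P. mean \<eta> I x)\<bar> \<le> lamA X \<eta> P + noise_const q d bf * \<epsilon>"
proof -
  define \<phi> where "\<phi> = fbar X"
  define A where "A = Aest X \<eta> P"
  define B where "B = \<phi> + 3 * \<epsilon>"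
  have \<phi>: "1 \<le> \<phi>" by (simp add: \<phi>_def fbar_ge_1)
  have B: "1 \<le> B" "\<phi> \<le> B" "B \<le> M" using \<phi> eps_nonneg fbar_eps_le(1)[OF X] by (auto simp: B_def \<phi>_def)
  have \<gamma>: "0 < \<gamma>" by (rule gam_dim_pos[OF d_pos q])
  have A0: "0 \<le> A" unfolding A_def A_n_eq using rate_nonneg[OF \<eta> P] fbar_ge_1[of X] by simp
  \<comment> \<open>The factor A also multiplies a term of order \<epsilon>, where it is replaced by
    the constant M.\<close>
  have "rate \<eta> P \<le> 1" unfolding rate_def using min_vol_H[OF \<eta> P] n by (simp add: divide_le_eq)
  then have "A \<le> M * 1"
    unfolding A_def A_n_eq using sqrt_fbar_le[OF X] rate_nonneg[OF \<eta> P] M_ge(1) by (intro mult_mono) auto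
  then have AM: "A \<le> M" by simp
  have fin: "finite P" by (rule partitions_finite[OF P])
  have ix: "I \<in> index_sets d" if "I \<in> P" for I by (rule partitions_index_sets[OF P that])
  have D0: "0 \<le> \<gamma> * A + 3 * \<epsilon>" using \<gamma> A0 eps_nonneg by simp
  have "\<bar>est K n X \<eta> P x - (\<Prod>I\<in>P. mean \<eta> I x)\<bar> \<le> real (card P) * (\<gamma> * A + 3 * \<epsilon>) * B ^ (card P - 1)"
    unfolding est_def
  proof (rule abs_prod_diff_le[OF fin])
    fix I assume I: "I \<in> P"
    show "\<bar>est1 K n X \<eta> I x\<bar> \<le> B" using abs_est1_le_fbar[OF \<eta> d_pos q n ix[OF I], of X x] B by (simp add: \<phi>_def)
    have "\<bar>mean \<eta> I x\<bar> \<le> abs_mean \<eta> I x" by (rule mean_le_abs_mean)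
    then show "\<bar>mean \<eta> I x\<bar> \<le> B"
      using good_event_bounds(1)[OF \<eta> ix[OF I] X, of x] by (simp add: B_def \<phi>_def)
    show "\<bar>est1 K n X \<eta> I x - mean \<eta> I x\<bar> \<le> \<gamma> * A + 3 * \<epsilon>"
      unfolding A_def using ix[OF I] by (intro est_mean_close[OF X \<eta> P order_refl I]) (auto simp: index_sets_def)
  qed (use B D0 in auto)
  also have "\<dots> \<le> real d * (\<gamma> * A + 3 * \<epsilon>) * B ^ (d - 1)"
    using card_partition_le[OF P] B D0 by (intro mult_mono power_increasing) auto
  \<comment> \<open>The means are bounded only by \<phi> + 3 \<epsilon>, slightly more than
    \<open>lam\<close> allows. Splitting off the pure power of \<phi> leaves a remainder that is
    proportional to \<epsilon>.\<close>
  also have "\<dots> = real d * (\<gamma> * A * \<phi> ^ (d - 1)) + real d * (\<gamma> * A * (B ^ (d - 1) - \<phi> ^ (d - 1)) + 3 * \<epsilon> * B ^ (d - 1))"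
    by (simp add: algebra_simps)
  also have "\<dots> \<le> lamA X \<eta> P + noise_const q d bf * \<epsilon>"
  proof (rule add_mono)
    have "\<phi> ^ (d - 1) \<le> \<phi> ^ (d\<^sup>2 div 4 + 1)" using exponent_le \<phi> by (intro power_increasing)
    moreover have "\<gamma> \<le> Lam K L q d" unfolding gam_dim_def by (rule Lam_ge_gam[OF d_pos])
    ultimately have "real d * (\<gamma> * A * \<phi> ^ (d - 1)) \<le> real d * (Lam K L q d * A * \<phi> ^ (d\<^sup>2 div 4 + 1))"
      using \<gamma> A0 \<phi> by (intro mult_left_mono mult_mono mult_right_mono) auto
    also have "\<dots> = lamA X \<eta> P" by (simp add: lam_def A_def \<phi>_def)
    finally show "real d * (\<gamma> * A * \<phi> ^ (d - 1)) \<le> lamA X \<eta> P" .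
  next
    \<comment> \<open>Powers are products of equal factors, so the product inequality doubles as a
      mean value bound.\<close>
    have "\<bar>(\<Prod>i\<in>{..<d - 1}. B) - (\<Prod>i\<in>{..<d - 1}. \<phi>)\<bar> \<le> real (card {..<d - 1}) * (3 * \<epsilon>) * B ^ (card {..<d - 1} - 1)"
      using B \<phi> eps_nonneg by (intro abs_prod_diff_le) (auto simp: B_def)
    then have "B ^ (d - 1) - \<phi> ^ (d - 1) \<le> real (d - 1) * (3 * \<epsilon>) * B ^ (d - 1 - 1)" by simp
    also have "\<dots> \<le> real d * (3 * \<epsilon>) * M ^ d"
    proof (intro mult_mono)
      show "B ^ (d - 1 - 1) \<le> M ^ d" using B M_ge(1) by (intro order_trans[OF power_mono[of B M] power_increasing]) auto
    qed (use eps_nonneg mesh_const_nonneg[of d] B in auto)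
    finally have BB: "B ^ (d - 1) - \<phi> ^ (d - 1) \<le> real d * (3 * \<epsilon>) * M ^ d" .
    have BM: "B ^ (d - 1) \<le> M ^ d" using B M_ge(1) by (intro order_trans[OF power_mono[of B M] power_increasing]) auto
    have "0 \<le> B ^ (d - 1) - \<phi> ^ (d - 1)" using B \<phi> by (simp add: power_mono)
    then have "\<gamma> * A * (B ^ (d - 1) - \<phi> ^ (d - 1)) \<le> \<gamma> * M * (real d * (3 * \<epsilon>) * M ^ d)"
      using BB AM A0 \<gamma> M_ge(1) by (intro mult_mono) auto
    moreover have "3 * \<epsilon> * B ^ (d - 1) \<le> 3 * \<epsilon> * M ^ d" using BM eps_nonneg by (intro mult_left_mono) auto
    ultimately have "\<gamma> * A * (B ^ (d - 1) - \<phi> ^ (d - 1)) + 3 * \<epsilon> * B ^ (d - 1) \<le>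
      \<gamma> * M * (real d * (3 * \<epsilon>) * M ^ d) + 3 * \<epsilon> * M ^ d"
      by (rule add_mono)
    then have "real d * (\<gamma> * A * (B ^ (d - 1) - \<phi> ^ (d - 1)) + 3 * \<epsilon> * B ^ (d - 1)) \<le>
      real d * (\<gamma> * M * (real d * (3 * \<epsilon>) * M ^ d) + 3 * \<epsilon> * M ^ d)"
      by (rule mult_left_mono) simp
    also have "\<dots> = noise_const q d bf * \<epsilon>"
      by (simp add: noise_const_def algebra_simps power_add)
    finally show "real d * (\<gamma> * A * (B ^ (d - 1) - \<phi> ^ (d - 1)) + 3 * \<epsilon> * B ^ (d - 1)) \<le> noise_const q d bf * \<epsilon>" .
  qed
  finally show ?thesis .
qed

definition marg_err :: "real \<Rightarrow> point \<Rightarrow> nat set set \<Rightarrow> real" where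
  "marg_err b h P = \<gamma> * (M * rate h P) + 3 * \<epsilon> + b"

lemma marg_err_nonneg: "h \<in> H \<Longrightarrow> P \<in> partitions d \<Longrightarrow> 0 \<le> b \<Longrightarrow> 0 \<le> marg_err b h P"
  unfolding marg_err_def using rate_nonneg[of h P] gam_dim_pos[OF d_pos q] M_ge(1) eps_nonneg by simp

lemma est_marg_close:
  assumes X: "X \<in> good_event z N n" and h: "h \<in> H" and P: "P \<in> partitions d"
    and J: "J \<subseteq> I" "I \<in> P" "J \<noteq> {}" and b: "bias K d f h J \<le> ennreal b" "0 \<le> b" and x: "x \<in> J \<rightarrow>\<^sub>E UNIV"
  shows "\<bar>est1 K n X h J x - marg J x\<bar> \<le> marg_err b h P"
proof -
  have Ji: "J \<in> index_sets d" using J partitions_index_sets[OF P J(2)] by (auto simp: index_sets_def)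
  have hp: "0 < h j" if "j \<in> J" for j using bandwidthsD(1)[OF h] index_sets_subset[OF Ji] that by auto
  have 1: "\<bar>mean h J x - marg J x\<bar> \<le> b"
    using b x by (intro abs_le_supnorm[of J "\<lambda>x. mean h J x - marg J x"]) (simp_all add: bias_eq[OF Ji hp])
  have "Aest X h P \<le> M * rate h P"
    unfolding A_n_eq using sqrt_fbar_le[OF X] rate_nonneg[OF h P] by (rule mult_right_mono)
  then have "\<gamma> * Aest X h P \<le> \<gamma> * (M * rate h P)" using gam_dim_pos[OF d_pos q] by (intro mult_left_mono) auto
  then show ?thesis using est_mean_close[OF X h P J, of x] 1 unfolding marg_err_def by linarith
qed

text \<open>On a block J, \<open>mean \<eta> J\<close> and \<open>est1_conv\<close> are the same
  \<eta>-smoothing, applied to \<open>marg J\<close> and to \<open>est1\<close> at bandwidth h.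
  Their difference therefore costs the sup error at h times at most a^d, uniformly in \<eta> and
  P'.\<close>

lemma est_conv_close:
  assumes X: "X \<in> good_event z N n" and h: "h \<in> H" and P: "P \<in> indep_partitions d f"
    and \<eta>: "\<eta> \<in> H" and P': "P' \<in> partitions d"
    and b: "\<And>J. J \<in> P \<diamond> P' \<Longrightarrow> bias K d f h J \<le> ennreal b" "0 \<le> b"
  shows "\<bar>est_conv K n X h P \<eta> P' x - (\<Prod>I\<in>P'. mean \<eta> I x)\<bar> \<le> product_const d bf * marg_err b h P"
proof -
  have PP: "P \<in> partitions d" using P by (auto simp: indep_partitions_def)
  define D where "D = marg_err b h P"
  have D: "0 \<le> D" unfolding D_def by (rule marg_err_nonneg[OF h PP b(2)])
  have ad: "1 \<le> a ^ d" using a_ge_1 by simp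
  have eq: "(\<Prod>I\<in>P'. mean \<eta> I x) = (\<Prod>J\<in>P \<diamond> P'. mean \<eta> J x)"
    using bandwidthsD(1)[OF \<eta>] by (intro prod_mean_independent[OF P P'])
  have Mg: "1 \<le> a ^ d * M" using mult_mono[OF ad M_ge(1)] ad by simp
  have "\<bar>est_conv K n X h P \<eta> P' x - (\<Prod>J\<in>P \<diamond> P'. mean \<eta> J x)\<bar>
     \<le> real (card (P \<diamond> P')) * (D * a ^ d) * (a ^ d * M) ^ (card (P \<diamond> P') - 1)"
    unfolding est_conv_def
  proof (rule abs_prod_diff_le[OF finite_meet[OF PP P']])
    fix J assume J: "J \<in> P \<diamond> P'"
    then obtain I I' where I: "I \<in> P" "J = I \<inter> I'" "J \<noteq> {}" by (auto simp: meet_def)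
    have Ji: "J \<in> index_sets d" by (rule meet_index_sets[OF PP J])
    have fin: "finite J" by (rule index_sets_card(1)[OF Ji])
    have hp: "0 < h j" "0 < \<eta> j" if "j \<in> J" for j
      using bandwidthsD(1)[OF h] bandwidthsD(1)[OF \<eta>] index_sets_subset[OF Ji] that by auto
    have c: "has_bochner_integral (leb J) (\<lambda>t. est1 K n X h J t * kern K \<eta> J (\<lambda>j. t j - x j)) (est1_conv K n X h \<eta> J x)"
      by (rule est1_conv_eq[OF fin]) (rule hp, assumption)+
    have k: "has_bochner_integral (leb J) (\<lambda>t. \<bar>kern K \<eta> J (\<lambda>j. t j - x j)\<bar>) ((\<integral>t. \<bar>K t\<bar> \<partial>lborel) ^ card J)"
      by (rule kern_integral(2)[OF fin]) (rule hp)
    have k1: "has_bochner_integral (leb J) (\<lambda>t. kern K \<eta> J (\<lambda>j. t j - x j)) 1"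
      by (rule kern_integral(1)[OF fin]) (rule hp)
    have aJ: "a ^ card J \<le> a ^ d" using index_sets_card(3)[OF Ji] a_ge_1 by (intro power_increasing) auto
    have kc: "(\<integral>t. \<bar>K t\<bar> \<partial>lborel) ^ card J \<le> a ^ d"
      using power_mono[OF integral_abs_K_le, of "card J"] aJ by simp
    have ic: "integrable (leb J) (\<lambda>t. est1 K n X h J t * kern K \<eta> J (\<lambda>j. t j - x j))"
      and ec: "est1_conv K n X h \<eta> J x = (\<integral>t. est1 K n X h J t * kern K \<eta> J (\<lambda>j. t j - x j) \<partial>leb J)"
      using c by (auto simp: has_bochner_integral_iff)
    have im: "integrable (leb J) (\<lambda>t. marg J t * kern K \<eta> J (\<lambda>j. t j - x j))"
      using k1 by (intro integrable_marginal_mult[OF Ji]) (auto simp: has_bochner_integral_iff)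
    have "\<bar>est1_conv K n X h \<eta> J x\<bar> \<le> fbar X * a ^ d"
      unfolding ec using abs_est1_le_fbar[OF h d_pos q n Ji, of X] fbar_ge_1[of X]
      by (intro kern_smoothing_le[OF k kc _ _ ic]) auto
    also have "\<dots> \<le> a ^ d * M" using fbar_eps_le(2)[OF X] ad by (simp add: mult.commute)
    finally show "\<bar>est1_conv K n X h \<eta> J x\<bar> \<le> a ^ d * M" .
    have "\<bar>mean \<eta> J x\<bar> \<le> bf * a ^ card J"
    proof (rule order_trans)
      show "\<bar>mean \<eta> J x\<bar> \<le> abs_mean \<eta> J x" by (rule mean_le_abs_mean)
      show "abs_mean \<eta> J x \<le> bf * a ^ card J" by (rule abs_mean_le[OF Ji]) (rule hp)
    qed
    also have "\<dots> \<le> bf * a ^ d" using aJ bf_pos by simp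
    also have "\<dots> \<le> 1 * M" using M_ge by simp
    also have "\<dots> \<le> a ^ d * M" using ad M_ge(1) by (intro mult_right_mono) auto
    finally show "\<bar>mean \<eta> J x\<bar> \<le> a ^ d * M" .
    have "est1_conv K n X h \<eta> J x - mean \<eta> J x =
      (\<integral>t. (est1 K n X h J t - marg J t) * kern K \<eta> J (\<lambda>j. t j - x j) \<partial>leb J)"
      unfolding ec mean_eq(1)[OF Ji] left_diff_distrib by (rule Bochner_Integration.integral_diff[OF ic im, symmetric])
    also have "\<bar>\<dots>\<bar> \<le> D * a ^ d"
    proof (rule kern_smoothing_le[OF k kc _ D])
      show "\<bar>est1 K n X h J t - marg J t\<bar> \<le> D" if "t \<in> space (leb J)" for t
        unfolding D_def using that I by (intro est_marg_close[OF X h PP _ I(1) I(3) b(1)[OF J] b(2)]) auto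
      show "integrable (leb J) (\<lambda>t. (est1 K n X h J t - marg J t) * kern K \<eta> J (\<lambda>j. t j - x j))"
        unfolding left_diff_distrib by (rule Bochner_Integration.integrable_diff[OF ic im])
    qed
    finally show "\<bar>est1_conv K n X h \<eta> J x - mean \<eta> J x\<bar> \<le> D * a ^ d" .
  qed (use D ad Mg in auto)
  also have "\<dots> \<le> real d * (D * a ^ d) * (a ^ d * M) ^ d"
    using card_meet_le[OF PP P'] D ad Mg a_ge_1 by (intro mult_mono power_increasing) auto
  also have "\<dots> = product_const d bf * D" by (simp add: product_const_def)
  finally show ?thesis unfolding eq D_def .
qed

lemma est_density_close:
  assumes X: "X \<in> good_event z N n" and h: "h \<in> H" and P: "P \<in> indep_partitions d f"
    and b: "\<And>J. J \<in> P \<Longrightarrow> bias K d f h J \<le> ennreal b" "0 \<le> b" and x: "x \<in> {1..d} \<rightarrow>\<^sub>E UNIV"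
  shows "\<bar>est K n X h P x - f x\<bar> \<le> product_const d bf * marg_err b h P"
proof -
  have PP: "P \<in> partitions d" and fx: "f x = (\<Prod>I\<in>P. marg I x)" using P x by (auto simp: indep_partitions_def)
  define D where "D = marg_err b h P"
  have D: "0 \<le> D" unfolding D_def by (rule marg_err_nonneg[OF h PP b(2)])
  have ad: "1 \<le> a ^ d" using a_ge_1 by simp
  have "\<bar>est K n X h P x - f x\<bar> \<le> real (card P) * D * M ^ (card P - 1)"
    unfolding est_def fx
  proof (rule abs_prod_diff_le[OF partitions_finite[OF PP]])
    fix I assume I: "I \<in> P"
    have Ii: "I \<in> index_sets d" by (rule partitions_index_sets[OF PP I])
    show "\<bar>est1 K n X h I x\<bar> \<le> M"
      using abs_est1_le_fbar[OF h d_pos q n Ii, of X x] fbar_eps_le(2)[OF X] by linarith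
    have r: "restrict x I \<in> I \<rightarrow>\<^sub>E UNIV" by auto
    have "marg I x \<le> bf" using marginal_le[OF Ii r] by (simp only: marginal_restrict)
    then show "\<bar>marg I x\<bar> \<le> M" using marginal_nonneg[of I x] M_ge(2) by linarith
    show "\<bar>est1 K n X h I x - marg I x\<bar> \<le> D"
      using est_marg_close[OF X h PP order_refl I _ b(1)[OF I] b(2) r] Ii
      unfolding est1_restrict marginal_restrict D_def by (auto simp: index_sets_def)
  qed (use D M_ge(1) in auto)
  also have "\<dots> \<le> real d * D * M ^ d"
    using card_partition_le[OF PP] D M_ge(1) by (intro mult_mono power_increasing) auto
  \<comment> \<open>The ones are placeholders to be enlarged to a^d, so that this bound shares the
    constant of \<open>est_conv_close\<close>.\<close>
  also have "\<dots> = (real d * 1 * (1 * M) ^ d) * D" by simp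
  also have "\<dots> \<le> product_const d bf * D"
    unfolding product_const_def using D ad M_ge(1) by (intro mult_right_mono mult_mono power_mono mult_left_mono) auto
  finally show ?thesis unfolding D_def .
qed

end

section \<open>The oracle inequality\<close>

lemma epowr_mono: "0 < b \<Longrightarrow> x \<le> y \<Longrightarrow> epowr x b \<le> epowr y b"
proof -
  assume b: "0 < b" and xy: "x \<le> y"
  show ?thesis
  proof (cases "y = \<infinity>")
    case True
    then show ?thesis by (simp add: epowr_def)
  next
    case False
    then have "x \<noteq> \<infinity>" "enn2real x \<le> enn2real y"
      using xy by (auto intro!: enn2real_mono simp: top_unique less_top)
    then show ?thesis using False b by (auto simp: epowr_def intro!: ennreal_leI powr_mono2)
  qed
qed

lemma epowr_ennreal: "0 \<le> x \<Longrightarrow> epowr (ennreal x) b = ennreal (x powr b)"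
  by (simp add: epowr_def)

text \<open>Superadditivity of the q-th power, from u^q = u u^(q-1) \<le> u (x+y)^(q-1). It takes
  the bad-event term out of the q-th moment as an additive remainder.\<close>

lemma powr_add_le:
  fixes x y q :: real
  assumes "0 \<le> x" "0 \<le> y" "1 \<le> q"
  shows "x powr q + y powr q \<le> (x + y) powr q"
proof -
  have *: "u powr q \<le> u * (x + y) powr (q - 1)" if "0 \<le> u" "u \<le> x + y" for u
  proof (cases "u = 0")
    case False
    then have "u powr q = u * u powr (q - 1)" using that by (simp add: powr_mult_base)
    also have "\<dots> \<le> u * (x + y) powr (q - 1)" using that assms by (intro mult_left_mono powr_mono2) auto
    finally show ?thesis .
  qed simp
  have "x powr q + y powr q \<le> x * (x + y) powr (q - 1) + y * (x + y) powr (q - 1)"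
    using assms by (intro add_mono *) auto
  also have "\<dots> = (x + y) * (x + y) powr (q - 1)" by (simp add: distrib_right)
  also have "\<dots> = (x + y) powr q" using assms by (simp add: powr_mult_base)
  finally show ?thesis .
qed

context kernel
begin

text \<open>The 3 collects two uses of the oracle error in the doubled criterion and one in the loss
  of the oracle itself; the 2 is the doubled majorant. The final 1 makes positivity immediate, which
  is needed for dividing by this constant.\<close>

definition oracle_const :: "real \<Rightarrow> nat \<Rightarrow> real \<Rightarrow> real" where
  "oracle_const q d bf = 3 * product_const d bf * (gam_dim q d * size_bound d bf + 1)
     + 2 * (Lam K L q d * real d * size_bound d bf ^ (d\<^sup>2 div 4 + 1) * size_bound d bf) + 1"

definition remainder_const :: "real \<Rightarrow> nat \<Rightarrow> real \<Rightarrow> real" where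
  "remainder_const q d bf = (9 * product_const d bf + 2 * noise_const q d bf) * mesh_const d"

definition tail_const :: "nat \<Rightarrow> real \<Rightarrow> real" where
  "tail_const d bf = 8 * 4 ^ d * (a ^ d + bf)"

lemma Lam_nonneg: "1 \<le> d \<Longrightarrow> 1 \<le> q \<Longrightarrow> 0 \<le> Lam K L q d"
  using Lam_ge_gam[of d L q K] gam_dim_pos[of d q] by (simp add: gam_dim_def)

lemma oracle_const_pos:
  assumes "1 \<le> d" "1 \<le> q" "0 < bf"
  shows "0 < oracle_const q d bf"
proof -
  have "0 \<le> Lam K L q d * real d * size_bound d bf ^ (d\<^sup>2 div 4 + 1) * size_bound d bf"
    using Lam_nonneg[of d q] size_bound_ge(1)[of bf d] assms by simp
  moreover have "0 \<le> 3 * product_const d bf * (gam_dim q d * size_bound d bf + 1)"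
    using product_const_nonneg[of bf d] gam_dim_pos[of d q] size_bound_ge(1)[of bf d] assms by simp
  ultimately show ?thesis unfolding oracle_const_def by linarith
qed

lemma remainder_const_nonneg: "1 \<le> d \<Longrightarrow> 1 \<le> q \<Longrightarrow> 0 < bf \<Longrightarrow> 0 \<le> remainder_const q d bf"
  unfolding remainder_const_def
  using product_const_nonneg[of bf d] noise_const_nonneg[of d q bf] mesh_const_nonneg[of d] by simp

lemma tail_const_pos: "0 < bf \<Longrightarrow> 0 < tail_const d bf"
  unfolding tail_const_def using a_ge_1 by (intro mult_pos_pos add_pos_pos) auto

end

context kde_sample
begin

lemmas Lam0 = Lam_nonneg[OF d_pos q]

lemma lamA_nonneg: "h \<in> H \<Longrightarrow> P \<in> partitions d \<Longrightarrow> 0 \<le> lamA X h P"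
  unfolding lam_def A_n_eq using rate_nonneg[of h P] Lam0 fbar_ge_1[of X] by simp

lemma lamA_le:
  assumes X: "X \<in> good_event z N n" and h: "h \<in> H" and P: "P \<in> partitions d"
  shows "lamA X h P \<le> Lam K L q d * real d * M ^ (d\<^sup>2 div 4 + 1) * M * rate h P"
proof -
  have "lamA X h P = Lam K L q d * real d * fbar X ^ (d\<^sup>2 div 4 + 1) * sqrt (fbar X) * rate h P"
    by (simp add: lam_def A_n_eq)
  also have "\<dots> \<le> Lam K L q d * real d * M ^ (d\<^sup>2 div 4 + 1) * M * rate h P"
    using rate_nonneg[OF h P] Lam0 fbar_ge_1[of X] fbar_eps_le(2)[OF X] sqrt_fbar_le[OF X]
    by (intro mult_right_mono mult_mono mult_left_mono power_mono) auto
  finally show ?thesis .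
qed

lemma supnorm_conv_le_Delta:
  assumes \<eta>: "\<eta> \<in> H" and P': "P' \<in> partitions d"
  shows "supnorm {1..d} (\<lambda>x. est_conv K n X h P \<eta> P' x - est K n X \<eta> P' x)
    \<le> Delta_n K L q d n X h P + ennreal (lamA X \<eta> P')"
proof -
  let ?s = "supnorm {1..d} (\<lambda>x. est_conv K n X h P \<eta> P' x - est K n X \<eta> P' x)"
  have "?s - ennreal (lamA X \<eta> P') \<le> (SUP P' \<in> partitions d.
        supnorm {1..d} (\<lambda>x. est_conv K n X h P \<eta> P' x - est K n X \<eta> P' x) - ennreal (lamA X \<eta> P'))"
    using P' by (rule SUP_upper)
  also have "\<dots> \<le> Delta_n K L q d n X h P"
    unfolding Delta_n_def using \<eta> by (rule SUP_upper)
  finally show ?thesis by (simp add: ennreal_minus_le_iff add.commute)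
qed

text \<open>The two distances to the auxiliary estimator are bounded crosswise: one by
  \<open>Delta_n\<close> at the oracle plus the majorant at the selection, the other with the roles
  exchanged. Regrouped, the four terms are the criteria of both pairs, and minimality leaves twice
  that of the oracle.\<close>

lemma selection_triangle:
  assumes h: "h \<in> H" and P: "P \<in> partitions d" and hh: "hh \<in> H" and Ph: "Ph \<in> partitions d"
    and sel: "criterion K L q d n X hh Ph \<le> criterion K L q d n X h P"
  shows "supnorm {1..d} (\<lambda>x. est K n X hh Ph x - g x)
    \<le> 2 * criterion K L q d n X h P + supnorm {1..d} (\<lambda>x. est K n X h P x - g x)"
proof -
  let ?c = "est_conv K n X h P hh Ph"
  have 1: "supnorm {1..d} (\<lambda>x. est K n X hh Ph x - est K n X h P x)
    \<le> supnorm {1..d} (\<lambda>x. ?c x - est K n X hh Ph x) + supnorm {1..d} (\<lambda>x. ?c x - est K n X h P x)"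
    by (rule supnorm_triangle)
  also have "\<dots> \<le> (Delta_n K L q d n X h P + ennreal (lamA X hh Ph)) + (Delta_n K L q d n X hh Ph + ennreal (lamA X h P))"
    using supnorm_conv_le_Delta[OF hh Ph, of X h P] supnorm_conv_le_Delta[OF h P, of X hh Ph]
    unfolding est_conv_commute[of n X hh Ph h P] by (rule add_mono)
  also have "\<dots> = criterion K L q d n X h P + criterion K L q d n X hh Ph"
    by (simp add: criterion_def ac_simps)
  also have "\<dots> \<le> criterion K L q d n X h P + criterion K L q d n X h P"
    by (intro add_left_mono sel)
  also have "\<dots> = 2 * criterion K L q d n X h P" by (simp add: mult_2)
  finally have 2: "supnorm {1..d} (\<lambda>x. est K n X hh Ph x - est K n X h P x) \<le> 2 * criterion K L q d n X h P" .
  have "supnorm {1..d} (\<lambda>x. est K n X hh Ph x - g x)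
    \<le> supnorm {1..d} (\<lambda>x. est K n X h P x - est K n X hh Ph x) + supnorm {1..d} (\<lambda>x. est K n X h P x - g x)"
    by (rule supnorm_triangle)
  also have "supnorm {1..d} (\<lambda>x. est K n X h P x - est K n X hh Ph x) = supnorm {1..d} (\<lambda>x. est K n X hh Ph x - est K n X h P x)"
    unfolding supnorm_def by (simp add: abs_minus_commute)
  also have "\<dots> + supnorm {1..d} (\<lambda>x. est K n X h P x - g x) \<le> 2 * criterion K L q d n X h P + supnorm {1..d} (\<lambda>x. est K n X h P x - g x)"
    by (intro add_right_mono 2)
  finally show ?thesis .
qed

text \<open>The pivot is the product of the means at \<eta>. The distance of the auxiliary estimator
  from it is an oracle error; the distance of the \<eta>-estimator from it is what the subtracted
  majorant removes, up to order \<epsilon>.\<close>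

lemma Delta_le:
  assumes X: "X \<in> good_event z N n" and h: "h \<in> H" and P: "P \<in> indep_partitions d f"
    and b: "approx_err K d f h P \<le> ennreal b" "0 \<le> b"
  shows "Delta_n K L q d n X h P \<le> ennreal (noise_const q d bf * \<epsilon> + product_const d bf * marg_err b h P)"
  unfolding Delta_n_def
proof (intro SUP_least)
  fix \<eta> P' assume \<eta>: "\<eta> \<in> H" and P': "P' \<in> partitions d"
  have PP: "P \<in> partitions d" using P by (auto simp: indep_partitions_def)
  define e where "e = noise_const q d bf * \<epsilon> + product_const d bf * marg_err b h P"
  have e: "0 \<le> e"
    unfolding e_def using noise_const_nonneg[OF d_pos q bf_pos] eps_nonneg product_const_nonneg[OF bf_pos]
      marg_err_nonneg[OF h PP b(2)] by (intro add_nonneg_nonneg mult_nonneg_nonneg)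
  have bias: "bias K d f h J \<le> ennreal b" if "J \<in> P \<diamond> P'" for J
  proof -
    have "bias K d f h J \<le> (SUP I \<in> P \<diamond> P'. bias K d f h I)" using that by (rule SUP_upper)
    also have "\<dots> \<le> approx_err K d f h P" unfolding approx_err_def using P' by (rule SUP_upper)
    finally show ?thesis using b(1) by (rule order_trans)
  qed
  have "supnorm {1..d} (\<lambda>x. est_conv K n X h P \<eta> P' x - est K n X \<eta> P' x) \<le> ennreal (lamA X \<eta> P' + e)"
  proof (rule supnorm_le)
    fix x :: point
    show "\<bar>est_conv K n X h P \<eta> P' x - est K n X \<eta> P' x\<bar> \<le> lamA X \<eta> P' + e"
      using est_conv_close[OF X h P \<eta> P' bias b(2), of x] prod_est_mean_close[OF X \<eta> P', of x]
      unfolding e_def by linarith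
  qed
  also have "\<dots> = ennreal (lamA X \<eta> P') + ennreal e" using lamA_nonneg[OF \<eta> P'] e by simp
  finally show "supnorm {1..d} (\<lambda>x. est_conv K n X h P \<eta> P' x - est K n X \<eta> P' x) - ennreal (lamA X \<eta> P') \<le> ennreal e"
    by (simp add: ennreal_minus_le_iff add.commute)
qed

lemma eps_le_rate: "\<epsilon> \<le> mesh_const d * real n powr (- 1 / 2)"
proof -
  have "\<epsilon> = mesh_const d * real n powr (- 1)" using n by (simp add: powr_minus_divide)
  also have "\<dots> \<le> mesh_const d * real n powr (- 1 / 2)"
    using n mesh_const_nonneg[of d] by (intro mult_left_mono powr_mono) auto
  finally show ?thesis .
qed

lemma oracle_on_good_event:
  assumes X: "X \<in> good_event z N n" and h: "h \<in> H" and P: "P \<in> indep_partitions d f"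
    and hh: "hh \<in> H" and Ph: "Ph \<in> partitions d"
    and sel: "criterion K L q d n X hh Ph \<le> criterion K L q d n X h P"
  shows "supnorm {1..d} (\<lambda>x. est K n X hh Ph x - f x)
    \<le> ennreal (oracle_const q d bf) * (approx_err K d f h P + ennreal (sqrt (ln (real n) / (real n * min_vol h P))))
      + ennreal (remainder_const q d bf * real n powr (- 1 / 2))"
proof (cases "approx_err K d f h P = \<infinity>")
  case True
  then show ?thesis using oracle_const_pos[OF d_pos q bf_pos] by (simp add: ennreal_mult_top)
next
  case False
  define b where "b = enn2real (approx_err K d f h P)"
  define c where "c = product_const d bf"
  define w where "w = noise_const q d bf"
  define D where "D = marg_err b h P"
  define r where "r = rate h P"
  define C where "C = Lam K L q d * real d * M ^ (d\<^sup>2 div 4 + 1) * M"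
  have PP: "P \<in> partitions d" using P by (auto simp: indep_partitions_def)
  have ab: "approx_err K d f h P = ennreal b" using False by (simp add: b_def less_top)
  have b: "0 \<le> b" by (simp add: b_def)
  have c: "0 \<le> c" unfolding c_def by (rule product_const_nonneg[OF bf_pos])
  have w: "0 \<le> w" unfolding w_def by (rule noise_const_nonneg[OF d_pos q bf_pos])
  have r: "0 \<le> r" unfolding r_def by (rule rate_nonneg[OF h PP])
  have C: "0 \<le> C" unfolding C_def using Lam0 M_ge(1) by simp
  have D: "0 \<le> D" unfolding D_def by (rule marg_err_nonneg[OF h PP b])
  have "bias K d f h J \<le> ennreal b" if "J \<in> P" for J
  proof -
    \<comment> \<open>Meeting with the one-block partition returns P, so the biases of its own
      blocks are already part of \<open>approx_err\<close>.\<close>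
    have m: "J \<in> P \<diamond> {{1..d}}"
      using index_sets_subset[OF partitions_index_sets[OF PP that]] partitions_index_sets[OF PP that] that
      unfolding meet_def index_sets_def by blast
    have "bias K d f h J \<le> (SUP I \<in> P \<diamond> {{1..d}}. bias K d f h I)" using m by (rule SUP_upper)
    also have "\<dots> \<le> approx_err K d f h P" unfolding approx_err_def using trivial_partition[OF d_pos] by (rule SUP_upper)
    finally show ?thesis using ab by simp
  qed
  then have dens: "supnorm {1..d} (\<lambda>x. est K n X h P x - f x) \<le> ennreal (c * D)"
    unfolding c_def D_def using b by (intro supnorm_le est_density_close[OF X h P])
  have crit: "criterion K L q d n X h P \<le> ennreal (w * \<epsilon> + c * D + C * r)"
  proof -
    have "criterion K L q d n X h P \<le> ennreal (w * \<epsilon> + c * D) + ennreal (C * r)"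
      unfolding criterion_def w_def c_def D_def C_def r_def
      by (intro add_mono Delta_le[OF X h P] ennreal_leI lamA_le[OF X h PP] b) (simp add: ab)
    also have "\<dots> = ennreal (w * \<epsilon> + c * D + C * r)"
      using w c D C r eps_nonneg by (intro ennreal_plus[symmetric] add_nonneg_nonneg mult_nonneg_nonneg)
    finally show ?thesis .
  qed
  have "supnorm {1..d} (\<lambda>x. est K n X hh Ph x - f x) \<le> 2 * ennreal (w * \<epsilon> + c * D + C * r) + ennreal (c * D)"
    by (rule order_trans[OF selection_triangle[OF h PP hh Ph sel, of f]]) (intro add_mono mult_left_mono crit dens, simp)
  also have "\<dots> = ennreal (2 * (w * \<epsilon> + c * D + C * r) + c * D)"
  proof -
    have nn: "0 \<le> w * \<epsilon> + c * D + C * r" "0 \<le> c * D"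
      using mult_nonneg_nonneg[OF w eps_nonneg] mult_nonneg_nonneg[OF c D] mult_nonneg_nonneg[OF C r] by linarith+
    have "2 * ennreal (w * \<epsilon> + c * D + C * r) = ennreal (2 * (w * \<epsilon> + c * D + C * r))"
      using nn(1) by (simp add: ennreal_mult del: distrib_left_numeral)
    then show ?thesis using nn by (simp add: ennreal_plus del: distrib_left_numeral)
  qed
  also have "\<dots> \<le> ennreal (oracle_const q d bf * (b + r) + remainder_const q d bf * real n powr (- 1 / 2))"
  proof (rule ennreal_leI)
    have "D = \<gamma> * M * r + 3 * \<epsilon> + b" by (simp add: D_def marg_err_def r_def)
    \<comment> \<open>Three copies of c D, each containing 3 \<epsilon>, give the 9 in
      \<open>remainder_const\<close>.\<close>
    then have "2 * (w * \<epsilon> + c * D + C * r) + c * D = 3 * c * (\<gamma> * M * r + b) + 2 * C * r + (9 * c + 2 * w) * \<epsilon>"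
      by (simp add: algebra_simps)
    also have "\<dots> \<le> (3 * c * (\<gamma> * M + 1) + 2 * C + 1) * (b + r) + (9 * c + 2 * w) * (mesh_const d * real n powr (- 1 / 2))"
    proof (rule add_mono)
      have "0 \<le> 3 * c * (\<gamma> * M * b) + 3 * c * r + 2 * C * b + b + r"
        using c b r C gam_dim_pos[OF d_pos q] M_ge(1) by (intro add_nonneg_nonneg mult_nonneg_nonneg) auto
      then show "3 * c * (\<gamma> * M * r + b) + 2 * C * r \<le> (3 * c * (\<gamma> * M + 1) + 2 * C + 1) * (b + r)"
        by (simp add: algebra_simps)
      show "(9 * c + 2 * w) * \<epsilon> \<le> (9 * c + 2 * w) * (mesh_const d * real n powr (- 1 / 2))"
        using c w by (intro mult_left_mono eps_le_rate) auto
    qed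
    finally show "2 * (w * \<epsilon> + c * D + C * r) + c * D \<le> oracle_const q d bf * (b + r) + remainder_const q d bf * real n powr (- 1 / 2)"
      by (simp add: oracle_const_def remainder_const_def c_def w_def C_def mult.assoc)
  qed
  also have "\<dots> = ennreal (oracle_const q d bf) * (approx_err K d f h P + ennreal (sqrt (ln (real n) / (real n * min_vol h P))))
      + ennreal (remainder_const q d bf * real n powr (- 1 / 2))"
  proof -
    have o: "0 \<le> oracle_const q d bf" using oracle_const_pos[OF d_pos q bf_pos] by simp
    have "0 \<le> remainder_const q d bf" by (rule remainder_const_nonneg[OF d_pos q bf_pos])
    then show ?thesis
      unfolding ab rate_def[symmetric] r_def[symmetric] using o b r by (simp add: ennreal_mult ennreal_plus)
  qed
  finally show ?thesis .
qed

section \<open>The bad event and the risk bound\<close>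

lemma crude_bound:
  assumes hh: "hh \<in> H" and Ph: "Ph \<in> partitions d"
  shows "supnorm {1..d} (\<lambda>x. est K n X hh Ph x - f x) \<le> ennreal ((a ^ d + bf) * real n)"
proof (rule supnorm_le)
  fix x :: point assume x: "x \<in> {1..d} \<rightarrow>\<^sub>E UNIV"
  have "\<bar>est K n X hh Ph x\<bar> \<le> (\<Prod>I\<in>Ph. \<Prod>j\<in>I \<inter> {1..d}. a / hh j)"
    unfolding est_def abs_prod
  proof (rule prod_mono, intro conjI abs_ge_zero)
    fix I assume "I \<in> Ph"
    then have I: "I \<in> index_sets d" by (rule partitions_index_sets[OF Ph])
    have "\<bar>est1 K n X hh I x\<bar> \<le> a ^ card I / vol hh I"
      using abs_est1_le[of K n X hh I x] est_abs_le(1)[OF hh d_pos q n I, of X x] by linarith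
    also have "\<dots> = (\<Prod>j\<in>I \<inter> {1..d}. a / hh j)"
      using index_sets_subset[OF I] by (simp add: Int_absorb2 prod_dividef vol_def)
    finally show "\<bar>est1 K n X hh I x\<bar> \<le> (\<Prod>j\<in>I \<inter> {1..d}. a / hh j)" .
  qed
  also have "\<dots> = a ^ card {1..d} / vol hh {1..d}"
    unfolding partition_prod[OF Ph order_refl] by (simp add: prod_dividef vol_def)
  also have "\<dots> \<le> a ^ d * real n" by (rule est_abs_le(2)[OF hh d_pos q n full_index_set])
  finally have 1: "\<bar>est K n X hh Ph x\<bar> \<le> a ^ d * real n" .
  have "f x \<le> bf" using marginal_le[OF full_index_set x] marginal_full[OF x] by simp
  moreover have "bf * 1 \<le> bf * real n" using bf_pos n by (intro mult_left_mono) auto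
  ultimately show "\<bar>est K n X hh Ph x - f x\<bar> \<le> (a ^ d + bf) * real n"
    using 1 f_nonneg[OF x] by (simp add: distrib_right)
qed

text \<open>Bandwidths and locations contribute N^(2d) = n^(2d(d+4)) together and Bernstein one
  factor n, which the tail exponent cancels. The 4^d is the number of index sets times the loss in N
  + 1 \<le> 2 N.\<close>

lemma bad_event_prob:
  "emeasure (law d f n) (space (law d f n) - good_event z N n) \<le> ennreal (8 * 4 ^ d * real n powr (- (3 / 2 * q)))"
proof -
  have N: "0 < N" using n by simp
  have nr: "0 < real n" using n by simp
  have e: "exp (- z) = real n powr (- tail_exponent q d)" using n by (simp add: powr_def)
  have "real (N + 1) \<le> 2 * real N" using N by simp
  then have N1: "real (N + 1) ^ d \<le> (2 * real N) ^ d" by (intro power_mono) auto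
  have "2 ^ d * (real N ^ d * (8 * real n * exp (- z) * real (N + 1) ^ d))
     \<le> 2 ^ d * (real N ^ d * (8 * real n * exp (- z) * (2 * real N) ^ d))"
    using N1 by (intro mult_left_mono) auto
  also have "\<dots> = 8 * (2 ^ d * 2 ^ d) * (real n * (real N ^ d * real N ^ d) * exp (- z))"
    by (simp add: power_mult_distrib mult_ac)
  also have "(2::real) ^ d * 2 ^ d = 4 ^ d" by (simp add: power_mult_distrib[symmetric])
  also have "real n * (real N ^ d * real N ^ d) * exp (- z) = real n powr (- (3 / 2 * q))"
  proof -
    have "real N ^ d * real N ^ d = real n ^ (2 * d * (d + 4))"
      by (simp add: power_mult[symmetric] power_add[symmetric]) (simp add: algebra_simps)
    also have "\<dots> = real n powr (real (2 * d * (d + 4)))" using nr by (simp only: powr_realpow)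
    finally have "real n * (real N ^ d * real N ^ d) * exp (- z)
      = real n powr 1 * real n powr (real (2 * d * (d + 4))) * real n powr (- tail_exponent q d)"
      unfolding e using nr by simp
    also have "\<dots> = real n powr (1 + real (2 * d * (d + 4)) - tail_exponent q d)"
      by (simp only: powr_add[symmetric] diff_conv_add_uminus)
    also have "1 + real (2 * d * (d + 4)) - tail_exponent q d = - (3 / 2 * q)" by (simp add: tail_exponent_def)
    finally show ?thesis .
  qed
  finally have "2 ^ d * (real N ^ d * (8 * real n * exp (- z) * real (N + 1) ^ d)) \<le> 8 * 4 ^ d * real n powr (- (3 / 2 * q))" .
  then show ?thesis
    using good_event_complement(2)[OF _ z_ge N, of n] n by (meson ennreal_leI order_trans less_le_trans zero_less_numeral)
qed

text \<open>The q-th power of the loss is dominated by a constant plus a multiple of the indicator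
  of the bad event, so only this event has to be measurable. Off the good event n^q meets the
  probability n^(-3q/2), and the q-th root leaves n^(-1/2).\<close>

lemma risk_le:
  assumes T: "T = ennreal t" "0 \<le> t"
    and good: "\<And>X. X \<in> good_event z N n \<Longrightarrow> supnorm {1..d} (\<lambda>x. est K n X (hhat X) (Phat X) x - f x) \<le> T"
    and all: "\<And>X. X \<in> space (law d f n) \<Longrightarrow>
      supnorm {1..d} (\<lambda>x. est K n X (hhat X) (Phat X) x - f x) \<le> ennreal ((a ^ d + bf) * real n)"
  shows "risk K q d n f hhat Phat \<le> T + ennreal (tail_const d bf * real n powr (- 1 / 2))"
proof -
  interpret P: prob_space "law d f n" by (rule prob_space_law)
  let ?bad = "space (law d f n) - good_event z N n"
  let ?s = "\<lambda>X. supnorm {1..d} (\<lambda>x. est K n X (hhat X) (Phat X) x - f x)"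
  define W where "W = (a ^ d + bf) * real n"
  define V where "V = tail_const d bf * real n powr (- 1 / 2)"
  have abf: "0 < a ^ d + bf" using a_ge_1 bf_pos by (intro add_pos_pos) auto
  have W: "0 \<le> W" unfolding W_def using abf by simp
  have V: "0 \<le> V" unfolding V_def tail_const_def using abf by simp
  have bad: "?bad \<in> sets (law d f n)"
    using good_event_complement(1)[OF _ z_ge, of n N] n by auto
  have "(\<integral>\<^sup>+ X. epowr (?s X) q \<partial>law d f n) \<le> (\<integral>\<^sup>+ X. ennreal (t powr q) + ennreal (W powr q) * indicator ?bad X \<partial>law d f n)"
  proof (rule nn_integral_mono)
    fix X assume X: "X \<in> space (law d f n)"
    show "epowr (?s X) q \<le> ennreal (t powr q) + ennreal (W powr q) * indicator ?bad X"
    proof (cases "X \<in> good_event z N n")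
      case True
      have "epowr (?s X) q \<le> epowr T q" using q by (intro epowr_mono good True) auto
      also have "\<dots> = ennreal (t powr q)" using T by (simp add: epowr_ennreal)
      finally show ?thesis by (simp add: add_increasing2)
    next
      case False
      have "epowr (?s X) q \<le> epowr (ennreal W) q" unfolding W_def using q by (intro epowr_mono all X) auto
      also have "\<dots> = ennreal (W powr q)" using W by (simp add: epowr_ennreal)
      finally show ?thesis using X False by (simp add: add_increasing)
    qed
  qed
  also have "\<dots> = ennreal (t powr q) + ennreal (W powr q) * emeasure (law d f n) ?bad"
    using bad by (simp add: nn_integral_add nn_integral_cmult P.emeasure_space_1)
  also have "\<dots> \<le> ennreal (t powr q) + ennreal (W powr q) * ennreal (8 * 4 ^ d * real n powr (- (3 / 2 * q)))"
    by (intro add_left_mono mult_left_mono bad_event_prob) auto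
  also have "\<dots> = ennreal (t powr q + W powr q * (8 * 4 ^ d * real n powr (- (3 / 2 * q))))"
    by (simp add: ennreal_mult ennreal_plus)
  also have "\<dots> \<le> ennreal ((t + V) powr q)"
  proof (rule ennreal_leI)
    have c1: "(1::real) \<le> 8 * 4 ^ d"
      using one_le_power[of "4::real" d] by linarith
    \<comment> \<open>A constant at least 1 does not exceed its q-th power, so it can be moved
      inside V^q.\<close>
    have c: "8 * 4 ^ d \<le> (8 * 4 ^ d :: real) powr q"
      using powr_mono[OF q c1] by simp
    have "W powr q * (8 * 4 ^ d * real n powr (- (3 / 2 * q))) =
      8 * 4 ^ d * ((a ^ d + bf) powr q * (real n powr q * real n powr (- (3 / 2 * q))))"
      unfolding W_def using abf by (simp add: powr_mult mult_ac)
    also have "real n powr q * real n powr (- (3 / 2 * q)) = real n powr ((- 1 / 2) * q)"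
      unfolding powr_add[symmetric] by simp
    also have "8 * 4 ^ d * ((a ^ d + bf) powr q * real n powr ((- 1 / 2) * q)) \<le>
      (8 * 4 ^ d) powr q * ((a ^ d + bf) powr q * real n powr ((- 1 / 2) * q))"
      using c by (intro mult_right_mono) auto
    also have "\<dots> = V powr q"
      unfolding V_def tail_const_def using abf by (simp add: powr_mult powr_powr mult.assoc)
    finally have "t powr q + W powr q * (8 * 4 ^ d * real n powr (- (3 / 2 * q))) \<le> t powr q + V powr q" by simp
    also have "\<dots> \<le> (t + V) powr q" by (rule powr_add_le[OF T(2) V q])
    finally show "t powr q + W powr q * (8 * 4 ^ d * real n powr (- (3 / 2 * q))) \<le> (t + V) powr q" .
  qed
  finally have le: "(\<integral>\<^sup>+ X. epowr (?s X) q \<partial>law d f n) \<le> ennreal ((t + V) powr q)" .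
  have "risk K q d n f hhat Phat \<le> epowr (ennreal ((t + V) powr q)) (1 / q)"
    unfolding risk_def using q by (intro epowr_mono le) auto
  also have "\<dots> = ennreal (t + V)"
    using T(2) V q by (simp add: epowr_ennreal powr_powr)
  also have "\<dots> = T + ennreal V" using T V by (simp add: ennreal_plus)
  finally show ?thesis unfolding V_def .
qed

lemma space_law: "space (law d f n) = space (PiM {1..n} (\<lambda>_. leb {1..d}))"
  by (simp add: law_def space_PiM)

lemma oracle_inequality:
  assumes sel: "is_selection K L q d n hhat Phat"
  shows "risk K q d n f hhat Phat \<le> ennreal (oracle_const q d bf) * oracle_risk K L q d n f
    + ennreal ((remainder_const q d bf + tail_const d bf) * real n powr (- 1 / 2))"
proof -
  define C where "C = ennreal (oracle_const q d bf)"
  define S where "S = ennreal (remainder_const q d bf * real n powr (- 1 / 2))"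
  let ?R = "oracle_risk K L q d n f"
  have o: "0 < oracle_const q d bf" by (rule oracle_const_pos[OF d_pos q bf_pos])
  have rem: "0 \<le> remainder_const q d bf" by (rule remainder_const_nonneg[OF d_pos q bf_pos])
  have C: "C \<noteq> 0" "C \<noteq> top" using o by (auto simp: C_def)
  have tail: "0 \<le> tail_const d bf" using tail_const_pos[OF bf_pos, of d] by simp
  have selX: "hhat X \<in> H" "Phat X \<in> partitions d"
    "\<And>h P. h \<in> H \<Longrightarrow> P \<in> partitions d \<Longrightarrow> criterion K L q d n X (hhat X) (Phat X) \<le> criterion K L q d n X h P"
    if "X \<in> space (law d f n)" for X
    using sel that unfolding is_selection_def space_law by blast+
  have good: "supnorm {1..d} (\<lambda>x. est K n X (hhat X) (Phat X) x - f x) \<le> C * ?R + S" if X: "X \<in> good_event z N n" for X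
  proof -
    let ?s = "supnorm {1..d} (\<lambda>x. est K n X (hhat X) (Phat X) x - f x)"
    have Xs: "X \<in> space (law d f n)" using X by (simp add: good_event_def)
    \<comment> \<open>The infimum defining the oracle risk need not be attained. The bound for each
      (h, P) is therefore solved for its bracket before the infimum is taken; this can be undone
      because C is neither 0 nor infinite.\<close>
    have "(?s - S) / C \<le> ?R"
      unfolding oracle_risk_def
    proof (intro INF_greatest)
      fix h P assume h: "h \<in> H" and P: "P \<in> indep_partitions d f"
      let ?t = "approx_err K d f h P + ennreal (sqrt (ln (real n) / (real n * min_vol h P)))"
      have PP: "P \<in> partitions d" using P by (auto simp: indep_partitions_def)
      have "?s \<le> C * ?t + S"
        unfolding C_def S_def by (rule oracle_on_good_event[OF X h P selX(1,2)[OF Xs] selX(3)[OF Xs h PP]])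
      then have "?s - S \<le> C * ?t"
        by (simp add: ennreal_minus_le_iff add.commute S_def)
      then show "(?s - S) / C \<le> ?t" using C by (intro divide_le_posI_ennreal) (auto simp: zero_less_iff_neq_zero)
    qed
    then have "C * ((?s - S) / C) \<le> C * ?R" by (rule mult_left_mono) simp
    moreover have "C * ((?s - S) / C) = ?s - S"
      using C by (simp add: ennreal_times_divide mult_divide_eq_ennreal mult.commute[of C])
    ultimately have "?s - S \<le> C * ?R" by simp
    then show ?thesis by (simp add: ennreal_minus_le_iff add.commute S_def)
  qed
  show ?thesis
  proof (cases "?R = top")
    case True
    then show ?thesis using C by (simp add: C_def[symmetric] ennreal_mult_top)
  next
    case False
    define t where "t = enn2real (C * ?R + S)"
    have fin: "C * ?R + S < top" using False C by (simp add: S_def ennreal_mult_less_top less_top)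
    then have T: "C * ?R + S = ennreal t" "0 \<le> t" by (simp_all add: t_def)
    have "risk K q d n f hhat Phat \<le> (C * ?R + S) + ennreal (tail_const d bf * real n powr (- 1 / 2))"
      by (rule risk_le[OF T good]) (auto intro!: crude_bound selX)
    also have "\<dots> = C * ?R + ennreal ((remainder_const q d bf + tail_const d bf) * real n powr (- 1 / 2))"
      unfolding S_def using rem tail by (simp add: distrib_right ennreal_plus add.assoc)
    finally show ?thesis unfolding C_def .
  qed
qed

end

theorem theorem1:
  fixes d :: nat and K :: "real \<Rightarrow> real" and L q bf :: real
  assumes "d \<ge> 1"
    and "kernel_cond K L"
    and "q \<ge> 1"
    and "0 < bf"
  shows "\<exists>C1 C2 :: real. 0 < C1 \<and> 0 < C2 \<and>
    (\<forall>f \<in> dens_class d bf. \<forall>n \<ge> 3. \<forall>hhat Phat.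
       is_selection K L q d n hhat Phat \<longrightarrow>
       risk K q d n f hhat Phat
         \<le> ennreal C1 * oracle_risk K L q d n f + ennreal (C2 * real n powr (- 1 / 2)))"
proof -
  interpret kernel K L by unfold_locales (rule assms(2))
  have 1: "0 < oracle_const q d bf" by (rule oracle_const_pos[OF assms(1,3,4)])
  have 2: "0 < remainder_const q d bf + tail_const d bf"
    using remainder_const_nonneg[OF assms(1,3,4)] tail_const_pos[OF assms(4), of d] by linarith
  have "risk K q d n f hhat Phat \<le> ennreal (oracle_const q d bf) * oracle_risk K L q d n f
      + ennreal ((remainder_const q d bf + tail_const d bf) * real n powr (- 1 / 2))"
    if "f \<in> dens_class d bf" "n \<ge> 3" "is_selection K L q d n hhat Phat" for f n hhat Phat
  proof -
    interpret kde_sample K L d f bf q n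
      using that assms by unfold_locales auto
    show ?thesis by (rule oracle_inequality[OF that(3)])
  qed
  then show ?thesis using 1 2 by blast
qed

end
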